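(* Fix $l\in(0,1/2)$, $0<\alpha<\beta<1$ and $\delta>0$. Then $$\lim_{N\to\infty}\max_{x\in V_N^l}\mathbf P\left(\left|\frac{\log|\mathcal H_N(\alpha)\cap D(x,N^\beta)|}{\log N}-2\beta\Big(1-(\alpha/\beta)^2\Big)\right|>\delta\right)=0.$$
   Context: For an integer $N\ge1$ let $V_N=\{1,\dots,N\}^2\subset\mathbb Z^2$, let $\partial V_N$ be the set of points of $V_N$ having a nearest neighbour outside $V_N$, and $\mathrm{int}(V_N)=V_N\setminus\partial V_N$. The two-dimensional discrete Gaussian free field (GFF) on $V_N$ is the centered Gaussian family $\Phi=(\Phi_x)_{x\in V_N}$ (under a probability $\mathbf P$) with $\Phi_x=0$ for $x\in\partial V_N$ and covariance $\mathrm{Cov}(\Phi_x,\Phi_y)=G_N(x,y)=\mathbb E_x\big(\sum_{i=0}^{\tau_{\partial V_N}}\mathbf 1_{\{\eta_i=y\}}\big)$ for $x,y\in\mathrm{int}(V_N)$, where $(\eta_i)_{i\ge0}$ is simple random walk on $\mathbb Z^2$ started at $x$ and $\tau_{\partial V_N}=\inf\{i\ge0:\eta_i\in\partial V_N\}$. Let $g=2/\pi$ and $\log$ the natural logarithm. For $l\in(0,1/2)$, $V_N^l:=\{x\in V_N:\mathrm{dist}(x,V_N^c)\ge lN\}$, and for $\eta\in(0,1)$, $\mathcal H_N(\eta):=\{x\in V_N^l:\Phi_x\ge 2\sqrt g\,\eta\log N\}$ (the $\eta$-high points). $D(x,\rho):=\{y\in V_N:|y-x|\le\rho\}$ (Euclidean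 norm). *)

theory Defs
  imports "HOL-Probability.Probability"
begin

type_synonym pt = "int \<times> int"

definition box :: "nat \<Rightarrow> pt set" where
  "box N = {1..int N} \<times> {1..int N}"

definition nbrs :: "pt \<Rightarrow> pt set" where
  "nbrs x = {(fst x + 1, snd x), (fst x - 1, snd x), (fst x, snd x + 1), (fst x, snd x - 1)}"

definition bdry :: "nat \<Rightarrow> pt set" where
  "bdry N = {x \<in> box N. \<exists>y \<in> nbrs x. y \<notin> box N}"

definition intr :: "nat \<Rightarrow> pt set" where
  "intr N = box N - bdry N"

definition edist :: "pt \<Rightarrow> pt \<Rightarrow> real" where
  "edist x y = sqrt ((real_of_int (fst x - fst y))\<^sup>2 + (real_of_int (snd x - snd y))\<^sup>2)"

text \<open>walk_prob N n x y = P_x(eta_n = y and eta_0,...,eta_n all in int(V_N)) for simple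
  random walk eta on Z^2; equivalently P_x(eta_n = y, n < tau) for y interior.\<close>
fun walk_prob :: "nat \<Rightarrow> nat \<Rightarrow> pt \<Rightarrow> pt \<Rightarrow> real" where
  "walk_prob N 0 x y = (if x = y \<and> x \<in> intr N then 1 else 0)"
| "walk_prob N (Suc n) x y =
     (if x \<in> intr N then (\<Sum>z\<in>nbrs x. walk_prob N n z y / 4) else 0)"

text \<open>Green function G_N(x,y) = E_x (sum_{i=0}^{tau} 1{eta_i = y}) for x, y interior
  (the visit at i = tau is at a boundary point, hence never equals an interior y).\<close>
definition green :: "nat \<Rightarrow> pt \<Rightarrow> pt \<Rightarrow> real" where
  "green N x y = (\<Sum>n. walk_prob N n x y)"

definition gff_cov :: "nat \<Rightarrow> pt \<Rightarrow> pt \<Rightarrow> real" where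
  "gff_cov N x y = (if x \<in> intr N \<and> y \<in> intr N then green N x y else 0)"

definition centered_gaussian_rv :: "'a measure \<Rightarrow> ('a \<Rightarrow> real) \<Rightarrow> real \<Rightarrow> bool" where
  "centered_gaussian_rv M X v \<longleftrightarrow>
     X \<in> borel_measurable M \<and>
     ((v = 0 \<and> (AE \<omega> in M. X \<omega> = 0)) \<or>
      (0 < v \<and> distributed M lborel X (normal_density 0 (sqrt v))))"

definition is_gff :: "'a measure \<Rightarrow> nat \<Rightarrow> ('a \<Rightarrow> pt \<Rightarrow> real) \<Rightarrow> bool" where
  "is_gff M N \<Phi> \<longleftrightarrow>
     prob_space M \<and>
     (\<forall>\<omega>\<in>space M. \<forall>x\<in>bdry N. \<Phi> \<omega> x = 0) \<and>
     (\<forall>c :: pt \<Rightarrow> real. centered_gaussian_rv M (\<lambda>\<omega>. \<Sum>x\<in>box N. c x * \<Phi> \<omega> x)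
        (\<Sum>x\<in>box N. \<Sum>y\<in>box N. c x * c y * gff_cov N x y))"

definition gconst :: real where "gconst = 2 / pi"

definition dist_compl :: "nat \<Rightarrow> pt \<Rightarrow> real" where
  "dist_compl N x = Inf {edist x z | z. z \<notin> box N}"

definition inner_box :: "real \<Rightarrow> nat \<Rightarrow> pt set" where
  "inner_box l N = {x \<in> box N. dist_compl N x \<ge> l * real N}"

definition high_pts :: "real \<Rightarrow> nat \<Rightarrow> real \<Rightarrow> (pt \<Rightarrow> real) \<Rightarrow> pt set" where
  "high_pts l N \<eta> \<phi> = {x \<in> inner_box l N. \<phi> x \<ge> 2 * sqrt gconst * \<eta> * ln (real N)}"

definition disc :: "nat \<Rightarrow> pt \<Rightarrow> real \<Rightarrow> pt set" where
  "disc N x \<rho> = {y \<in> box N. edist y x \<le> \<rho>}"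

end

theory Submission
  imports Defs "HOL-Real_Asymp.Real_Asymp"
begin

text \<open>
  For a finite set \<open>S\<close> of interior points let \<open>R\<^sub>y\<close> be the field at \<open>y\<close> minus its harmonic extension from
  outside \<open>S\<close>. Summation by parts shows that \<open>R\<close> has the Green function of \<open>S\<close> as covariance, that nested
  sets give nested decompositions, and that separated sets give uncorrelated fields. The discrete
  Laplacian of \<open>ln |z|\<close> is \<open>O(|z| powr -4)\<close> and has total mass \<open>pi / 2\<close>, so the Green function of a box of
  radius \<open>n\<close> at its centre is \<open>2 / pi * ln n + O(1)\<close>. Every probabilistic estimate is read off from
  exponential moments of linear functionals of the field.

  Upper bound: let \<open>h\<close> be the harmonic average at \<open>x\<close> of the field over the boundary of the box of radius
  \<open>N powr \<beta>\<close>. It is \<open>o(ln N)\<close> with high probability, and \<open>\<Phi>\<^sub>y - h\<close> has variance \<open>2 / pi * \<beta> * ln N + O(1)\<close>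
  inside the box, so Markov's inequality for the number of high points has the right exponent.

  Lower bound: take a row of \<open>N powr \<kappa>\<close> separated boxes of radius about \<open>N powr b\<close>, with \<open>b\<close> slightly below
  \<open>\<beta>\<close>, and apply the second moment method to the sum of \<open>exp (t * R\<^sub>y)\<close> over points \<open>y\<close> at which the harmonic
  averages of \<open>R\<close> at all dyadic scales do not exceed their typical value under the tilted law. With this
  truncation the second moment in one box exceeds the squared first moment by a factor \<open>N powr o(1)\<close>
  only, for \<open>t\<close> up to the critical value. As different boxes are uncorrelated, the relative variance of the
  whole sum tends to zero.
\<close>

section \<open>Green functions of killed walks\<close>

text \<open>Two plain moment computations fail, and this shapes the proof. The expected number of
  high points in the disc is about N^(2\<beta> - 2\<alpha>^2), more than the typical N^(2\<beta> -
  2\<alpha>^2/\<beta>), because it is dominated by rare events on which the whole disc is raised;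
  subtracting the harmonic average at \<open>x\<close> removes them. For the second moment, a pair
  at distance d in a box of radius q carries without truncation an excess factor of order
  (q/d)^(2t^2/pi), which is summable over the box only for t^2 < pi, that is, for \<alpha>/\<beta>
  below 1/sqrt 2. The truncation halves this exponent, which then suffices up to t^2 = 2 pi. The
  slack of \<epsilon> ln N allowed in the truncation still costs a factor N^(t\<epsilon>), so one
  box would only give a success probability that may tend to zero slowly. Averaging over N^\<kappa>
  boxes with \<kappa> > t\<epsilon> repairs this. All Green function errors are additive constants;
  they enter only as constant factors in exponential moments, so no attempt is made to have them
  small.\<close>

definition avg :: "(pt \<Rightarrow> real) \<Rightarrow> pt \<Rightarrow> real" where
  "avg u x = (\<Sum>z\<in>nbrs x. u z) / 4"

lemma finite_nbrs [simp]: "finite (nbrs x)"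
  by (simp add: nbrs_def)

lemma sum_nbrs: "(\<Sum>z\<in>nbrs (a, b). u z) = u (a + 1, b) + u (a - 1, b) + u (a, b + 1) + u (a, b - 1)"
  by (simp add: nbrs_def algebra_simps)

lemma avg_Pair: "avg u (a, b) = (u (a + 1, b) + u (a - 1, b) + u (a, b + 1) + u (a, b - 1)) / 4"
  by (simp add: avg_def sum_nbrs)

lemma nbrs_sym: "y \<in> nbrs x \<longleftrightarrow> x \<in> nbrs y"
  by (cases x; cases y) (auto simp: nbrs_def)

lemma avg_mono: "(\<And>z. z \<in> nbrs x \<Longrightarrow> u z \<le> v z) \<Longrightarrow> avg u x \<le> avg v x"
  by (simp add: avg_def sum_mono divide_right_mono)

lemma avg_cong: "(\<And>z. z \<in> nbrs x \<Longrightarrow> u z = v z) \<Longrightarrow> avg u x = avg v x"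
  by (simp add: avg_def)

lemma avg_add: "avg (\<lambda>z. u z + v z) x = avg u x + avg v x"
  by (simp add: avg_def sum.distrib add_divide_distrib)

lemma avg_diff: "avg (\<lambda>z. u z - v z) x = avg u x - avg v x"
  by (simp add: avg_def sum_subtractf diff_divide_distrib)

lemma avg_cmult: "avg (\<lambda>z. c * u z) x = c * avg u x"
  by (simp add: avg_def sum_distrib_left)

lemma avg_cmult_right: "avg (\<lambda>z. u z * c) x = avg u x * c"
  by (simp add: avg_def sum_distrib_right)

lemma avg_const [simp]: "avg (\<lambda>z. c) x = c"
  by (cases x) (simp add: avg_Pair)

lemma avg_sum: "avg (\<lambda>z. \<Sum>i\<in>I. u i z) x = (\<Sum>i\<in>I. avg (u i) x)"
  by (simp add: avg_def sum_divide_distrib sum.swap [of _ I])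

text \<open>Minimum principle. If the minimum over \<open>S\<close> is negative, take a point of the
  minimising set with the largest first coordinate: its right neighbour is strictly larger and the
  other three are no smaller, so the average exceeds the minimum. Choosing an extremal point
  replaces any argument about connectedness of \<open>S\<close>.\<close>

lemma superharmonic_nonneg:
  assumes "finite S"
    and sup: "\<And>x. x \<in> S \<Longrightarrow> avg u x \<le> u x"
    and bd: "\<And>x z. x \<in> S \<Longrightarrow> z \<in> nbrs x \<Longrightarrow> z \<notin> S \<Longrightarrow> 0 \<le> u z"
    and "x \<in> S"
  shows "0 \<le> u x"
proof (rule ccontr)
  assume neg: "\<not> 0 \<le> u x"
  define m where "m = Min (u ` S)"
  have m_le: "m \<le> u y" if "y \<in> S" for y
    using that \<open>finite S\<close> by (simp add: m_def)
  have "m < 0" using m_le[OF \<open>x \<in> S\<close>] neg by simp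
  define A where "A = {y \<in> S. u y = m}"
  have "m \<in> u ` S" unfolding m_def using assms by (intro Min_in) auto
  then have A: "finite A" "A \<noteq> {}" using \<open>finite S\<close> by (auto simp: A_def)
  define y where "y = arg_max_on fst A"
  have y: "y \<in> A" "\<And>z. z \<in> A \<Longrightarrow> fst z \<le> fst y"
  proof -
    have "Max (fst ` A) \<in> fst ` A" using A by (intro Max_in) auto
    then obtain y0 where y0: "y0 \<in> A" "fst y0 = Max (fst ` A)" by force
    have "is_arg_max fst (\<lambda>z. z \<in> A) y0"
      using y0 A by (auto simp: is_arg_max_linorder)
    then have "is_arg_max fst (\<lambda>z. z \<in> A) y"
      unfolding y_def arg_max_on_def arg_max_def by (rule someI)
    then show "y \<in> A" "\<And>z. z \<in> A \<Longrightarrow> fst z \<le> fst y"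
      by (auto simp: is_arg_max_linorder)
  qed
  obtain a b where ab: "y = (a, b)" by force
  have yS: "(a, b) \<in> S" "u (a, b) = m" using y(1) ab by (auto simp: A_def)
  have ge: "m \<le> u z" if "z \<in> nbrs (a, b)" for z
    using that bd[OF yS(1) that] m_le[of z] \<open>m < 0\<close> by (cases "z \<in> S") auto
  have gt: "m < u (a + 1, b)"
  proof (cases "(a + 1, b) \<in> S")
    case True
    have "(a + 1, b) \<notin> A" using y(2)[of "(a + 1, b)"] ab by auto
    then show ?thesis using True m_le[OF True] by (auto simp: A_def)
  next
    case False
    then have "0 \<le> u (a + 1, b)" by (intro bd[OF yS(1)]) (auto simp: nbrs_def)
    then show ?thesis using \<open>m < 0\<close> by simp
  qed
  have "u (a - 1, b) \<ge> m" "u (a, b + 1) \<ge> m" "u (a, b - 1) \<ge> m"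
    by (auto intro!: ge simp: nbrs_def)
  then have "m < avg u (a, b)" using gt by (simp add: avg_Pair)
  then show False using sup[OF yS(1)] yS(2) by simp
qed

text \<open>Summation by parts: the neighbour relation is symmetric, and since both functions vanish
  off \<open>S\<close> there are no boundary terms.\<close>

lemma sum_avg_swap:
  assumes "finite S" "\<And>x. x \<notin> S \<Longrightarrow> u x = 0" "\<And>x. x \<notin> S \<Longrightarrow> v x = 0"
  shows "(\<Sum>x\<in>S. u x * avg v x) = (\<Sum>x\<in>S. avg u x * v x)"
proof -
  have restr: "(\<Sum>z\<in>nbrs x. w z) = (\<Sum>z | z \<in> S \<and> z \<in> nbrs x. w z)"
    if "\<And>z. z \<notin> S \<Longrightarrow> w z = 0" for w :: "pt \<Rightarrow> real" and x
    using that by (intro sum.mono_neutral_right) auto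
  have "(\<Sum>x\<in>S. u x * avg v x) = (\<Sum>x\<in>S. \<Sum>z | z \<in> S \<and> z \<in> nbrs x. u x * v z / 4)"
    unfolding avg_def by (subst restr) (simp_all add: assms sum_distrib_left sum_divide_distrib)
  also have "\<dots> = (\<Sum>z\<in>S. \<Sum>x | x \<in> S \<and> z \<in> nbrs x. u x * v z / 4)"
    using \<open>finite S\<close> by (intro sum.swap_restrict) auto
  also have "\<dots> = (\<Sum>z\<in>S. \<Sum>x | x \<in> S \<and> x \<in> nbrs z. u x * v z / 4)"
    by (simp add: nbrs_sym)
  also have "\<dots> = (\<Sum>x\<in>S. avg u x * v x)"
    unfolding avg_def by (subst restr) (simp_all add: assms sum_distrib_right sum_divide_distrib)
  finally show ?thesis .
qed

text \<open>The set of survival is a parameter because Green functions of many boxes inside the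
  domain are compared with each other and translated.\<close>

fun killed_walk :: "pt set \<Rightarrow> nat \<Rightarrow> pt \<Rightarrow> pt \<Rightarrow> real" where
  "killed_walk S 0 x y = (if x = y \<and> x \<in> S then 1 else 0)"
| "killed_walk S (Suc n) x y = (if x \<in> S then avg (\<lambda>z. killed_walk S n z y) x else 0)"

definition gr :: "pt set \<Rightarrow> pt \<Rightarrow> pt \<Rightarrow> real" where
  "gr S x y = (\<Sum>n. killed_walk S n x y)"

lemma walk_prob_eq: "walk_prob N n x y = killed_walk (intr N) n x y"
  by (induction n arbitrary: x) (auto simp: avg_def sum_divide_distrib)

lemma green_eq: "green N = gr (intr N)"
  by (intro ext) (simp add: green_def gr_def walk_prob_eq)

lemma killed_walk_nonneg: "0 \<le> killed_walk S n x y"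
  by (induction n arbitrary: x) (auto simp: avg_def intro!: sum_nonneg divide_nonneg_nonneg)

lemma killed_walk_outside: "x \<notin> S \<Longrightarrow> killed_walk S n x y = 0"
  by (cases n) auto

text \<open>The function \<open>m - |x|\<^sup>2\<close> drops by exactly one under averaging, so it dominates the expected
  time spent before leaving \<open>S\<close>.\<close>
lemma killed_walk_summable:
  assumes "finite S"
  shows "summable (\<lambda>n. killed_walk S n x y)"
proof -
  define sq where "sq = (\<lambda>z :: pt. (real_of_int (fst z))\<^sup>2 + (real_of_int (snd z))\<^sup>2)"
  define m where "m = Max (insert 0 (sq ` (S \<union> (\<Union>x\<in>S. nbrs x))))"
  have m: "sq z \<le> m" if "z \<in> S \<union> (\<Union>x\<in>S. nbrs x)" for z
    using that assms by (auto simp: m_def intro!: Max_ge)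
  have avg_sq: "avg sq z = sq z + 1" for z
    by (cases z) (simp add: avg_Pair sq_def power2_eq_square algebra_simps)
  \<comment> \<open>The claim includes the outer neighbours of \<open>S\<close>, since the induction
    step evaluates it at all neighbours of a point of \<open>S\<close>.\<close>
  have bound: "(\<Sum>n<k. killed_walk S n x y) \<le> m - sq x" if "x \<in> S \<union> (\<Union>x\<in>S. nbrs x)" for k x
    using that
  proof (induction k arbitrary: x)
    case 0
    then show ?case using m by auto
  next
    case (Suc k)
    show ?case
    proof (cases "x \<in> S")
      case False
      then show ?thesis using m[OF Suc.prems] by (simp add: killed_walk_outside del: killed_walk.simps)
    next
      case True
      have "(\<Sum>n<Suc k. killed_walk S n x y)
          = killed_walk S 0 x y + (\<Sum>n<k. killed_walk S (Suc n) x y)"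
        by (rule sum.lessThan_Suc_shift)
      also have "(\<Sum>n<k. killed_walk S (Suc n) x y) = avg (\<lambda>z. \<Sum>n<k. killed_walk S n z y) x"
        using True by (simp add: avg_sum)
      also have "\<dots> \<le> avg (\<lambda>z. m - sq z) x"
        using Suc.IH True by (intro avg_mono) blast
      also have "\<dots> = m - sq x - 1" by (simp add: avg_diff avg_sq)
      finally show ?thesis by (auto split: if_splits)
    qed
  qed
  have "(\<Sum>n<k. killed_walk S n x y) \<le> max 0 (m - sq x)" for k
  proof (cases "x \<in> S")
    case True
    then show ?thesis using bound[of x k] by simp
  qed (simp add: killed_walk_outside)
  then show ?thesis
    by (intro summableI_nonneg_bounded killed_walk_nonneg)
qed

lemma gr_nonneg: "finite S \<Longrightarrow> 0 \<le> gr S x y"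
  unfolding gr_def by (intro suminf_nonneg killed_walk_summable killed_walk_nonneg)

lemma gr_outside: "x \<notin> S \<Longrightarrow> gr S x y = 0"
  by (simp add: gr_def killed_walk_outside)

lemma gr_step:
  assumes "finite S" "x \<in> S"
  shows "gr S x y - avg (\<lambda>z. gr S z y) x = (if x = y then 1 else 0)"
proof -
  note sm = killed_walk_summable[OF \<open>finite S\<close>]
  have "gr S x y = killed_walk S 0 x y + (\<Sum>n. killed_walk S (Suc n) x y)"
    unfolding gr_def using suminf_split_head[OF sm, of x y] by simp
  also have "(\<Sum>n. killed_walk S (Suc n) x y) = avg (\<lambda>z. gr S z y) x"
    using assms(2) unfolding gr_def
    by (simp add: avg_def suminf_divide suminf_sum sm summable_sum del: avg_Pair)
  finally show ?thesis using assms(2) by auto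
qed

text \<open>For two points of \<open>S\<close>, apply summation by parts to the two Green functions:
  \<open>1 - avg\<close> turns each of them into a unit mass on \<open>S\<close>. If exactly one
  argument lies in \<open>S\<close>, the value is zero: either the walk starts outside, or the
  function is harmonic on \<open>S\<close> with zero boundary values and the minimum principle
  applies.\<close>

lemma gr_sym:
  assumes "finite S"
  shows "gr S x y = gr S y x"
proof -
  have right0: "gr S x y = 0" if "x \<in> S" "y \<notin> S" for x y
  proof -
    have "0 \<le> - gr S x y"
    proof (rule superharmonic_nonneg[OF \<open>finite S\<close> _ _ \<open>x \<in> S\<close>, of "\<lambda>x. - gr S x y"])
      show "avg (\<lambda>x. - gr S x y) x \<le> - gr S x y" if "x \<in> S" for x
        using gr_step[OF \<open>finite S\<close> that, of y] that \<open>y \<notin> S\<close> avg_cmult[of "-1" "\<lambda>x. gr S x y" x]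
        by (auto split: if_splits)
    qed (simp add: gr_outside)
    then show ?thesis using gr_nonneg[OF \<open>finite S\<close>, of x y] by simp
  qed
  show ?thesis
  proof (cases "x \<in> S \<and> y \<in> S")
    case True
    let ?u = "\<lambda>z. gr S z y" and ?v = "\<lambda>z. gr S z x"
    have "gr S x y = (\<Sum>z\<in>S. ?u z * (?v z - avg ?v z))"
      using True assms by (simp add: gr_step if_distrib cong: if_cong)
    also have "\<dots> = (\<Sum>z\<in>S. (?u z - avg ?u z) * ?v z)"
      using sum_avg_swap[OF assms, of ?u ?v]
      by (simp add: gr_outside right_diff_distrib left_diff_distrib sum_subtractf)
    also have "\<dots> = (\<Sum>z\<in>S. (if z = y then 1 else 0) * ?v z)"
      using assms by (intro sum.cong) (simp_all add: gr_step)
    also have "\<dots> = gr S y x"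
      using True assms by (simp add: if_distrib[of "\<lambda>c. c * _"] cong: if_cong)
    finally show ?thesis .
  next
    case False
    then show ?thesis using right0 gr_outside by (cases "x \<in> S"; cases "y \<in> S") auto
  qed
qed

lemma gr_outside2: "finite S \<Longrightarrow> y \<notin> S \<Longrightarrow> gr S x y = 0"
  using gr_sym gr_outside by metis

lemma gr_step2:
  assumes "finite S" "y \<in> S"
  shows "gr S x y - avg (gr S x) y = (if x = y then 1 else 0)"
proof -
  have "avg (\<lambda>z. gr S z x) y = avg (gr S x) y" using gr_sym[OF assms(1)] by (intro avg_cong) auto
  then show ?thesis using gr_step[OF assms, of x] gr_sym[OF assms(1), of x y] by auto
qed

text \<open>On \<open>S\<close> the unit masses at \<open>y\<close> cancel, so the difference is
  harmonic there, and off \<open>S\<close> only the nonnegative \<open>gr T\<close> is left.\<close>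

lemma gr_mono:
  assumes "finite T" "S \<subseteq> T"
  shows "gr S x y \<le> gr T x y"
proof (cases "x \<in> S \<and> y \<in> S")
  case True
  have fS: "finite S" using assms finite_subset by blast
  have "0 \<le> gr T x y - gr S x y"
  proof (rule superharmonic_nonneg[OF fS _ _, of "\<lambda>x. gr T x y - gr S x y"])
    show "avg (\<lambda>x. gr T x y - gr S x y) z \<le> gr T z y - gr S z y" if "z \<in> S" for z
      using gr_step[OF fS that, of y] gr_step[OF \<open>finite T\<close>, of z y] that \<open>S \<subseteq> T\<close>
      by (auto simp: avg_diff)
  qed (use True gr_nonneg[OF \<open>finite T\<close>] in \<open>auto simp: gr_outside\<close>)
  then show ?thesis by simp
next
  case False
  then show ?thesis
    using gr_nonneg[OF \<open>finite T\<close>] gr_outside gr_outside2 assms finite_subset by metis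
qed

definition shift :: "pt \<Rightarrow> pt \<Rightarrow> pt" where
  "shift c x = (fst c + fst x, snd c + snd x)"

lemma shift_inject [simp]: "shift c x = shift c y \<longleftrightarrow> x = y"
  by (auto simp: shift_def prod_eq_iff)

lemma avg_shift: "avg u (shift c x) = avg (\<lambda>z. u (shift c z)) x"
  by (cases x; cases c) (simp add: shift_def avg_Pair algebra_simps)

lemma gr_shift: "gr (shift c ` S) (shift c x) (shift c y) = gr S x y"
proof -
  have "killed_walk (shift c ` S) n (shift c x) (shift c y) = killed_walk S n x y" for n
    by (induction n arbitrary: x) (auto simp: avg_shift)
  then show ?thesis by (simp add: gr_def)
qed

text \<open>Cut argument: the flow of the gradient of \<open>gr S x\<close> out of any superlevel set is at most one,
  and all edges of the cut contribute with the same sign.\<close>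
lemma gr_gradient:
  assumes "finite S" "w \<in> nbrs z"
  shows "\<bar>gr S x z - gr S x w\<bar> \<le> 4"
proof -
  let ?u = "gr S x"
  have main: "?u z - ?u w \<le> 4" if "w \<in> nbrs z" "?u w < ?u z" for z w
  proof -
    define A where "A = {v \<in> S. ?u z \<le> ?u v}"
    have pos: "0 < ?u z" using that gr_nonneg[OF \<open>finite S\<close>, of x w] by linarith
    have out: "v \<notin> A \<Longrightarrow> ?u v < ?u z" for v
      using pos gr_outside2[OF \<open>finite S\<close>, of v x] by (cases "v \<in> S") (auto simp: A_def)
    have "z \<in> S" using pos gr_outside2[OF \<open>finite S\<close>, of z x] by fastforce
    then have A: "finite A" "z \<in> A" "w \<notin> A" "A \<subseteq> S"
      using that \<open>finite S\<close> by (auto simp: A_def)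
    have "(\<Sum>v\<in>A. ?u v - avg ?u v) = (\<Sum>v\<in>A. if x = v then 1 else 0)"
      using A \<open>finite S\<close> by (intro sum.cong refl gr_step2) blast+
    also have "\<dots> \<le> 1" using A by (simp)
    finally have le1: "(\<Sum>v\<in>A. ?u v - avg ?u v) \<le> 1" .
    have "?u v - avg ?u v = (\<Sum>y | y \<in> A \<and> y \<in> nbrs v. ?u v - ?u y) / 4
        + (\<Sum>y\<in>nbrs v - A. ?u v - ?u y) / 4" for v
    proof -
      have "?u v - avg ?u v = avg (\<lambda>y. ?u v - ?u y) v" by (simp add: avg_diff)
      also have "\<dots> = (\<Sum>y\<in>(nbrs v \<inter> A) \<union> (nbrs v - A). ?u v - ?u y) / 4"
        by (simp add: avg_def Un_Diff_Int Int_Diff_Un)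
      also have "\<dots> = (\<Sum>y\<in>nbrs v \<inter> A. ?u v - ?u y) / 4 + (\<Sum>y\<in>nbrs v - A. ?u v - ?u y) / 4"
        by (subst sum.union_disjoint) (auto simp: add_divide_distrib)
      also have "nbrs v \<inter> A = {y. y \<in> A \<and> y \<in> nbrs v}" by auto
      finally show ?thesis .
    qed
    then have eq: "(\<Sum>v\<in>A. ?u v - avg ?u v) =
       (\<Sum>v\<in>A. \<Sum>y | y \<in> A \<and> y \<in> nbrs v. ?u v - ?u y) / 4 + (\<Sum>v\<in>A. \<Sum>y\<in>nbrs v - A. ?u v - ?u y) / 4"
      by (simp add: sum.distrib sum_divide_distrib)
    \<comment> \<open>An edge with both ends in \<open>A\<close> is counted once in each direction
      with opposite signs, so only the edges leaving \<open>A\<close> remain.\<close>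
    have "(\<Sum>v\<in>A. \<Sum>y | y \<in> A \<and> y \<in> nbrs v. ?u v) = (\<Sum>y\<in>A. \<Sum>v | v \<in> A \<and> y \<in> nbrs v. ?u v)"
      using A by (intro sum.swap_restrict) auto
    also have "\<dots> = (\<Sum>v\<in>A. \<Sum>y | y \<in> A \<and> y \<in> nbrs v. ?u y)"
      by (simp add: nbrs_sym)
    finally have zero: "(\<Sum>v\<in>A. \<Sum>y | y \<in> A \<and> y \<in> nbrs v. ?u v - ?u y) = 0"
      by (simp add: sum_subtractf)
    have nn: "0 \<le> ?u v - ?u y" if "v \<in> A" "y \<in> nbrs v - A" for v y
      using that out[of y] by (auto simp: A_def)
    \<comment> \<open>A single edge of the cut is thus bounded by the whole cut. The constant 4 is
      the degree, from the factor 1/4 in \<open>avg\<close>.\<close>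
    have "?u z - ?u w \<le> (\<Sum>y\<in>nbrs z - A. ?u z - ?u y)"
      using that A nn by (intro member_le_sum[of w]) auto
    also have "\<dots> \<le> (\<Sum>v\<in>A. \<Sum>y\<in>nbrs v - A. ?u v - ?u y)"
      using A nn by (intro member_le_sum[of z]) (auto intro!: sum_nonneg)
    finally show ?thesis using le1 eq zero by simp
  qed
  show ?thesis
    using main[of w z] main[of z w] assms(2) nbrs_sym
    by (cases "?u w < ?u z"; cases "?u z < ?u w") fastforce+
qed

section \<open>The logarithm as an approximately harmonic function\<close>

text \<open>Open ball of the sup norm. The strict inequalities place every exit point at sup
  distance exactly \<open>k\<close>, and make \<open>sqball 0 c\<close> empty, which later serves as
  the finest scale.\<close>

definition sqball :: "nat \<Rightarrow> pt \<Rightarrow> pt set" where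
  "sqball k c = {z. \<bar>fst z - fst c\<bar> < int k \<and> \<bar>snd z - snd c\<bar> < int k}"

lemma sqball_Times:
  "sqball k c = {fst c - int k + 1..fst c + int k - 1} \<times> {snd c - int k + 1..snd c + int k - 1}"
  by (auto simp: sqball_def)

lemma finite_sqball [simp]: "finite (sqball k c)"
  by (simp add: sqball_Times)

lemma card_sqball:
  assumes "1 \<le> k"
  shows "card (sqball k c) = (2 * k - 1)\<^sup>2"
proof -
  have "nat (int k * 2 - 1) = 2 * k - 1" using assms by linarith
  then show ?thesis
    by (simp add: sqball_Times card_cartesian_product power2_eq_square algebra_simps)
qed

lemma card_sqball_le: "real (card (sqball k c)) \<le> 4 * (real k)\<^sup>2"
proof (cases "k = 0")
  case False
  have "(2 * k - 1)\<^sup>2 \<le> (2 * k)\<^sup>2" by (intro power_mono) auto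
  then have "card (sqball k c) \<le> 4 * k\<^sup>2" using False by (simp add: card_sqball)
  then have "real (card (sqball k c)) \<le> real (4 * k\<^sup>2)" by (simp only: of_nat_le_iff)
  then show ?thesis by simp
qed (simp add: sqball_def)

lemma shift_sqball: "shift c ` sqball k z = sqball k (shift c z)"
proof
  show "sqball k (shift c z) \<subseteq> shift c ` sqball k z"
  proof
    fix w assume "w \<in> sqball k (shift c z)"
    then have "(fst w - fst c, snd w - snd c) \<in> sqball k z" "w = shift c (fst w - fst c, snd w - snd c)"
      by (auto simp: sqball_def shift_def algebra_simps)
    then show "w \<in> shift c ` sqball k z" by blast
  qed
qed (auto simp: sqball_def shift_def)

definition nsq :: "pt \<Rightarrow> real" where
  "nsq z = (real_of_int (fst z))\<^sup>2 + (real_of_int (snd z))\<^sup>2"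

definition lnorm :: "pt \<Rightarrow> real" where
  "lnorm z = ln (nsq z) / 2"

text \<open>The discrete Laplacian of the logarithm. The convention \<open>ln 0 = 0\<close> gives
  \<open>mu (0, 0) = 0\<close>: the expected point mass at the origin is smeared over nearby
  points.\<close>

definition mu :: "pt \<Rightarrow> real" where
  "mu z = avg lnorm z - lnorm z"

text \<open>An exit point has sup distance \<open>k\<close> from the centre, hence Euclidean
  distance between \<open>k\<close> and \<open>sqrt 2 * k\<close>; the slack 1 covers
  \<open>ln (sqrt 2)\<close>.\<close>

lemma sqball_boundary:
  assumes "v \<in> sqball k c" "z \<in> nbrs v" "z \<notin> sqball k c"
  shows "z \<in> sqball (Suc k) c" "ln k \<le> lnorm (z - c)" "lnorm (z - c) \<le> ln k + 1"
proof -
  have w: "\<bar>fst (z - c)\<bar> \<le> int k" "\<bar>snd (z - c)\<bar> \<le> int k" "\<bar>fst (z - c)\<bar> = int k \<or> \<bar>snd (z - c)\<bar> = int k"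
    and k: "1 \<le> k"
    using assms by (cases v; auto simp: sqball_def nbrs_def)+
  show "z \<in> sqball (Suc k) c" using w by (auto simp: sqball_def)
  have sq: "(real_of_int (fst (z - c)))\<^sup>2 \<le> (real k)\<^sup>2" "(real_of_int (snd (z - c)))\<^sup>2 \<le> (real k)\<^sup>2"
    using w(1,2) by (metis abs_le_square_iff abs_of_nat of_int_abs of_int_le_iff of_int_of_nat_eq)+
  have "(real_of_int (fst (z - c)))\<^sup>2 = (real k)\<^sup>2 \<or> (real_of_int (snd (z - c)))\<^sup>2 = (real k)\<^sup>2"
    using w(3) by (metis of_int_abs of_int_of_nat_eq power2_abs)
  then have lo: "(real k)\<^sup>2 \<le> nsq (z - c)" unfolding nsq_def by auto
  have up: "nsq (z - c) \<le> 2 * (real k)\<^sup>2" using sq by (simp add: nsq_def)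
  have k2: "0 < (real k)\<^sup>2" using k by simp
  then have pos: "0 < nsq (z - c)" using lo by linarith
  have "ln ((real k)\<^sup>2) \<le> ln (nsq (z - c))" using lo k2 by (intro ln_mono)
  moreover have "ln (nsq (z - c)) \<le> ln (2 * (real k)\<^sup>2)" using up pos by (intro ln_mono)
  moreover have "ln (2::real) \<le> 1" using ln_le_minus_one[of 2] by simp
  ultimately show "ln k \<le> lnorm (z - c)" "lnorm (z - c) \<le> ln k + 1"
    using k by (simp_all add: lnorm_def ln_realpow ln_mult)
qed

text \<open>At the origin both sides vanish, since \<open>ln 0 = 0\<close> and \<open>1 / 0 = 0\<close>.\<close>
lemma mu_bound: "\<bar>mu z\<bar> \<le> 1 / (nsq z)\<^sup>2"
proof -
  obtain a b :: int where z: "z = (a, b)" by force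
  define x y where "x = real_of_int a" and "y = real_of_int b"
  define s where "s = x\<^sup>2 + y\<^sup>2"
  have s_int: "s = real_of_int (a\<^sup>2 + b\<^sup>2)" by (simp add: s_def x_def y_def)
  have nsq_z: "nsq z = s" by (simp add: nsq_def z s_def x_def y_def)
  have mu: "8 * mu z = ln ((x+1)\<^sup>2+y\<^sup>2) + ln ((x-1)\<^sup>2+y\<^sup>2) + ln (x\<^sup>2+(y+1)\<^sup>2) + ln (x\<^sup>2+(y-1)\<^sup>2) - 4 * ln s"
    by (simp add: mu_def z avg_Pair lnorm_def nsq_def x_def y_def s_def)
  have "a\<^sup>2 + b\<^sup>2 \<ge> 0" by simp
  then consider "a\<^sup>2 + b\<^sup>2 = 0" | "a\<^sup>2 + b\<^sup>2 = 1" | "a\<^sup>2 + b\<^sup>2 \<ge> 2" by linarith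
  then show ?thesis
  proof cases
    case 1
    then have "a = 0" "b = 0" by (simp_all add: sum_power2_eq_zero_iff)
    then have "mu z = 0" by (simp add: mu_def z avg_Pair lnorm_def nsq_def)
    then show ?thesis by simp
  next
    case 2
    have "a\<^sup>2 = 0 \<or> a\<^sup>2 = 1" using 2 zero_le_power2[of a] zero_le_power2[of b] by linarith
    then have "(a = 0 \<and> (b = 1 \<or> b = -1)) \<or> ((a = 1 \<or> a = -1) \<and> b = 0)"
      using 2 by (auto simp: power2_eq_1_iff)
    then have "8 * mu z = ln 4 + 2 * ln 2"
      unfolding mu s_def x_def y_def by (auto simp: power2_eq_square)
    moreover have "ln (4::real) = 2 * ln 2" using ln_realpow[of 2 2] by simp
    moreover have "0 < ln (2::real)" "ln (2::real) \<le> 1" using ln_le_minus_one[of 2] by auto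
    ultimately have "\<bar>mu z\<bar> \<le> 1" by linarith
    then show ?thesis using 2 by (simp add: nsq_z s_int)
  next
    case 3
    have s2: "s \<ge> 2" unfolding s_int using 3 by linarith
    have pos: "(x+1)\<^sup>2+y\<^sup>2 > 0" "(x-1)\<^sup>2+y\<^sup>2 > 0" "x\<^sup>2+(y+1)\<^sup>2 > 0" "x\<^sup>2+(y-1)\<^sup>2 > 0"
    proof -
      have *: "u\<^sup>2 + v\<^sup>2 > 0" if "u \<noteq> 0 \<or> v \<noteq> 0" for u v :: real
        using that by (simp add: sum_power2_gt_zero_iff)
      have n1: "x \<noteq> - 1 \<or> y \<noteq> 0" "x \<noteq> 1 \<or> y \<noteq> 0" "x \<noteq> 0 \<or> y \<noteq> -1" "x \<noteq> 0 \<or> y \<noteq> 1"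
        using s2 by (auto simp: s_def)
      then show "(x+1)\<^sup>2+y\<^sup>2 > 0" "(x-1)\<^sup>2+y\<^sup>2 > 0" "x\<^sup>2+(y+1)\<^sup>2 > 0" "x\<^sup>2+(y-1)\<^sup>2 > 0"
        by (auto intro!: *)
    qed
    \<comment> \<open>The product of the values of \<open>nsq\<close> at the four neighbours is (s^2
      - 1)^2 + 16 x^2 y^2. It has no term of order s^3, so its relative deviation \<open>r\<close>
      from s^4 is of order s^(-2); this is the decay of \<open>mu\<close>.\<close>
    define r where "r = (16 * x\<^sup>2 * y\<^sup>2 + 1 - 2 * s\<^sup>2) / s ^ 4"
    let ?P = "((x+1)\<^sup>2+y\<^sup>2) * ((x-1)\<^sup>2+y\<^sup>2) * (x\<^sup>2+(y+1)\<^sup>2) * (x\<^sup>2+(y-1)\<^sup>2)"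
    have "?P = s ^ 4 + (16 * x\<^sup>2 * y\<^sup>2 + 1 - 2 * s\<^sup>2)"
      unfolding s_def by algebra
    also have "16 * x\<^sup>2 * y\<^sup>2 + 1 - 2 * s\<^sup>2 = s ^ 4 * r" using s2 by (simp add: r_def)
    finally have P: "?P = s ^ 4 * (1 + r)" by (simp add: distrib_left)
    have "4 * ln s + ln (1 + r) = ln ?P"
    proof -
      have "0 < ?P" using pos by (intro mult_pos_pos)
      then have "0 < 1 + r" using s2 by (simp add: P zero_less_mult_iff)
      then show ?thesis using s2 by (simp add: P ln_mult ln_realpow)
    qed
    also have "\<dots> = ln ((x+1)\<^sup>2+y\<^sup>2) + ln ((x-1)\<^sup>2+y\<^sup>2) + ln (x\<^sup>2+(y+1)\<^sup>2) + ln (x\<^sup>2+(y-1)\<^sup>2)"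
      using pos by (simp add: ln_mult_pos mult_pos_pos)
    finally have mu_r: "8 * mu z = ln (1 + r)" using mu by linarith
    have xy: "16 * x\<^sup>2 * y\<^sup>2 \<le> 4 * s\<^sup>2"
    proof -
      have "0 \<le> (x\<^sup>2 - y\<^sup>2)\<^sup>2" by simp
      then show ?thesis by (simp add: s_def power2_eq_square algebra_simps)
    qed
    have ss: "s\<^sup>2 \<ge> 4" using s2 power_mono[of 2 s 2] by simp
    have "r \<le> (3 * s\<^sup>2) / s ^ 4"
      unfolding r_def using xy ss by (intro divide_right_mono) auto
    also have "\<dots> = 3 / s\<^sup>2" using s2 by (simp add: field_simps power2_eq_square power4_eq_xxxx)
    finally have r_up: "r \<le> 3 / s\<^sup>2" .
    have "(- 2 * s\<^sup>2) / s ^ 4 \<le> r"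
      unfolding r_def by (intro divide_right_mono) auto
    also have "(- 2 * s\<^sup>2) / s ^ 4 = - 2 / s\<^sup>2" using s2 by (simp add: field_simps power2_eq_square power4_eq_xxxx)
    finally have r_lo: "- 2 / s\<^sup>2 \<le> r" .
    have half: "2 / s\<^sup>2 \<le> 1 / 2" using divide_left_mono[OF ss, of 2] s2 by simp
    have "1 / 2 \<le> 1 + r" using r_lo half by linarith
    have "ln (1 + r) \<le> 3 / s\<^sup>2"
      using ln_le_minus_one[of "1 + r"] r_up \<open>1 / 2 \<le> 1 + r\<close> by linarith
    moreover have "- 4 / s\<^sup>2 \<le> ln (1 + r)"
    proof -
      have "- ln (1 + r) = ln (inverse (1 + r))" using \<open>1 / 2 \<le> 1 + r\<close> by (simp add: ln_inverse)
      also have "\<dots> \<le> inverse (1 + r) - 1" using \<open>1 / 2 \<le> 1 + r\<close> by (intro ln_le_minus_one) auto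
      also have "\<dots> = - r / (1 + r)" using \<open>1 / 2 \<le> 1 + r\<close> by (simp add: field_simps)
      also have "\<dots> \<le> (2 / s\<^sup>2) / (1 + r)"
        using r_lo \<open>1 / 2 \<le> 1 + r\<close> by (intro divide_right_mono) auto
      also have "\<dots> \<le> (2 / s\<^sup>2) / (1 / 2)"
        using \<open>1 / 2 \<le> 1 + r\<close> by (intro divide_left_mono) auto
      finally show ?thesis by simp
    qed
    ultimately have "\<bar>ln (1 + r)\<bar> \<le> 4 / s\<^sup>2"
      using zero_le_power2[of s] by (auto simp: abs_le_iff divide_right_mono intro: order_trans)
    then show ?thesis using mu_r unfolding nsq_z by (simp add: abs_le_iff field_simps)
  qed
qed

text \<open>The weight is the Lipschitz bound for a Green function between \<open>z\<close> and the
  origin. The shell at sup distance n has 8n points, each contributing at most 8/n^3, and 64/n^2 is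
  at most 128 (1/n - 1/(n+1)), so the right-hand side telescopes.\<close>

lemma weighted_mu_bound:
  assumes "1 \<le> n"
  shows "(\<Sum>z\<in>sqball n (0, 0). 4 * real_of_int (\<bar>fst z\<bar> + \<bar>snd z\<bar>) * \<bar>mu z\<bar>) \<le> 128 * (1 - 1 / n)"
  using assms
proof (induction n rule: dec_induct)
  case base
  have "sqball 1 (0, 0) = {(0, 0)}" by (auto simp: sqball_def)
  then show ?case by simp
next
  case (step n)
  let ?t = "\<lambda>z. 4 * real_of_int (\<bar>fst z\<bar> + \<bar>snd z\<bar>) * \<bar>mu z\<bar>"
  let ?A = "sqball (Suc n) (0, 0) - sqball n (0, 0)"
  have sub: "sqball n (0, 0) \<subseteq> sqball (Suc n) (0, 0)" by (auto simp: sqball_def)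
  have "card ?A = (2 * Suc n - 1)\<^sup>2 - (2 * n - 1)\<^sup>2"
    using step.hyps sub by (simp add: card_Diff_subset card_sqball del: mult_Suc_right)
  also have "\<dots> = 8 * n"
    using step.hyps by (cases n) (auto simp: power2_eq_square algebra_simps)
  finally have card: "card ?A = 8 * n" .
  have "?t z \<le> 8 / n ^ 3" if "z \<in> ?A" for z
  proof -
    have z: "\<bar>fst z\<bar> \<le> int n" "\<bar>snd z\<bar> \<le> int n" "\<bar>fst z\<bar> = int n \<or> \<bar>snd z\<bar> = int n"
      using that by (auto simp: sqball_def)
    have "(real n)\<^sup>2 \<le> nsq z"
    proof -
      have "(real_of_int (fst z))\<^sup>2 = (real n)\<^sup>2 \<or> (real_of_int (snd z))\<^sup>2 = (real n)\<^sup>2"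
        using z(3) by (metis of_int_abs of_int_of_nat_eq power2_abs)
      then show ?thesis unfolding nsq_def by auto
    qed
    then have "(real n ^ 2)\<^sup>2 \<le> (nsq z)\<^sup>2" by (intro power_mono) auto
    then have "1 / (nsq z)\<^sup>2 \<le> 1 / (real n) ^ 4"
      using step.hyps by (intro divide_left_mono) (auto simp flip: power_mult intro!: mult_pos_pos)
    then have mu: "\<bar>mu z\<bar> \<le> 1 / (real n) ^ 4" using mu_bound[of z] by linarith
    have "?t z \<le> (4 * real_of_int (int n + int n)) * (1 / (real n) ^ 4)"
      using z(1,2) by (intro mult_mono mu mult_left_mono, simp_all only: of_int_le_iff) auto
    also have "\<dots> = 8 / n ^ 3" using step.hyps by (simp add: field_simps power3_eq_cube power4_eq_xxxx)
    finally show ?thesis .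
  qed
  then have "(\<Sum>z\<in>?A. ?t z) \<le> real (card ?A) * (8 / n ^ 3)"
    by (intro sum_bounded_above) auto
  also have "\<dots> = 64 / n\<^sup>2" using step.hyps by (simp add: card power2_eq_square power3_eq_cube)
  finally have A: "(\<Sum>z\<in>?A. ?t z) \<le> 64 / n\<^sup>2" .
  have "(\<Sum>z\<in>sqball (Suc n) (0, 0). ?t z) = (\<Sum>z\<in>sqball n (0, 0). ?t z) + (\<Sum>z\<in>?A. ?t z)"
    using sum.subset_diff[OF sub, of ?t] by simp
  also have "\<dots> \<le> 128 * (1 - 1 / n) + 64 / n\<^sup>2" using step.IH A by linarith
  also have "\<dots> \<le> 128 * (1 - 1 / Suc n)"
  proof -
    have "64 / (real n)\<^sup>2 = 128 / (real n * (real n + real n))"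
      by (simp add: power2_eq_square)
    also have "\<dots> \<le> 128 / (real n * (real n + 1))"
      using step.hyps by (intro divide_left_mono mult_left_mono) auto
    also have "\<dots> = 128 / n - 128 / (Suc n)" using step.hyps by (simp add: field_simps)
    finally show ?thesis by simp
  qed
  finally show ?case .
qed

section \<open>Total mass of the discrete Laplacian of the logarithm\<close>

lemma second_difference_sum:
  fixes h :: "int \<Rightarrow> real"
  shows "(\<Sum>a = - int n + 1..int n - 1. h (a + 1) + h (a - 1) - 2 * h a)
    = (if n = 0 then 0 else h (int n) - h (int n - 1) + h (- int n) - h (1 - int n))"
proof (induction n)
  case (Suc n)
  show ?case
  proof (cases "n = 0")
    case False
    have "{- int (Suc n) + 1..int (Suc n) - 1} = insert (int n) (insert (- int n) {- int n + 1..int n - 1})"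
      using False by auto
    then have "(\<Sum>a = - int (Suc n) + 1..int (Suc n) - 1. h (a + 1) + h (a - 1) - 2 * h a)
        = (h (int n + 1) + h (int n - 1) - 2 * h (int n)) + ((h (- int n + 1) + h (- int n - 1) - 2 * h (- int n))
        + (\<Sum>a = - int n + 1..int n - 1. h (a + 1) + h (a - 1) - 2 * h a))"
      using False by (simp only:) simp
    also have "\<dots> = h (int n + 1) - h (int n) + h (- int n - 1) - h (- int n)"
    proof -
      have "- int n + 1 = 1 - int n" by simp
      then show ?thesis unfolding Suc using False by (simp only: if_False)
    qed
    finally have *: "(\<Sum>a = - int (Suc n) + 1..int (Suc n) - 1. h (a + 1) + h (a - 1) - 2 * h a)
      = h (int n + 1) - h (int n) + h (- int n - 1) - h (- int n)" .
    have "int (Suc n) = int n + 1" "int (Suc n) - 1 = int n" "- int (Suc n) = - int n - 1" "1 - int (Suc n) = - int n"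
      by auto
    then show ?thesis unfolding * by (simp only: nat.simps if_False)
  qed simp
qed simp

text \<open>Discrete divergence theorem: second differences telescope along rows and columns to the
  outward differences at the sides. By the symmetries of \<open>lnorm\<close> the four sides
  contribute equally, which cancels the 1/4 in \<open>avg\<close>.\<close>

lemma flux_eq:
  assumes "1 \<le> n"
  shows "(\<Sum>z\<in>sqball n (0, 0). mu z)
    = (\<Sum>b = - int n + 1..int n - 1. lnorm (int n, b) - lnorm (int n - 1, b))"
proof -
  let ?I = "{- int n + 1..int n - 1}" and ?f = "\<lambda>a b. lnorm (a, b)"
  have sym: "?f a b = ?f b a" "?f (- a) b = ?f a b" "?f (1 - a) b = ?f (a - 1) b" for a b :: int
    by (auto simp: lnorm_def nsq_def add.commute power2_commute)
  have "(\<Sum>z\<in>sqball n (0, 0). 4 * mu z) = (\<Sum>a\<in>?I. \<Sum>b\<in>?I. 4 * mu (a, b))"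
    by (simp add: sqball_Times sum.cartesian_product split_beta)
  also have "\<dots> = (\<Sum>a\<in>?I. \<Sum>b\<in>?I. ?f (a + 1) b + ?f (a - 1) b - 2 * ?f a b)
      + (\<Sum>a\<in>?I. \<Sum>b\<in>?I. ?f a (b + 1) + ?f a (b - 1) - 2 * ?f a b)"
    unfolding sum.distrib[symmetric] by (intro sum.cong refl) (simp add: mu_def avg_Pair)
  also have "(\<Sum>a\<in>?I. \<Sum>b\<in>?I. ?f (a + 1) b + ?f (a - 1) b - 2 * ?f a b)
      = (\<Sum>b\<in>?I. \<Sum>a\<in>?I. ?f (a + 1) b + ?f (a - 1) b - 2 * ?f a b)"
    by (rule sum.swap)
  also have "(\<Sum>a\<in>?I. \<Sum>b\<in>?I. ?f a (b + 1) + ?f a (b - 1) - 2 * ?f a b)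
      = (\<Sum>b\<in>?I. \<Sum>a\<in>?I. ?f (a + 1) b + ?f (a - 1) b - 2 * ?f a b)"
    by (simp add: sym(1))
  also have "(\<Sum>b\<in>?I. \<Sum>a\<in>?I. ?f (a + 1) b + ?f (a - 1) b - 2 * ?f a b)
      = (\<Sum>b\<in>?I. 2 * (?f (int n) b - ?f (int n - 1) b))"
    using assms by (subst second_difference_sum) (simp add: sym(2,3))
  finally have "(\<Sum>z\<in>sqball n (0, 0). 4 * mu z) = (\<Sum>b\<in>?I. 2 * (?f (int n) b - ?f (int n - 1) b))
      + (\<Sum>b\<in>?I. 2 * (?f (int n) b - ?f (int n - 1) b))" .
  then show ?thesis unfolding sum_distrib_left[symmetric] by linarith
qed

lemma arctan_diff_bounds:
  fixes u v :: real
  assumes "0 \<le> u" "u \<le> v"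
  shows "(v - u) / (1 + v\<^sup>2) \<le> arctan v - arctan u" "arctan v - arctan u \<le> (v - u) / (1 + u\<^sup>2)"
proof -
  have "\<exists>w\<ge>u. w \<le> v \<and> arctan v - arctan u = (v - u) * inverse (1 + w\<^sup>2)"
  proof (cases "u = v")
    case False
    then show ?thesis
      using MVT2[of u v arctan "\<lambda>w. inverse (1 + w\<^sup>2)"] assms DERIV_arctan by (metis less_eq_real_def)
  qed (use assms in auto)
  then obtain w where w: "u \<le> w" "w \<le> v" "arctan v - arctan u = (v - u) / (1 + w\<^sup>2)"
    by (auto simp: divide_inverse)
  have "u\<^sup>2 \<le> w\<^sup>2" "w\<^sup>2 \<le> v\<^sup>2" using assms w by (auto intro: power_mono)
  moreover have "0 \<le> u\<^sup>2" by simp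
  ultimately have *: "0 < 1 + u\<^sup>2" "1 + u\<^sup>2 \<le> 1 + w\<^sup>2" "1 + w\<^sup>2 \<le> 1 + v\<^sup>2" by linarith+
  show "(v - u) / (1 + v\<^sup>2) \<le> arctan v - arctan u" "arctan v - arctan u \<le> (v - u) / (1 + u\<^sup>2)"
    unfolding w(3) using assms * by (auto intro!: divide_left_mono mult_pos_pos)
qed

lemma sum_symmetric_interval:
  fixes h :: "int \<Rightarrow> real"
  assumes "1 \<le> n" "\<And>b. h (- b) = h b"
  shows "(\<Sum>b = - int n + 1..int n - 1. h b) = h 0 + 2 * (\<Sum>b = 1..<n. h (int b))"
  using assms(1)
proof (induction n rule: dec_induct)
  case (step n)
  have "{- int (Suc n) + 1..int (Suc n) - 1} = insert (int n) (insert (- int n) {- int n + 1..int n - 1})"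
    using step.hyps by auto
  then show ?case using step by (simp add: assms(2))
qed simp

text \<open>Comparison of a Riemann sum of p/(p^2 + b^2) with its primitive arctan(b/p), over unit
  intervals on both sides of each b > 0. The term b = 0 is the separate 1/p, and the terms b and -b
  agree.\<close>

lemma sum_inverse_quadratic_bounds:
  fixes p :: real
  assumes "1 \<le> n" "0 < p"
  shows "p * (\<Sum>b = - int n + 1..int n - 1. 1 / (p\<^sup>2 + (real_of_int b)\<^sup>2)) \<le> 1 / p + 2 * arctan ((real n - 1) / p)"
    and "1 / p + 2 * (arctan (n / p) - arctan (1 / p)) \<le> p * (\<Sum>b = - int n + 1..int n - 1. 1 / (p\<^sup>2 + (real_of_int b)\<^sup>2))"
proof -
  have eq: "p * (\<Sum>b = - int n + 1..int n - 1. 1 / (p\<^sup>2 + (real_of_int b)\<^sup>2))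
      = 1 / p + 2 * (\<Sum>b = 1..<n. p / (p\<^sup>2 + (real b)\<^sup>2))"
    using assms by (subst sum_symmetric_interval) (auto simp: sum_distrib_left power2_eq_square algebra_simps)
  have quot: "p / (p\<^sup>2 + c\<^sup>2) = (1 / p) / (1 + (c / p)\<^sup>2)" for c :: real
    using assms by (simp add: field_simps power2_eq_square add_nonneg_eq_0_iff)
  have "(\<Sum>b = 1..<n. p / (p\<^sup>2 + (real b)\<^sup>2)) \<le> (\<Sum>b = 1..<n. arctan (real b / p) - arctan ((real b - 1) / p))"
  proof (intro sum_mono)
    fix b assume "b \<in> {1..<n}"
    then have "(real b / p - (real b - 1) / p) / (1 + (real b / p)\<^sup>2) \<le> arctan (real b / p) - arctan ((real b - 1) / p)"
      using assms by (intro arctan_diff_bounds) (auto simp: divide_right_mono)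
    moreover have "real b / p - (real b - 1) / p = 1 / p" using assms by (simp add: field_simps)
    ultimately show "p / (p\<^sup>2 + (real b)\<^sup>2) \<le> arctan (real b / p) - arctan ((real b - 1) / p)"
      by (simp add: quot)
  qed
  also have "\<dots> = arctan ((real n - 1) / p)"
    using assms(1)
  proof (induction n rule: dec_induct)
    case (step n)
    then show ?case by (simp add: sum.atLeastLessThan_Suc)
  qed simp
  finally show "p * (\<Sum>b = - int n + 1..int n - 1. 1 / (p\<^sup>2 + (real_of_int b)\<^sup>2)) \<le> 1 / p + 2 * arctan ((real n - 1) / p)"
    unfolding eq by simp
  have "arctan (n / p) - arctan (1 / p) = (\<Sum>b = 1..<n. arctan ((real b + 1) / p) - arctan (real b / p))"
    using assms(1)
  proof (induction n rule: dec_induct)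
    case (step n)
    then show ?case by (simp add: sum.atLeastLessThan_Suc add.commute)
  qed simp
  also have "\<dots> \<le> (\<Sum>b = 1..<n. p / (p\<^sup>2 + (real b)\<^sup>2))"
  proof (intro sum_mono)
    fix b assume "b \<in> {1..<n}"
    then have "arctan ((real b + 1) / p) - arctan (real b / p) \<le> ((real b + 1) / p - real b / p) / (1 + (real b / p)\<^sup>2)"
      using assms by (intro arctan_diff_bounds) (auto simp: divide_right_mono)
    moreover have "(real b + 1) / p - real b / p = 1 / p" using assms by (simp add: field_simps)
    ultimately show "arctan ((real b + 1) / p) - arctan (real b / p) \<le> p / (p\<^sup>2 + (real b)\<^sup>2)"
      by (simp add: quot)
  qed
  finally show "1 / p + 2 * (arctan (n / p) - arctan (1 / p)) \<le> p * (\<Sum>b = - int n + 1..int n - 1. 1 / (p\<^sup>2 + (real_of_int b)\<^sup>2))"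
    unfolding eq by simp
qed

text \<open>The continuous flux of the gradient of ln |z| through one side of the square is the
  integral of n/(n^2 + b^2) over [-n, n], that is 2 arctan 1 = pi/2. The difference of
  \<open>lnorm\<close> across the side lies between p/(n^2 + b^2) and n/(p^2 + b^2) with p = n - 1;
  n = 1 is split off because then p = 0.\<close>

lemma flux_bound:
  assumes "1 \<le> n"
  shows "\<bar>(\<Sum>z\<in>sqball n (0, 0). mu z) - pi / 2\<bar> \<le> 8 / n"
proof (cases "n = 1")
  case True
  have "sqball 1 (0, 0) = {(0, 0)}" by (auto simp: sqball_def)
  moreover have "mu (0, 0) = 0" using mu_bound[of "(0, 0)"] by (simp add: nsq_def)
  ultimately show ?thesis using True pi_less_4 by simp
next
  case False
  define p where "p = real n - 1"
  have p: "1 \<le> p" "real n = p + 1" using False assms by (auto simp: p_def)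
  let ?I = "{- int n + 1..int n - 1}"
  have pi: "pi < 4" "0 < pi" by (auto simp: pi_less_4)
  have ratio: "1 + (2 * real n - 1) / (p\<^sup>2 + (real_of_int b)\<^sup>2) = ((real n)\<^sup>2 + (real_of_int b)\<^sup>2) / (p\<^sup>2 + (real_of_int b)\<^sup>2)" for b
  proof -
    have "(real n)\<^sup>2 + (real_of_int b)\<^sup>2 = (p\<^sup>2 + (real_of_int b)\<^sup>2) + (2 * real n - 1)"
      by (simp add: p(2) power2_eq_square algebra_simps)
    moreover have "0 < p\<^sup>2 + (real_of_int b)\<^sup>2" using p by (auto intro!: add_pos_nonneg)
    moreover have "1 + c / d = (d + c) / d" if "0 < d" for c d :: real
      using that by (simp add: add_divide_distrib)
    ultimately show ?thesis by metis
  qed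
  have diff: "lnorm (int n, b) - lnorm (int n - 1, b) = ln (1 + (2 * real n - 1) / (p\<^sup>2 + (real_of_int b)\<^sup>2)) / 2" for b
  proof -
    have pos: "0 < p\<^sup>2 + (real_of_int b)\<^sup>2" "0 < (real n)\<^sup>2 + (real_of_int b)\<^sup>2"
      using p by (auto intro!: add_pos_nonneg)
    have "ln (((real n)\<^sup>2 + (real_of_int b)\<^sup>2) / (p\<^sup>2 + (real_of_int b)\<^sup>2))
        = ln ((real n)\<^sup>2 + (real_of_int b)\<^sup>2) - ln (p\<^sup>2 + (real_of_int b)\<^sup>2)"
      using pos by (intro ln_divide_pos)
    then show ?thesis unfolding ratio by (simp add: lnorm_def nsq_def p_def diff_divide_distrib)
  qed
  have "(\<Sum>z\<in>sqball n (0, 0). mu z) \<le> (\<Sum>b\<in>?I. real n * (1 / (p\<^sup>2 + (real_of_int b)\<^sup>2)))"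
    unfolding flux_eq[OF assms] diff
  proof (intro sum_mono)
    fix b
    have pos: "0 < p\<^sup>2 + (real_of_int b)\<^sup>2" using p by (auto intro!: add_pos_nonneg)
    have "ln (1 + (2 * real n - 1) / (p\<^sup>2 + (real_of_int b)\<^sup>2)) \<le> (2 * real n - 1) / (p\<^sup>2 + (real_of_int b)\<^sup>2)"
      using p pos by (intro ln_add_one_self_le_self) auto
    also have "\<dots> \<le> 2 * real n / (p\<^sup>2 + (real_of_int b)\<^sup>2)"
      using pos by (intro divide_right_mono) auto
    finally show "ln (1 + (2 * real n - 1) / (p\<^sup>2 + (real_of_int b)\<^sup>2)) / 2 \<le> real n * (1 / (p\<^sup>2 + (real_of_int b)\<^sup>2))"
      by (simp add: mult.commute)
  qed
  also have "\<dots> = (real n / p) * (p * (\<Sum>b\<in>?I. 1 / (p\<^sup>2 + (real_of_int b)\<^sup>2)))"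
    using p by (simp add: sum_distrib_left)
  also have "\<dots> \<le> (real n / p) * (1 / p + 2 * arctan ((real n - 1) / p))"
    using p assms by (intro mult_left_mono sum_inverse_quadratic_bounds) auto
  also have "\<dots> = (1 + 1 / p) * (1 / p + pi / 2)"
    using p assms by (simp add: of_nat_diff arctan_one add_divide_distrib)
  also have "\<dots> \<le> pi / 2 + 8 / n"
  proof -
    have "(1 + 1 / p) * (1 / p + pi / 2) = pi / 2 + (1 / p) * (1 + 1 / p + pi / 2)"
      using p by (simp add: field_simps)
    also have "(1 / p) * (1 + 1 / p + pi / 2) \<le> (1 / p) * 4"
    proof (rule mult_left_mono)
      have "1 / p \<le> 1" using p by simp
      then show "1 + 1 / p + pi / 2 \<le> 4" using pi by linarith
    qed (use p in simp)
    also have "(1 / p) * 4 \<le> 8 / n" unfolding p(2) using p(1) by (simp add: field_simps)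
    finally show ?thesis by simp
  qed
  finally have up: "(\<Sum>z\<in>sqball n (0, 0). mu z) \<le> pi / 2 + 8 / n" .
  have "pi / 2 - 8 / n \<le> (p / n) * (1 / n + 2 * (pi / 4 - 1 / n))"
  proof -
    have "(p / n) * (1 / n + 2 * (pi / 4 - 1 / n)) = (1 - 1 / n) * (pi / 2 - 1 / n)"
    proof -
      have "p / n = 1 - 1 / n" using assms unfolding p_def by (simp add: diff_divide_distrib)
      then show ?thesis by simp
    qed
    also have "\<dots> = pi / 2 - (1 / n) * (1 + pi / 2 - 1 / n)"
    proof -
      have "(1 - i) * (h - i) = h - i * (1 + h - i)" for i h :: real by algebra
      then show ?thesis .
    qed
    moreover have "(1 / n) * (1 + pi / 2 - 1 / n) \<le> (1 / n) * 8"
    proof (rule mult_left_mono)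
      have "0 \<le> 1 / real n" by simp
      then show "1 + pi / 2 - 1 / n \<le> 8" using pi by linarith
    qed simp
    ultimately show ?thesis by simp
  qed
  also have "\<dots> \<le> (p / n) * (1 / n + 2 * (arctan (n / n) - arctan (1 / n)))"
  proof -
    have "arctan (1 / n) \<le> 1 / n" using arctan_diff_bounds(2)[of 0 "1 / n"] by simp
    then show ?thesis using assms p by (intro mult_left_mono) (auto simp: arctan_one)
  qed
  also have "\<dots> \<le> (p / n) * (n * (\<Sum>b\<in>?I. 1 / ((real n)\<^sup>2 + (real_of_int b)\<^sup>2)))"
    using p assms by (intro mult_left_mono sum_inverse_quadratic_bounds) auto
  also have "\<dots> = (\<Sum>b\<in>?I. p * (1 / ((real n)\<^sup>2 + (real_of_int b)\<^sup>2)))"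
    using assms by (simp add: sum_distrib_left)
  also have "\<dots> \<le> (\<Sum>z\<in>sqball n (0, 0). mu z)"
    unfolding flux_eq[OF assms] diff
  proof (intro sum_mono)
    fix b
    have pos: "0 < p\<^sup>2 + (real_of_int b)\<^sup>2" "0 < (real n)\<^sup>2 + (real_of_int b)\<^sup>2"
      using p assms by (auto intro!: add_pos_nonneg)
    let ?q = "(2 * real n - 1) / (p\<^sup>2 + (real_of_int b)\<^sup>2)"
    have q: "0 \<le> ?q" using pos p by auto
    have eq: "inverse (1 + ?q) = (p\<^sup>2 + (real_of_int b)\<^sup>2) / ((real n)\<^sup>2 + (real_of_int b)\<^sup>2)"
      unfolding ratio by simp
    have "- ln (1 + ?q) = ln (inverse (1 + ?q))" using q by (simp add: ln_inverse)
    also have "\<dots> \<le> inverse (1 + ?q) - 1" using q by (intro ln_le_minus_one) auto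
    also have "\<dots> = - ((2 * real n - 1) / ((real n)\<^sup>2 + (real_of_int b)\<^sup>2))"
      unfolding eq using pos by (simp add: field_simps p(2) power2_eq_square)
    finally have "(2 * real n - 1) / ((real n)\<^sup>2 + (real_of_int b)\<^sup>2) \<le> ln (1 + ?q)"
      by linarith
    moreover have "2 * p / ((real n)\<^sup>2 + (real_of_int b)\<^sup>2) \<le> (2 * real n - 1) / ((real n)\<^sup>2 + (real_of_int b)\<^sup>2)"
      using pos by (intro divide_right_mono) (auto simp: p_def)
    ultimately show "p * (1 / ((real n)\<^sup>2 + (real_of_int b)\<^sup>2)) \<le> ln (1 + ?q) / 2" by (simp add: mult.commute)
  qed
  finally show ?thesis using up by (simp add: abs_le_iff)
qed

lemma gr_lipschitz:
  assumes "finite S"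
  shows "\<bar>gr S x (a, b) - gr S x (c, d)\<bar> \<le> 4 * real_of_int (\<bar>a - c\<bar> + \<bar>b - d\<bar>)"
proof -
  have h: "\<bar>gr S x (a + int k, b) - gr S x (a, b)\<bar> \<le> 4 * k" for a b k
  proof (induction k)
    case (Suc k)
    have "\<bar>gr S x (a + int (Suc k), b) - gr S x (a + int k, b)\<bar> \<le> 4"
      by (rule gr_gradient[OF assms]) (auto simp: nbrs_def)
    then show ?case using Suc by simp
  qed simp
  have v: "\<bar>gr S x (a, b + int k) - gr S x (a, b)\<bar> \<le> 4 * k" for a b k
  proof (induction k)
    case (Suc k)
    have "\<bar>gr S x (a, b + int (Suc k)) - gr S x (a, b + int k)\<bar> \<le> 4"
      by (rule gr_gradient[OF assms]) (auto simp: nbrs_def)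
    then show ?case using Suc by simp
  qed simp
  have "\<bar>gr S x (a, b) - gr S x (c, b)\<bar> \<le> 4 * real_of_int \<bar>a - c\<bar>"
  proof (cases "a \<le> c")
    case True
    then show ?thesis using h[of a "nat (c - a)" b] by (simp add: abs_minus_commute)
  next
    case False
    then show ?thesis using h[of c "nat (a - c)" b] by simp
  qed
  moreover have "\<bar>gr S x (c, b) - gr S x (c, d)\<bar> \<le> 4 * real_of_int \<bar>b - d\<bar>"
  proof (cases "b \<le> d")
    case True
    then show ?thesis using v[of c b "nat (d - b)"] by (simp add: abs_minus_commute)
  next
    case False
    then show ?thesis using v[of c d "nat (b - d)"] by simp
  qed
  ultimately show ?thesis by simp
qed

text \<open>\<open>H\<close> is the harmonic extension of \<open>lnorm\<close> from the boundary. The mass of \<open>mu\<close> is close to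
  \<open>pi / 2\<close> and sits near the origin, where \<open>gr S x\<close> is Lipschitz; this identifies \<open>gr S x 0\<close>.\<close>
lemma gr_sqball_origin:
  assumes "z \<in> sqball n (0, 0)"
  shows "\<bar>gr (sqball n (0, 0)) z (0, 0) - gconst * (ln n - lnorm z)\<bar> \<le> 161"
proof -
  let ?S = "sqball n (0, 0)" and ?o = "(0, 0) :: pt"
  have n: "1 \<le> n" using assms by (auto simp: sqball_def)
  define H where "H = (\<lambda>x. lnorm x + (\<Sum>y\<in>?S. gr ?S x y * mu y))"
  have harm: "avg H x = H x" if "x \<in> ?S" for x
  proof -
    have "avg H x = avg lnorm x + (\<Sum>y\<in>?S. avg (\<lambda>x. gr ?S x y) x * mu y)"
      unfolding H_def by (simp only: avg_add avg_sum avg_cmult_right)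
    also have "\<dots> = avg lnorm x + (\<Sum>y\<in>?S. gr ?S x y * mu y - (if x = y then mu y else 0))"
    proof -
      have avg_gr: "avg (\<lambda>x. gr ?S x y) x = gr ?S x y - (if x = y then 1 else 0)" for y
        using gr_step[OF finite_sqball that, of y] by linarith
      have "mu y * avg (\<lambda>x. gr ?S x y) x = gr ?S x y * mu y - (if x = y then mu y else 0)" for y
        unfolding avg_gr right_diff_distrib by simp
      then show ?thesis by (simp add: mult.commute)
    qed
    also have "\<dots> = H x" using that by (simp add: sum_subtractf H_def mu_def)
    finally show ?thesis .
  qed
  have bd: "ln n \<le> H w \<and> H w \<le> ln n + 1" if "x \<in> ?S" "w \<in> nbrs x" "w \<notin> ?S" for x w
  proof -
    have "ln n \<le> lnorm w" "lnorm w \<le> ln n + 1"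
      using sqball_boundary(2,3)[OF that] by (simp_all flip: zero_prod_def)
    then show ?thesis using that by (simp add: H_def gr_outside)
  qed
  have "0 \<le> H z - ln n"
  proof (rule superharmonic_nonneg[where S = ?S and u = "\<lambda>x. H x - ln n"])
    show "avg (\<lambda>x. H x - ln n) x \<le> H x - ln n" if "x \<in> ?S" for x
      using harm[OF that] by (simp only: avg_diff avg_const)
    show "0 \<le> H w - ln n" if "x \<in> ?S" "w \<in> nbrs x" "w \<notin> ?S" for x w
      using bd[OF that] by simp
  qed (use assms in auto)
  moreover have "0 \<le> (ln n + 1) - H z"
  proof (rule superharmonic_nonneg[where S = ?S and u = "\<lambda>x. (ln n + 1) - H x"])
    show "avg (\<lambda>x. (ln n + 1) - H x) x \<le> (ln n + 1) - H x" if "x \<in> ?S" for x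
      using harm[OF that] by (simp only: avg_diff avg_const)
    show "0 \<le> (ln n + 1) - H w" if "x \<in> ?S" "w \<in> nbrs x" "w \<notin> ?S" for x w
      using bd[OF that] by simp
  qed (use assms finite_sqball in blast)+
  ultimately have Hz: "\<bar>(\<Sum>y\<in>?S. gr ?S z y * mu y) - (ln n - lnorm z)\<bar> \<le> 1"
    by (simp add: H_def abs_le_iff)
  have "\<bar>(\<Sum>y\<in>?S. gr ?S z y * mu y) - gr ?S z ?o * (\<Sum>y\<in>?S. mu y)\<bar> = \<bar>\<Sum>y\<in>?S. (gr ?S z y - gr ?S z ?o) * mu y\<bar>"
    by (simp add: sum_distrib_left left_diff_distrib sum_subtractf)
  also have "\<dots> \<le> (\<Sum>y\<in>?S. \<bar>(gr ?S z y - gr ?S z ?o) * mu y\<bar>)" by (rule sum_abs)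
  also have "\<dots> \<le> (\<Sum>y\<in>?S. 4 * real_of_int (\<bar>fst y\<bar> + \<bar>snd y\<bar>) * \<bar>mu y\<bar>)"
  proof (intro sum_mono)
    fix y :: pt
    have "\<bar>gr ?S z y - gr ?S z ?o\<bar> \<le> 4 * real_of_int (\<bar>fst y\<bar> + \<bar>snd y\<bar>)"
      using gr_lipschitz[OF finite_sqball, of n ?o z "fst y" "snd y" 0 0] by simp
    then show "\<bar>(gr ?S z y - gr ?S z ?o) * mu y\<bar> \<le> 4 * real_of_int (\<bar>fst y\<bar> + \<bar>snd y\<bar>) * \<bar>mu y\<bar>"
      unfolding abs_mult by (intro mult_right_mono) auto
  qed
  also have "\<dots> \<le> 128 * (1 - 1 / n)" using n by (rule weighted_mu_bound)
  also have "\<dots> \<le> 128" by simp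
  finally have err: "\<bar>(\<Sum>y\<in>?S. gr ?S z y * mu y) - gr ?S z ?o * (\<Sum>y\<in>?S. mu y)\<bar> \<le> 128" .
  \<comment> \<open>The Green function vanishes at distance n from the origin, so the Lipschitz
    bound gives at most 4n at the origin. This linear growth is absorbed by the error 8/n of the
    total mass.\<close>
  have "gr ?S z (int n, 0) = 0" by (rule gr_outside2[OF finite_sqball]) (simp add: sqball_def)
  then have "\<bar>gr ?S z ?o\<bar> \<le> 4 * n"
    using gr_lipschitz[OF finite_sqball, of n ?o z 0 0 "int n" 0] by simp
  then have "\<bar>gr ?S z ?o * ((\<Sum>y\<in>?S. mu y) - pi / 2)\<bar> \<le> (4 * n) * (8 / n)"
    unfolding abs_mult by (intro mult_mono flux_bound n) auto
  also have "\<dots> = 32" using n by simp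
  finally have "\<bar>gr ?S z ?o * (\<Sum>y\<in>?S. mu y) - pi / 2 * gr ?S z ?o\<bar> \<le> 32" by (simp add: algebra_simps)
  \<comment> \<open>161 = 1 + 128 + 32: boundary values, weighted mass of \<open>mu\<close>, error
    of the total mass.\<close>
  then have main: "\<bar>pi / 2 * gr ?S z ?o - (ln n - lnorm z)\<bar> \<le> 161" using Hz err by linarith
  have "\<bar>gr ?S z ?o - gconst * (ln n - lnorm z)\<bar> = gconst * \<bar>pi / 2 * gr ?S z ?o - (ln n - lnorm z)\<bar>"
  proof -
    have "gr ?S z ?o - gconst * (ln n - lnorm z) = gconst * (pi / 2 * gr ?S z ?o - (ln n - lnorm z))"
      by (simp add: gconst_def right_diff_distrib)
    then show ?thesis by (simp only: abs_mult) (simp add: gconst_def)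
  qed
  also have "\<dots> \<le> 1 * 161"
    using main pi_ge_two by (intro mult_mono) (auto simp: gconst_def)
  finally show ?thesis by simp
qed

lemma gr_sqball:
  assumes "z \<in> sqball n c"
  shows "\<bar>gr (sqball n c) z c - gconst * (ln n - lnorm (z - c))\<bar> \<le> 161"
proof -
  have eq: "z = shift c (z - c)" "c = shift c (0, 0)" by (auto simp: shift_def)
  have "gr (sqball n c) z c = gr (shift c ` sqball n (0, 0)) (shift c (z - c)) (shift c (0, 0))"
    using eq by (simp add: shift_sqball)
  also have "\<dots> = gr (sqball n (0, 0)) (z - c) (0, 0)" by (rule gr_shift)
  finally show ?thesis using gr_sqball_origin[of "z - c" n] assms by (simp add: sqball_def)
qed

text \<open>The general estimate covers the centre itself, since \<open>lnorm\<close> is 0 at the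
  origin.\<close>

lemma gr_sqball_center:
  assumes "1 \<le> n"
  shows "\<bar>gr (sqball n c) c c - gconst * ln n\<bar> \<le> 161"
  using gr_sqball[of c n c] assms by (simp add: sqball_def lnorm_def nsq_def)

section \<open>Exponential moments of Gaussian functionals\<close>

lemma normal_density_exp:
  assumes "0 < \<sigma>"
  shows "normal_density 0 \<sigma> x * exp (s * x) = exp (s\<^sup>2 * \<sigma>\<^sup>2 / 2) * normal_density (s * \<sigma>\<^sup>2) \<sigma> x"
proof -
  have "- (x - 0)\<^sup>2 / (2 * \<sigma>\<^sup>2) + s * x = s\<^sup>2 * \<sigma>\<^sup>2 / 2 + - (x - s * \<sigma>\<^sup>2)\<^sup>2 / (2 * \<sigma>\<^sup>2)"
    using assms by (simp add: field_simps power2_eq_square)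
  then have "exp (- (x - 0)\<^sup>2 / (2 * \<sigma>\<^sup>2)) * exp (s * x) = exp (s\<^sup>2 * \<sigma>\<^sup>2 / 2) * exp (- (x - s * \<sigma>\<^sup>2)\<^sup>2 / (2 * \<sigma>\<^sup>2))"
    by (simp only: exp_add[symmetric])
  then show ?thesis by (simp add: normal_density_def mult.left_commute mult.commute)
qed

lemma centered_gaussian_exp:
  assumes "prob_space M" "centered_gaussian_rv M X v"
  shows "integrable M (\<lambda>\<omega>. exp (X \<omega>))" "(\<integral>\<omega>. exp (X \<omega>) \<partial>M) = exp (v / 2)"
proof -
  interpret prob_space M by fact
  have X [measurable]: "X \<in> borel_measurable M"
    and cases: "(v = 0 \<and> (AE \<omega> in M. X \<omega> = 0)) \<or> (0 < v \<and> distributed M lborel X (normal_density 0 (sqrt v)))"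
    using assms(2) by (auto simp: centered_gaussian_rv_def)
  have "integrable M (\<lambda>\<omega>. exp (X \<omega>)) \<and> (\<integral>\<omega>. exp (X \<omega>) \<partial>M) = exp (v / 2)"
    using cases
  proof (elim disjE conjE)
    assume v: "v = 0" "AE \<omega> in M. X \<omega> = 0"
    have "integrable M (\<lambda>\<omega>. exp (X \<omega>)) \<longleftrightarrow> integrable M (\<lambda>\<omega>. 1::real)"
      using v by (intro integrable_cong_AE) auto
    moreover have "(\<integral>\<omega>. exp (X \<omega>) \<partial>M) = (\<integral>\<omega>. 1 \<partial>M)"
      using v by (intro integral_cong_AE) auto
    ultimately show ?thesis using v by (simp add: prob_space)
  next
    assume v: "0 < v" and d: "distributed M lborel X (normal_density 0 (sqrt v))"
    have eq: "normal_density 0 (sqrt v) x * exp x = exp (v / 2) * normal_density v (sqrt v) x" for x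
      using normal_density_exp[of "sqrt v" x 1] v by simp
    have "integrable M (\<lambda>\<omega>. exp (X \<omega>))"
      using distributed_integrable[OF d, of exp] v by (simp add: eq)
    moreover have "(\<integral>\<omega>. exp (X \<omega>) \<partial>M) = exp (v / 2)"
      using distributed_integral[OF d, of exp] v by (simp add: eq)
    ultimately show ?thesis by blast
  qed
  then show "integrable M (\<lambda>\<omega>. exp (X \<omega>))" "(\<integral>\<omega>. exp (X \<omega>) \<partial>M) = exp (v / 2)" by auto
qed

definition lin :: "nat \<Rightarrow> (pt \<Rightarrow> real) \<Rightarrow> (pt \<Rightarrow> real) \<Rightarrow> real" where
  "lin N c \<phi> = (\<Sum>x\<in>box N. c x * \<phi> x)"

text \<open>The covariance of \<open>lin N c\<close> and \<open>lin N d\<close> under the field.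
  Random variables are represented by their coefficient vectors, so that covariances become algebra
  with finite sums.\<close>

definition qf :: "nat \<Rightarrow> (pt \<Rightarrow> real) \<Rightarrow> (pt \<Rightarrow> real) \<Rightarrow> real" where
  "qf N c d = (\<Sum>x\<in>box N. \<Sum>y\<in>box N. c x * d y * gff_cov N x y)"

lemma finite_box [simp]: "finite (box N)" by (simp add: box_def)

lemma finite_intr [simp]: "finite (intr N)" by (simp add: intr_def)

lemma intr_subset_box: "intr N \<subseteq> box N" by (auto simp: intr_def)

lemma gff_exp:
  assumes "is_gff M N \<Phi>"
  shows "(\<lambda>\<omega>. lin N c (\<Phi> \<omega>)) \<in> borel_measurable M"
    "integrable M (\<lambda>\<omega>. exp (lin N c (\<Phi> \<omega>)))"
    "(\<integral>\<omega>. exp (lin N c (\<Phi> \<omega>)) \<partial>M) = exp (qf N c c / 2)"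
proof -
  have *: "prob_space M" "centered_gaussian_rv M (\<lambda>\<omega>. lin N c (\<Phi> \<omega>)) (qf N c c)"
    using assms by (simp_all add: is_gff_def lin_def qf_def)
  show "(\<lambda>\<omega>. lin N c (\<Phi> \<omega>)) \<in> borel_measurable M" using *(2) by (simp add: centered_gaussian_rv_def)
  show "integrable M (\<lambda>\<omega>. exp (lin N c (\<Phi> \<omega>)))"
    "(\<integral>\<omega>. exp (lin N c (\<Phi> \<omega>)) \<partial>M) = exp (qf N c c / 2)"
    using centered_gaussian_exp[OF *] by auto
qed

lemma gff_cov_eq: "gff_cov N x y = gr (intr N) x y"
  by (auto simp: gff_cov_def green_eq gr_outside gr_outside2)

lemma lin_add: "lin N (\<lambda>x. c x + d x) \<phi> = lin N c \<phi> + lin N d \<phi>"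
  and lin_diff: "lin N (\<lambda>x. c x - d x) \<phi> = lin N c \<phi> - lin N d \<phi>"
  and lin_cmult: "lin N (\<lambda>x. a * c x) \<phi> = a * lin N c \<phi>"
  by (simp_all add: lin_def sum.distrib sum_subtractf sum_distrib_left algebra_simps)

lemma qf_commute: "qf N c d = qf N d c"
  unfolding qf_def gff_cov_eq
  by (subst sum.swap) (simp add: gr_sym[OF finite_intr] mult.commute)

lemma qf_add_left: "qf N (\<lambda>x. c x + c' x) d = qf N c d + qf N c' d"
  and qf_diff_left: "qf N (\<lambda>x. c x - c' x) d = qf N c d - qf N c' d"
  and qf_cmult_left: "qf N (\<lambda>x. a * c x) d = a * qf N c d"
  by (simp_all add: qf_def sum.distrib sum_subtractf sum_distrib_left algebra_simps)

lemma qf_add_right: "qf N d (\<lambda>x. c x + c' x) = qf N d c + qf N d c'"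
  and qf_diff_right: "qf N d (\<lambda>x. c x - c' x) = qf N d c - qf N d c'"
  and qf_cmult_right: "qf N d (\<lambda>x. a * c x) = a * qf N d c"
  using qf_add_left qf_diff_left qf_cmult_left by (metis qf_commute)+

lemmas qf_bilinear = qf_add_left qf_diff_left qf_cmult_left qf_add_right qf_diff_right qf_cmult_right

section \<open>Covariances of the fields localised to subdomains\<close>

definition unit_at :: "pt \<Rightarrow> pt \<Rightarrow> real" where
  "unit_at y x = (if x = y then 1 else 0)"

lemma lin_unit_at: "y \<in> box N \<Longrightarrow> lin N (unit_at y) \<phi> = \<phi> y"
  by (simp add: lin_def unit_at_def if_distrib[of "\<lambda>c. c * _"] cong: if_cong)

lemma qf_unit_at:
  assumes "y \<in> box N" "z \<in> box N"
  shows "qf N (unit_at y) (unit_at z) = gr (intr N) y z"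
proof -
  have "qf N (unit_at y) (unit_at z) = (\<Sum>x\<in>box N. if x = y then (\<Sum>w\<in>box N. if w = z then gff_cov N x w else 0) else 0)"
    unfolding qf_def unit_at_def by (rule sum.cong[OF refl]) (auto simp: if_distrib[of "\<lambda>c. c * _"] cong: if_cong)
  then show ?thesis using assms by (simp add: gff_cov_eq)
qed

text \<open>The coefficients of \<open>\<Phi>\<^sub>y\<close> minus its harmonic extension from outside \<open>S\<close>: minus the exit
  distribution of the walk from \<open>S\<close>, plus a unit mass at \<open>y\<close>.\<close>
definition rho :: "pt set \<Rightarrow> pt \<Rightarrow> pt \<Rightarrow> real" where
  "rho S y z = gr S y z - avg (gr S y) z"

text \<open>\<open>rho S y\<close> is \<open>1 - avg\<close> applied to \<open>gr S y\<close>, while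
  the Green potential \<open>U\<close> of \<open>d\<close> satisfies \<open>U - avg U = d\<close> on
  \<open>intr N\<close>. Summation by parts moves \<open>1 - avg\<close> from one factor to the
  other. All covariances below are instances.\<close>

lemma qf_rho:
  assumes "S \<subseteq> intr N"
  shows "qf N (rho S y) d = (\<Sum>w\<in>S. gr S y w * d w)"
proof -
  let ?T = "intr N"
  have fS: "finite S" by (rule finite_subset[OF assms finite_intr])
  define U where "U = (\<lambda>w. \<Sum>z\<in>?T. gr ?T w z * d z)"
  have U: "U x - avg U x = d x" if "x \<in> ?T" for x
  proof -
    have "avg U x = (\<Sum>z\<in>?T. avg (\<lambda>w. gr ?T w z) x * d z)"
      unfolding U_def by (simp only: avg_sum avg_cmult_right)
    then have "U x - avg U x = (\<Sum>z\<in>?T. (gr ?T x z - avg (\<lambda>w. gr ?T w z) x) * d z)"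
      by (simp add: U_def left_diff_distrib sum_subtractf)
    also have "\<dots> = d x"
      using that by (simp add: gr_step if_distrib[of "\<lambda>c. c * _"] cong: if_cong)
    finally show ?thesis .
  qed
  have U0: "U x = 0" if "x \<notin> ?T" for x using that by (simp add: U_def gr_outside)
  have "(\<Sum>z\<in>box N. c * d z * gff_cov N x z) = c * U x" for x c
  proof -
    have "(\<Sum>z\<in>box N. c * d z * gff_cov N x z) = (\<Sum>z\<in>?T. c * d z * gff_cov N x z)"
      using intr_subset_box by (intro sum.mono_neutral_right) (auto simp: gff_cov_def)
    then show ?thesis by (simp add: U_def gff_cov_eq sum_distrib_left algebra_simps)
  qed
  then have "qf N (rho S y) d = (\<Sum>x\<in>box N. rho S y x * U x)"
    by (simp add: qf_def)
  \<comment> \<open>\<open>rho S y\<close> may also charge the boundary of the domain, but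
    \<open>U\<close> vanishes there.\<close>
  also have "\<dots> = (\<Sum>x\<in>?T. rho S y x * U x)"
    using intr_subset_box U0 by (intro sum.mono_neutral_right) auto
  also have "\<dots> = (\<Sum>x\<in>?T. gr S y x * U x) - (\<Sum>x\<in>?T. avg (gr S y) x * U x)"
    by (simp add: rho_def left_diff_distrib sum_subtractf)
  also have "(\<Sum>x\<in>?T. avg (gr S y) x * U x) = (\<Sum>x\<in>?T. gr S y x * avg U x)"
    using U0 gr_outside2[OF fS] assms by (intro sum_avg_swap[symmetric] finite_intr) blast+
  also have "(\<Sum>x\<in>?T. gr S y x * U x) - (\<Sum>x\<in>?T. gr S y x * avg U x) = (\<Sum>x\<in>?T. gr S y x * (U x - avg U x))"
    by (simp add: right_diff_distrib sum_subtractf)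
  also have "\<dots> = (\<Sum>x\<in>?T. gr S y x * d x)" using U by simp
  also have "\<dots> = (\<Sum>w\<in>S. gr S y w * d w)"
    using assms fS by (intro sum.mono_neutral_right) (auto simp: gr_outside2)
  finally show ?thesis .
qed

lemma qf_rho_unit_at:
  assumes "S \<subseteq> intr N"
  shows "qf N (rho S y) (unit_at z) = gr S y z"
proof -
  have fS: "finite S" by (rule finite_subset[OF assms finite_intr])
  then show ?thesis
    by (simp add: qf_rho[OF assms] unit_at_def if_distrib[of "\<lambda>c. _ * c"] gr_outside2 cong: if_cong)
qed

text \<open>On the smaller set, \<open>rho S' z\<close> is just the unit mass at \<open>z\<close>.
  With \<open>S = S'\<close> this is the covariance of the localised field; in general it says that
  the field of \<open>S\<close> is uncorrelated with the difference of the fields of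
  \<open>S'\<close> and \<open>S\<close>.\<close>

lemma qf_rho_nested:
  assumes "S \<subseteq> S'" "S' \<subseteq> intr N"
  shows "qf N (rho S y) (rho S' z) = gr S y z"
proof -
  have f: "finite S'" "finite S"
    using assms finite_subset[OF _ finite_intr] by (blast intro: order_trans)+
  have "qf N (rho S y) (rho S' z) = (\<Sum>w\<in>S. gr S y w * rho S' z w)"
    using assms by (intro qf_rho) auto
  also have "\<dots> = (\<Sum>w\<in>S. if z = w then gr S y w else 0)"
  proof (intro sum.cong refl)
    fix w assume "w \<in> S"
    then have "rho S' z w = (if z = w then 1 else 0)"
      using assms(1) unfolding rho_def by (intro gr_step2 f) auto
    then show "gr S y w * rho S' z w = (if z = w then gr S y w else 0)" by simp
  qed
  also have "\<dots> = gr S y z" using f by (simp add: gr_outside2)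
  finally show ?thesis .
qed

text \<open>\<open>rho S' z\<close> charges \<open>S'\<close> and its outer neighbours, so the two
  sets must be neither overlapping nor adjacent.\<close>

lemma qf_rho_separated:
  assumes "S \<subseteq> intr N" "S' \<subseteq> intr N" "\<And>w. w \<in> S \<Longrightarrow> w \<notin> S' \<and> nbrs w \<inter> S' = {}"
  shows "qf N (rho S y) (rho S' z) = 0"
proof -
  have f: "finite S'" by (rule finite_subset[OF assms(2) finite_intr])
  have "rho S' z w = 0" if "w \<in> S" for w
  proof -
    have "avg (gr S' z) w = avg (\<lambda>_. 0) w"
      using assms(3)[OF that] gr_outside2[OF f] by (intro avg_cong) blast
    then show ?thesis using assms(3)[OF that] f by (simp add: rho_def gr_outside2)
  qed
  then show ?thesis by (simp add: qf_rho[OF assms(1)])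
qed

lemma rho_empty: "rho {} y = (\<lambda>z. 0)"
proof
  have "gr {} y = (\<lambda>z. 0)" by (intro ext gr_outside) simp
  then show "rho {} y z = 0" for z by (simp add: rho_def)
qed

lemma gff_exp_le:
  assumes "is_gff M N \<Phi>" "f \<in> borel_measurable M" "\<And>\<omega>. \<omega> \<in> space M \<Longrightarrow> 0 \<le> f \<omega>"
    and "\<And>\<omega>. \<omega> \<in> space M \<Longrightarrow> f \<omega> \<le> exp (lin N c (\<Phi> \<omega>) + b)"
  shows "integrable M f" "(\<integral>\<omega>. f \<omega> \<partial>M) \<le> exp (qf N c c / 2 + b)"
proof -
  note g = gff_exp[OF assms(1), of c]
  have int: "integrable M (\<lambda>\<omega>. exp (lin N c (\<Phi> \<omega>) + b))"
    using g by (simp add: exp_add)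
  show "integrable M f"
    using assms(3,4) by (intro Bochner_Integration.integrable_bound[OF int assms(2)] AE_I2) simp
  then have "(\<integral>\<omega>. f \<omega> \<partial>M) \<le> (\<integral>\<omega>. exp (lin N c (\<Phi> \<omega>) + b) \<partial>M)"
    using int assms(4) by (intro integral_mono) auto
  also have "\<dots> = exp (qf N c c / 2 + b)" using g by (simp add: exp_add)
  finally show "(\<integral>\<omega>. f \<omega> \<partial>M) \<le> exp (qf N c c / 2 + b)" .
qed

section \<open>Lower bound\<close>

text \<open>Chebyshev's inequality for the truncated sum, centred at the untruncated mean
  \<open>w\<close>. Truncation lowers the mean by at most \<open>\<eta> * w\<close>, so the mean
  square distance from \<open>w\<close> is at most (1 + \<kappa>) w^2 - 2 (1 - \<eta>) w^2 +
  w^2.\<close>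

lemma (in prob_space) truncated_second_moment:
  fixes \<xi> :: "'i \<Rightarrow> 'a \<Rightarrow> real"
  assumes "finite I"
    and meas [measurable]: "\<And>i. i \<in> I \<Longrightarrow> \<xi> i \<in> borel_measurable M" "\<And>i. i \<in> I \<Longrightarrow> A i \<in> events"
    and nonneg: "\<And>i \<omega>. 0 \<le> \<xi> i \<omega>"
    and int: "\<And>i. i \<in> I \<Longrightarrow> integrable M (\<xi> i)"
    and tail: "\<And>i. i \<in> I \<Longrightarrow> (\<integral>\<omega>. \<xi> i \<omega> * indicator (space M - A i) \<omega> \<partial>M) \<le> \<eta> * expectation (\<xi> i)"
    and int2: "\<And>i j. i \<in> I \<Longrightarrow> j \<in> I \<Longrightarrow> integrable M (\<lambda>\<omega>. \<xi> i \<omega> * \<xi> j \<omega>)"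
    and w: "w = (\<Sum>i\<in>I. expectation (\<xi> i))" "0 < w"
    and pairs: "(\<Sum>i\<in>I. \<Sum>j\<in>I. \<integral>\<omega>. \<xi> i \<omega> * \<xi> j \<omega> * (indicator (A i) \<omega> * indicator (A j) \<omega>) \<partial>M) \<le> (1 + \<kappa>) * w\<^sup>2"
  shows "prob {\<omega> \<in> space M. (\<Sum>i\<in>I. \<xi> i \<omega> * indicator (A i) \<omega>) < w / 2} \<le> 4 * (\<kappa> + 2 * \<eta>)"
proof -
  define X where "X = (\<lambda>\<omega>. \<Sum>i\<in>I. \<xi> i \<omega> * indicator (A i) \<omega>)"
  have X_meas [measurable]: "X \<in> borel_measurable M" unfolding X_def by measurable
  have int_A: "integrable M (\<lambda>\<omega>. \<xi> i \<omega> * indicator (A i) \<omega>)" if "i \<in> I" for i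
    using integrable_mult_indicator[OF meas(2)[OF that] int[OF that]] by (simp add: mult.commute)
  have int_AA: "integrable M (\<lambda>\<omega>. \<xi> i \<omega> * \<xi> j \<omega> * (indicator (A i) \<omega> * indicator (A j) \<omega>))" if "i \<in> I" "j \<in> I" for i j
    using integrable_mult_indicator[OF sets.Int[OF meas(2)[OF that(1)] meas(2)[OF that(2)]] int2[OF that]]
    by (simp add: indicator_inter_arith mult.commute)
  have intX: "integrable M X" unfolding X_def using int_A by (intro Bochner_Integration.integrable_sum)
  have X2: "(X \<omega>)\<^sup>2 = (\<Sum>i\<in>I. \<Sum>j\<in>I. \<xi> i \<omega> * \<xi> j \<omega> * (indicator (A i) \<omega> * indicator (A j) \<omega>))" for \<omega>
    unfolding X_def power2_eq_square sum_product by (intro sum.cong) auto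
  have intX2: "integrable M (\<lambda>\<omega>. (X \<omega>)\<^sup>2)"
    unfolding X2 using int_AA by (intro Bochner_Integration.integrable_sum)
  have EX2: "expectation (\<lambda>\<omega>. (X \<omega>)\<^sup>2) \<le> (1 + \<kappa>) * w\<^sup>2"
  proof -
    have "expectation (\<lambda>\<omega>. (X \<omega>)\<^sup>2) = (\<Sum>i\<in>I. \<Sum>j\<in>I. \<integral>\<omega>. \<xi> i \<omega> * \<xi> j \<omega> * (indicator (A i) \<omega> * indicator (A j) \<omega>) \<partial>M)"
      unfolding X2 using int_AA
      by (subst Bochner_Integration.integral_sum; (intro Bochner_Integration.integrable_sum sum.cong refl Bochner_Integration.integral_sum)?) auto
    then show ?thesis using pairs by simp
  qed
  have "(1 - \<eta>) * expectation (\<xi> i) \<le> expectation (\<lambda>\<omega>. \<xi> i \<omega> * indicator (A i) \<omega>)" if "i \<in> I" for i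
  proof -
    have int_c: "integrable M (\<lambda>\<omega>. \<xi> i \<omega> * indicator (space M - A i) \<omega>)"
      using integrable_mult_indicator[OF sets.compl_sets[OF meas(2)[OF that]] int[OF that]] by (simp add: mult.commute)
    have "expectation (\<xi> i) = expectation (\<lambda>\<omega>. \<xi> i \<omega> * indicator (A i) \<omega> + \<xi> i \<omega> * indicator (space M - A i) \<omega>)"
      by (intro Bochner_Integration.integral_cong) (auto simp: indicator_def)
    also have "\<dots> = expectation (\<lambda>\<omega>. \<xi> i \<omega> * indicator (A i) \<omega>) + expectation (\<lambda>\<omega>. \<xi> i \<omega> * indicator (space M - A i) \<omega>)"
      using int_A[OF that] int_c by (rule Bochner_Integration.integral_add)
    finally show ?thesis using tail[OF that] by (simp add: left_diff_distrib)
  qed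
  then have "(\<Sum>i\<in>I. (1 - \<eta>) * expectation (\<xi> i)) \<le> (\<Sum>i\<in>I. expectation (\<lambda>\<omega>. \<xi> i \<omega> * indicator (A i) \<omega>))"
    by (rule sum_mono)
  also have "\<dots> = expectation X"
    unfolding X_def using int_A by (subst Bochner_Integration.integral_sum) auto
  finally have EX: "(1 - \<eta>) * w \<le> expectation X" by (simp add: w(1) sum_distrib_left)
  have int_sq: "integrable M (\<lambda>\<omega>. (X \<omega> - w)\<^sup>2)"
    using intX intX2 by (simp add: power2_diff)
  have "expectation (\<lambda>\<omega>. (X \<omega> - w)\<^sup>2) = expectation (\<lambda>\<omega>. (X \<omega>)\<^sup>2) - 2 * w * expectation X + w\<^sup>2"
    using intX intX2 by (simp add: power2_diff prob_space algebra_simps)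
  also have "\<dots> \<le> (1 + \<kappa>) * w\<^sup>2 - 2 * w * ((1 - \<eta>) * w) + w\<^sup>2"
    using EX2 EX w(2) by (intro add_mono diff_mono mult_left_mono) auto
  also have "\<dots> = (\<kappa> + 2 * \<eta>) * w\<^sup>2" by (simp add: power2_eq_square algebra_simps)
  finally have var: "expectation (\<lambda>\<omega>. (X \<omega> - w)\<^sup>2) \<le> (\<kappa> + 2 * \<eta>) * w\<^sup>2" .
  have "prob {\<omega> \<in> space M. X \<omega> < w / 2} \<le> prob {\<omega> \<in> space M. (X \<omega> - w)\<^sup>2 \<ge> (w / 2)\<^sup>2}"
  proof (intro finite_measure_mono subsetI CollectI conjI)
    fix \<omega> assume "\<omega> \<in> {\<omega> \<in> space M. X \<omega> < w / 2}"
    then have "w / 2 \<le> w - X \<omega>" by simp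
    then have "(w / 2)\<^sup>2 \<le> (w - X \<omega>)\<^sup>2" using w(2) by (intro power_mono) auto
    then show "(w / 2)\<^sup>2 \<le> (X \<omega> - w)\<^sup>2" by (simp add: power2_commute)
  qed auto
  also have "\<dots> \<le> expectation (\<lambda>\<omega>. (X \<omega> - w)\<^sup>2) / (w / 2)\<^sup>2"
    using w(2) by (intro integral_Markov_inequality_measure[OF int_sq, where A = "{}"]) auto
  also have "\<dots> \<le> (\<kappa> + 2 * \<eta>) * w\<^sup>2 / (w / 2)\<^sup>2"
    using var by (intro divide_right_mono) auto
  also have "\<dots> = 4 * (\<kappa> + 2 * \<eta>)" using w(2) by (simp add: power2_eq_square)
  finally show ?thesis unfolding X_def .
qed

lemma gconst_bounds: "0 < gconst" "gconst \<le> 1" "pi * gconst = 2"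
  using pi_ge_two by (auto simp: gconst_def)

text \<open>The box is caught between balls of radius q and 5q centred at \<open>y\<close>, so the
  variance is the same up to a constant throughout the inner box; 163 is 161 plus a bound 2 for
  \<open>ln 5\<close>.\<close>

lemma gr_inner_bounds:
  assumes "y \<in> sqball q c"
  shows "gconst * ln q - 161 \<le> gr (sqball (4 * q) c) y y" "gr (sqball (4 * q) c) y y \<le> gconst * ln q + 163"
proof -
  have q: "1 \<le> q" using assms by (auto simp: sqball_def)
  have sub: "sqball q y \<subseteq> sqball (4 * q) c" "sqball (4 * q) c \<subseteq> sqball (5 * q) y"
    using assms by (auto simp: sqball_def)
  have "gr (sqball q y) y y \<le> gr (sqball (4 * q) c) y y" by (rule gr_mono[OF finite_sqball sub(1)])
  then show "gconst * ln q - 161 \<le> gr (sqball (4 * q) c) y y"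
    using gr_sqball_center[OF q, of y] by linarith
  have "gr (sqball (4 * q) c) y y \<le> gr (sqball (5 * q) y) y y" by (rule gr_mono[OF finite_sqball sub(2)])
  also have "\<dots> \<le> gconst * ln (5 * q) + 161"
    using gr_sqball_center[of "5 * q" y] q by (simp add: abs_le_iff)
  also have "gconst * ln (5 * q) = gconst * ln 5 + gconst * ln q"
    using q by (simp add: ln_mult distrib_left)
  also have "gconst * ln 5 \<le> 1 * 2"
  proof (intro mult_mono)
    have "(5::real) \<le> exp 2" using exp_lower_Taylor_quadratic[of 2] by simp
    then show "ln (5::real) \<le> 2" using ln_mono[of 5 "exp 2"] by simp
  qed (use gconst_bounds in auto)
  finally show "gr (sqball (4 * q) c) y y \<le> gconst * ln q + 163" by simp
qed

locale gff =
  fixes M :: "'a measure" and N :: nat and \<Phi> :: "'a \<Rightarrow> pt \<Rightarrow> real"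
  assumes is_gff: "is_gff M N \<Phi>"
begin

sublocale prob_space M using is_gff by (simp add: is_gff_def)

abbreviation L :: "(pt \<Rightarrow> real) \<Rightarrow> 'a \<Rightarrow> real" where
  "L c \<omega> \<equiv> lin N c (\<Phi> \<omega>)"

lemma L_measurable [measurable]: "L c \<in> borel_measurable M"
  by (rule gff_exp[OF is_gff])

text \<open>\<open>L (rho S y) - L (rho (sqball k y) y)\<close> is the harmonic average of \<open>L (rho S \<cdot>)\<close> over the
  boundary of the box of radius \<open>k\<close> around \<open>y\<close>. It is required not to exceed the value it typically
  takes when the law is tilted by \<open>exp (t * L (rho S y))\<close>; \<open>k = 0\<close> bounds \<open>L (rho S y)\<close> itself.\<close>
definition good :: "pt set \<Rightarrow> nat set \<Rightarrow> real \<Rightarrow> real \<Rightarrow> pt \<Rightarrow> 'a set" where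
  "good S K t e y = {\<omega> \<in> space M.
     (\<forall>k\<in>K. L (rho S y) \<omega> - L (rho (sqball k y) y) \<omega> \<le> t * (gr S y y - gr (sqball k y) y y) + e) \<and>
     t * gr S y y - e \<le> L (rho S y) \<omega> \<and> - e \<le> L (unit_at y) \<omega> - L (rho S y) \<omega>}"

lemma good_event [measurable]: "countable K \<Longrightarrow> good S K t e y \<in> events"
  unfolding good_def by measurable

lemma exp_integrable: "integrable M (\<lambda>\<omega>. exp (L c \<omega>))"
  by (rule gff_exp[OF is_gff])

text \<open>A union bound under the law tilted by \<open>exp (t * L (rho S y))\<close>. The
  functionals constrained in \<open>good\<close> have tilted means t (V - V_k), tV and 0, where V
  and V_k are the variances for \<open>S\<close> and for the ball of radius k, and each has variance
  at most \<open>D\<close>; so a deviation by \<open>e\<close> costs exp(-e^2/(2D)).\<close>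

lemma good_tail:
  assumes "S \<subseteq> intr N" "finite K" "y \<in> box N" "\<And>k. k \<in> K \<Longrightarrow> sqball k y \<subseteq> S"
    and D: "gr (intr N) y y \<le> D" "0 < D" and "0 < e"
  shows "(\<integral>\<omega>. exp (t * L (rho S y) \<omega>) * indicator (space M - good S K t e y) \<omega> \<partial>M)
    \<le> (real (card K) + 2) * exp (- e\<^sup>2 / (2 * D)) * exp (t\<^sup>2 * gr S y y / 2)"
proof -
  define V where "V = gr S y y"
  \<comment> \<open>The minimiser of s^2 D/2 - s e.\<close>
  define s where "s = e / D"
  have s: "0 < s" using assms by (simp add: s_def)
  have VD: "0 \<le> V" "V \<le> D"
    using gr_mono[OF finite_intr assms(1), of y y] D gr_nonneg[OF finite_subset[OF assms(1) finite_intr]]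
    by (auto simp: V_def)
  have key: "exp (t\<^sup>2 * V / 2 + s\<^sup>2 * v / 2 - s * e) \<le> exp (- e\<^sup>2 / (2 * D)) * exp (t\<^sup>2 * V / 2)" if "v \<le> D" for v
  proof -
    have "s\<^sup>2 * v / 2 - s * e \<le> s\<^sup>2 * D / 2 - s * e" using that by (simp add: mult_left_mono)
    also have "\<dots> = - e\<^sup>2 / (2 * D)" using D by (simp add: s_def power2_eq_square field_simps)
    finally show ?thesis by (simp flip: exp_add)
  qed
  \<comment> \<open>On the violation of a constraint, \<open>exp (t * L (rho S y))\<close> is at
    most itself times exp(s * excess); \<open>c1\<close>, \<open>c2\<close> and \<open>c3\<close>
    are the coefficients of the resulting linear exponents.\<close>
  define c1 where "c1 = (\<lambda>k x. (t + s) * rho S y x - s * rho (sqball k y) y x)"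
  define b1 where "b1 = (\<lambda>k. - (s * (t * (V - gr (sqball k y) y y) + e)))"
  define c2 where "c2 = (\<lambda>x. (t - s) * rho S y x)"
  define c3 where "c3 = (\<lambda>x. (t + s) * rho S y x - s * unit_at y x)"
  define F where "F = (\<lambda>\<omega>. (\<Sum>k\<in>K. exp (L (c1 k) \<omega> + b1 k)) + (exp (L c2 \<omega> + s * (t * V - e)) + exp (L c3 \<omega> + - s * e)))"
  have Fk: "integrable M (\<lambda>\<omega>. exp (L c \<omega> + b))" "(\<integral>\<omega>. exp (L c \<omega> + b) \<partial>M) \<le> exp (qf N c c / 2 + b)" for c b
    by (rule gff_exp_le[OF is_gff, where c = c and b = b]; simp)+
  have qSS: "qf N (rho S y) (rho S y) = V" using qf_rho_nested[OF _ assms(1)] by (simp add: V_def)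
  have I1: "(\<integral>\<omega>. exp (L (c1 k) \<omega> + b1 k) \<partial>M) \<le> exp (- e\<^sup>2 / (2 * D)) * exp (t\<^sup>2 * V / 2)" if "k \<in> K" for k
  proof -
    let ?Q = "sqball k y" and ?g = "gr (sqball k y) y y"
    have Q: "?Q \<subseteq> S" "?Q \<subseteq> intr N" using assms(1,4) that by auto
    have "qf N (rho ?Q y) (rho S y) = ?g" "qf N (rho ?Q y) (rho ?Q y) = ?g"
      using Q assms(1) by (auto intro: qf_rho_nested)
    moreover from this have "qf N (rho S y) (rho ?Q y) = ?g" by (simp add: qf_commute)
    ultimately have "qf N (c1 k) (c1 k) / 2 + b1 k = t\<^sup>2 * V / 2 + s\<^sup>2 * (V - ?g) / 2 - s * e"
      unfolding c1_def b1_def by (simp add: qf_bilinear qSS power2_eq_square algebra_simps add_divide_distrib diff_divide_distrib)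
    moreover have "V - ?g \<le> D" using VD gr_nonneg[OF finite_sqball, of k y y y] by simp
    ultimately show ?thesis using Fk(2)[of "c1 k" "b1 k"] key[of "V - ?g"] by simp
  qed
  have "qf N c2 c2 / 2 + s * (t * V - e) = t\<^sup>2 * V / 2 + s\<^sup>2 * V / 2 - s * e"
    unfolding c2_def by (simp add: qf_bilinear qSS power2_eq_square algebra_simps add_divide_distrib diff_divide_distrib)
  then have I2: "(\<integral>\<omega>. exp (L c2 \<omega> + s * (t * V - e)) \<partial>M) \<le> exp (- e\<^sup>2 / (2 * D)) * exp (t\<^sup>2 * V / 2)"
    using Fk(2)[of c2 "s * (t * V - e)"] key[OF VD(2)] by simp
  have I3: "(\<integral>\<omega>. exp (L c3 \<omega> + - s * e) \<partial>M) \<le> exp (- e\<^sup>2 / (2 * D)) * exp (t\<^sup>2 * V / 2)"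
  proof -
    have "qf N (rho S y) (unit_at y) = V" using qf_rho_unit_at[OF assms(1)] by (simp add: V_def)
    moreover from this have "qf N (unit_at y) (rho S y) = V" by (simp add: qf_commute)
    moreover have "qf N (unit_at y) (unit_at y) = gr (intr N) y y" using assms(3) by (intro qf_unit_at)
    ultimately have q3: "qf N c3 c3 / 2 + - s * e = t\<^sup>2 * V / 2 + s\<^sup>2 * (gr (intr N) y y - V) / 2 - s * e"
      unfolding c3_def by (simp add: qf_bilinear qSS power2_eq_square algebra_simps add_divide_distrib diff_divide_distrib)
    have "(\<integral>\<omega>. exp (L c3 \<omega> + - s * e) \<partial>M) \<le> exp (qf N c3 c3 / 2 + - s * e)" by (rule Fk(2))
    also have "\<dots> \<le> exp (- e\<^sup>2 / (2 * D)) * exp (t\<^sup>2 * V / 2)"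
      unfolding q3 using D VD by (intro key) simp
    finally show ?thesis .
  qed
  have F_int: "integrable M F" unfolding F_def by (intro Bochner_Integration.integrable_add Bochner_Integration.integrable_sum Fk)
  have le_F: "exp (t * L (rho S y) \<omega>) * indicator (space M - good S K t e y) \<omega> \<le> F \<omega>" for \<omega>
  proof (cases "\<omega> \<in> space M - good S K t e y")
    case False
    then show ?thesis by (auto simp: F_def intro!: add_nonneg_nonneg sum_nonneg)
  next
    case True
    have nn: "0 \<le> (\<Sum>k\<in>K. exp (L (c1 k) \<omega> + b1 k))" by (intro sum_nonneg) auto
    from True consider (1) k where "k \<in> K" "t * (V - gr (sqball k y) y y) + e \<le> L (rho S y) \<omega> - L (rho (sqball k y) y) \<omega>"
      | (2) "L (rho S y) \<omega> \<le> t * V - e" | (3) "L (unit_at y) \<omega> - L (rho S y) \<omega> \<le> - e"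
      unfolding good_def V_def by force
    then have "exp (t * L (rho S y) \<omega>) \<le> F \<omega>"
    proof cases
      case 1
      have "s * (t * (V - gr (sqball k y) y y) + e) \<le> s * (L (rho S y) \<omega> - L (rho (sqball k y) y) \<omega>)"
        using 1(2) s by (intro mult_left_mono) auto
      then have "t * L (rho S y) \<omega> \<le> L (c1 k) \<omega> + b1 k"
        unfolding c1_def b1_def lin_diff lin_cmult by (simp add: algebra_simps)
      then have "exp (t * L (rho S y) \<omega>) \<le> exp (L (c1 k) \<omega> + b1 k)" by simp
      also have "\<dots> \<le> (\<Sum>k\<in>K. exp (L (c1 k) \<omega> + b1 k))"
        using 1(1) assms(2) by (intro member_le_sum) auto
      finally show ?thesis unfolding F_def by (smt (verit) exp_gt_zero)
    next
      case 2
      have "s * L (rho S y) \<omega> \<le> s * (t * V - e)" using 2 s by (intro mult_left_mono) auto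
      then have "t * L (rho S y) \<omega> \<le> L c2 \<omega> + s * (t * V - e)"
        unfolding c2_def lin_cmult by (simp add: algebra_simps)
      then have "exp (t * L (rho S y) \<omega>) \<le> exp (L c2 \<omega> + s * (t * V - e))" by simp
      then show ?thesis using nn unfolding F_def by (smt (verit) exp_gt_zero)
    next
      case 3
      have "s * (L (unit_at y) \<omega> - L (rho S y) \<omega>) \<le> s * (- e)" using 3 s by (intro mult_left_mono) auto
      then have "t * L (rho S y) \<omega> \<le> L c3 \<omega> + - s * e"
        unfolding c3_def lin_diff lin_cmult by (simp add: algebra_simps)
      then have "exp (t * L (rho S y) \<omega>) \<le> exp (L c3 \<omega> + - s * e)" by simp
      then show ?thesis using nn unfolding F_def by (smt (verit) exp_gt_zero)
    qed
    then show ?thesis using True by simp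
  qed
  have int: "integrable M (\<lambda>\<omega>. exp (t * L (rho S y) \<omega>) * indicator (space M - good S K t e y) \<omega>)"
  proof (intro Bochner_Integration.integrable_bound[OF F_int] AE_I2)
    show "(\<lambda>\<omega>. exp (t * L (rho S y) \<omega>) * indicator (space M - good S K t e y) \<omega>) \<in> borel_measurable M"
      using assms(2) by (auto intro!: borel_measurable_times borel_measurable_indicator countable_finite)
    show "norm (exp (t * L (rho S y) \<omega>) * indicator (space M - good S K t e y) \<omega>) \<le> norm (F \<omega>)" for \<omega>
      using le_F[of \<omega>] by (auto simp: abs_mult indicator_def)
  qed
  have "(\<integral>\<omega>. exp (t * L (rho S y) \<omega>) * indicator (space M - good S K t e y) \<omega> \<partial>M) \<le> (\<integral>\<omega>. F \<omega> \<partial>M)"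
    using int F_int le_F by (intro integral_mono)
  also have "\<dots> = (\<Sum>k\<in>K. \<integral>\<omega>. exp (L (c1 k) \<omega> + b1 k) \<partial>M)
      + ((\<integral>\<omega>. exp (L c2 \<omega> + s * (t * V - e)) \<partial>M) + (\<integral>\<omega>. exp (L c3 \<omega> + - s * e) \<partial>M))"
    unfolding F_def using Fk(1)
    by (simp only: Bochner_Integration.integral_add Bochner_Integration.integral_sum
        Bochner_Integration.integrable_add Bochner_Integration.integrable_sum)
  also have "\<dots> \<le> real (card K) * (exp (- e\<^sup>2 / (2 * D)) * exp (t\<^sup>2 * V / 2))
      + (exp (- e\<^sup>2 / (2 * D)) * exp (t\<^sup>2 * V / 2) + exp (- e\<^sup>2 / (2 * D)) * exp (t\<^sup>2 * V / 2))"
    using I1 I2 I3 by (intro add_mono sum_bounded_above) auto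
  finally show ?thesis unfolding V_def by (simp add: algebra_simps)
qed

lemma good_pair_measurable:
  assumes "countable K"
  shows "(\<lambda>\<omega>. exp (t * L (rho S y) \<omega>) * exp (t * L (rho S' z) \<omega>)
    * (indicator (good S K t e y) \<omega> * indicator (good S' K t e z) \<omega>)) \<in> borel_measurable M"
  using assms by (auto intro!: borel_measurable_times borel_measurable_indicator)

text \<open>The truncation at scale \<open>k\<close> bounds the coarse part of the field at
  \<open>y\<close> by t v + e; what remains of it lives in a ball missing \<open>z\<close> and is
  uncorrelated with the field at \<open>z\<close>. The coarse part then costs t^2 v instead of the
  t^2 v/2 already present in the variance at \<open>y\<close>, an excess of only t^2 v/2.\<close>

lemma good_pair_near:
  assumes "S \<subseteq> intr N" "countable K" "k \<in> K" "sqball k y \<subseteq> S" "z \<notin> sqball k y" "0 < t"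
  shows "(\<integral>\<omega>. exp (t * L (rho S y) \<omega>) * exp (t * L (rho S z) \<omega>)
      * (indicator (good S K t e y) \<omega> * indicator (good S K t e z) \<omega>) \<partial>M)
    \<le> exp (t\<^sup>2 * gr S y y / 2) * exp (t\<^sup>2 * gr S z z / 2)
       * exp (t\<^sup>2 / 2 * (gr S y y - gr (sqball k y) y y) + t * e)"
proof -
  let ?Q = "sqball k y"
  define v where "v = gr S y y - gr ?Q y y"
  define c where "c = (\<lambda>x. t * (rho S z x + rho ?Q y x))"
  have Q: "?Q \<subseteq> intr N" using assms by auto
  have q: "qf N (rho S z) (rho S z) = gr S z z" "qf N (rho ?Q y) (rho ?Q y) = gr ?Q y y"
    "qf N (rho ?Q y) (rho S z) = 0"
    using qf_rho_nested[OF subset_refl assms(1)] qf_rho_nested[OF subset_refl Q] qf_rho_nested[OF assms(4,1), of y z]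
      gr_outside2[OF finite_sqball assms(5), of y] by auto
  moreover from q(3) have "qf N (rho S z) (rho ?Q y) = 0" by (simp add: qf_commute)
  ultimately have qf: "qf N c c / 2 + t * (t * v + e)
      = t\<^sup>2 * gr S y y / 2 + t\<^sup>2 * gr S z z / 2 + (t\<^sup>2 / 2 * v + t * e)"
    unfolding c_def v_def by (simp add: qf_bilinear power2_eq_square algebra_simps add_divide_distrib diff_divide_distrib)
  have "(\<integral>\<omega>. exp (t * L (rho S y) \<omega>) * exp (t * L (rho S z) \<omega>)
      * (indicator (good S K t e y) \<omega> * indicator (good S K t e z) \<omega>) \<partial>M) \<le> exp (qf N c c / 2 + t * (t * v + e))"
  proof (rule gff_exp_le[OF is_gff good_pair_measurable[OF assms(2)]])
    fix \<omega>
    show "exp (t * L (rho S y) \<omega>) * exp (t * L (rho S z) \<omega>)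
      * (indicator (good S K t e y) \<omega> * indicator (good S K t e z) \<omega>) \<le> exp (L c \<omega> + t * (t * v + e))"
    proof (cases "\<omega> \<in> good S K t e y \<and> \<omega> \<in> good S K t e z")
      case True
      then have "L (rho S y) \<omega> - L (rho ?Q y) \<omega> \<le> t * v + e" using assms(3) by (auto simp: good_def v_def)
      then have "t * (L (rho S y) \<omega> - L (rho ?Q y) \<omega>) \<le> t * (t * v + e)" using assms(6) by (intro mult_left_mono) auto
      then have "t * L (rho S y) \<omega> + t * L (rho S z) \<omega> \<le> L c \<omega> + t * (t * v + e)"
        unfolding c_def lin_cmult lin_add by (simp add: algebra_simps)
      then show ?thesis using True by (simp flip: exp_add)
    qed auto
  qed auto
  then show ?thesis unfolding qf unfolding v_def exp_add .
qed

lemma good_pair_far: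
  assumes "S \<subseteq> intr N" "S' \<subseteq> intr N" "countable K" "\<And>w. w \<in> S \<Longrightarrow> w \<notin> S' \<and> nbrs w \<inter> S' = {}"
  shows "(\<integral>\<omega>. exp (t * L (rho S y) \<omega>) * exp (t * L (rho S' z) \<omega>)
      * (indicator (good S K t e y) \<omega> * indicator (good S' K t e z) \<omega>) \<partial>M)
    \<le> exp (t\<^sup>2 * gr S y y / 2) * exp (t\<^sup>2 * gr S' z z / 2)"
proof -
  define c where "c = (\<lambda>x. t * (rho S y x + rho S' z x))"
  have q: "qf N (rho S y) (rho S y) = gr S y y" "qf N (rho S' z) (rho S' z) = gr S' z z"
    "qf N (rho S y) (rho S' z) = 0"
    using qf_rho_nested[OF subset_refl assms(1)] qf_rho_nested[OF subset_refl assms(2)]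
      qf_rho_separated[OF assms(1,2,4)] by auto
  moreover from q(3) have "qf N (rho S' z) (rho S y) = 0" by (simp add: qf_commute)
  ultimately have qf: "qf N c c / 2 + 0 = t\<^sup>2 * gr S y y / 2 + t\<^sup>2 * gr S' z z / 2"
    unfolding c_def by (simp add: qf_bilinear power2_eq_square algebra_simps add_divide_distrib diff_divide_distrib)
  have "(\<integral>\<omega>. exp (t * L (rho S y) \<omega>) * exp (t * L (rho S' z) \<omega>)
      * (indicator (good S K t e y) \<omega> * indicator (good S' K t e z) \<omega>) \<partial>M) \<le> exp (qf N c c / 2 + 0)"
  proof (rule gff_exp_le[OF is_gff good_pair_measurable[OF assms(3)]])
    show "exp (t * L (rho S y) \<omega>) * exp (t * L (rho S' z) \<omega>)
      * (indicator (good S K t e y) \<omega> * indicator (good S' K t e z) \<omega>) \<le> exp (L c \<omega> + 0)" for \<omega>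
      unfolding c_def lin_cmult lin_add by (simp add: indicator_def distrib_left exp_add)
  qed auto
  then show ?thesis unfolding qf exp_add .
qed

text \<open>The pairs are grouped by dyadic distance \<open>2 ^ j\<close>. There are about \<open>4 ^ j\<close> of them, and the excess
  of the truncated joint moment is of order \<open>(q / 2 ^ j)\<^sup>2\<close> when \<open>t\<^sup>2\<close> has its critical value \<open>2 * pi\<close>.\<close>
lemma good_pairs_in_box:
  assumes "sqball (4 * q) c \<subseteq> intr N" "y \<in> sqball q c" "0 < t" "t\<^sup>2 \<le> 2 * pi"
    and J: "2 * q \<le> 2 ^ J" "2 ^ J \<le> 4 * q"
  defines "S \<equiv> sqball (4 * q) c" and "K \<equiv> insert 0 ((\<lambda>j. 2 ^ j) ` {..<J})"
  shows "(\<Sum>z\<in>sqball q c. \<integral>\<omega>. exp (t * L (rho S y) \<omega>) * exp (t * L (rho S z) \<omega>)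
      * (indicator (good S K t e y) \<omega> * indicator (good S K t e z) \<omega>) \<partial>M)
    \<le> exp (t\<^sup>2 * gr S y y / 2) * (exp (t\<^sup>2 / 2 * (gconst * ln q + 163)) * exp (324 * pi) * exp (t * e)
        * (real q)\<^sup>2 * (1 + 16 * real J))"
proof -
  define f where "f = (\<lambda>z. \<integral>\<omega>. exp (t * L (rho S y) \<omega>) * exp (t * L (rho S z) \<omega>)
      * (indicator (good S K t e y) \<omega> * indicator (good S K t e z) \<omega>) \<partial>M)"
  define b where "b = exp (t\<^sup>2 * gr S y y / 2) * (exp (t\<^sup>2 / 2 * (gconst * ln q + 163)) * exp (324 * pi) * exp (t * e)
        * (real q)\<^sup>2)"
  have b0: "0 \<le> b" by (simp add: b_def)
  have q: "1 \<le> q" using assms(2) by (auto simp: sqball_def)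
  have cK: "countable K" by (simp add: K_def)
  \<comment> \<open>\<open>max 1 (real k)\<close> lets the scale 0, used for the pair z = y, share
    the estimate.\<close>
  have near: "f z \<le> b / (max 1 (real k))\<^sup>2"
    if "z \<in> sqball q c" "k \<in> K" "sqball k y \<subseteq> S" "z \<notin> sqball k y" for z k
  proof -
    define v where "v = gr S y y - gr (sqball k y) y y"
    have v0: "0 \<le> v" using gr_mono[OF finite_sqball, of "sqball k y" "4 * q" c y y] that by (simp add: v_def S_def)
    \<comment> \<open>324 = 163 + 161, from the upper bound in the large box and the lower bound in
      the small one.\<close>
    have v_le: "v \<le> gconst * (ln q - ln (max 1 (real k))) + 324"
    proof (cases "k = 0")
      case True
      then show ?thesis using gr_inner_bounds(2)[OF assms(2)] gr_nonneg[OF finite_sqball, of k y y y]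
        by (simp add: v_def S_def)
    next
      case False
      then show ?thesis using gr_inner_bounds(2)[OF assms(2)] gr_sqball_center[of k y]
        by (simp add: v_def S_def abs_le_iff right_diff_distrib max_def)
    qed
    have "pi * v \<le> 2 * (ln q - ln (max 1 (real k))) + 324 * pi"
    proof -
      have "pi * v \<le> pi * (gconst * (ln q - ln (max 1 (real k))) + 324)" by (intro mult_left_mono v_le) auto
      also have "\<dots> = (pi * gconst) * (ln q - ln (max 1 (real k))) + 324 * pi" by (simp only: distrib_left mult.assoc mult.commute[of 324])
      finally show ?thesis unfolding gconst_bounds(3) .
    qed
    moreover have "t\<^sup>2 / 2 * v \<le> pi * v" using v0 assms(4) by (intro mult_right_mono) auto
    ultimately have "exp (t\<^sup>2 / 2 * v + t * e) \<le> exp (2 * (ln q - ln (max 1 (real k))) + 324 * pi + t * e)" by simp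
    also have "2 * (ln q - ln (max 1 (real k))) = ln ((real q / max 1 (real k))\<^sup>2)"
      using q by (simp add: ln_realpow ln_div max_def)
    also have "exp (ln ((real q / max 1 (real k))\<^sup>2) + 324 * pi + t * e) = (real q)\<^sup>2 / (max 1 (real k))\<^sup>2 * exp (324 * pi) * exp (t * e)"
      using q by (simp add: exp_add power_divide max_def)
    finally have 1: "exp (t\<^sup>2 / 2 * v + t * e) \<le> (real q)\<^sup>2 / (max 1 (real k))\<^sup>2 * exp (324 * pi) * exp (t * e)" .
    have 2: "exp (t\<^sup>2 * gr S z z / 2) \<le> exp (t\<^sup>2 / 2 * (gconst * ln q + 163))"
      using gr_inner_bounds(2)[OF that(1)] by (simp add: S_def mult_left_mono)
    have "f z \<le> exp (t\<^sup>2 * gr S y y / 2) * exp (t\<^sup>2 * gr S z z / 2) * exp (t\<^sup>2 / 2 * v + t * e)"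
      unfolding f_def v_def using assms(1) by (intro good_pair_near that cK assms(3)) (simp add: S_def)
    also have "\<dots> \<le> exp (t\<^sup>2 * gr S y y / 2) * exp (t\<^sup>2 / 2 * (gconst * ln q + 163))
        * ((real q)\<^sup>2 / (max 1 (real k))\<^sup>2 * exp (324 * pi) * exp (t * e))"
      using 1 2 by (intro mult_mono) auto
    also have "\<dots> = b / (max 1 (real k))\<^sup>2" by (simp add: b_def)
    finally show ?thesis .
  qed
  \<comment> \<open>Dyadic annuli around \<open>y\<close>: for \<open>z\<close> in the annulus j the
    ball of radius 2^j is the largest dyadic one missing \<open>z\<close>, and its truncation is
    used.\<close>
  let ?B = "\<lambda>j. sqball (2 * 2 ^ j) y - sqball (2 ^ j) y"
  have pw: "f z \<le> (if z = y then b else 0) + (\<Sum>j<J. if z \<in> ?B j then b / 4 ^ j else 0)" if z: "z \<in> sqball q c" for z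
  proof (cases "z = y")
    case True
    have "f z \<le> b" using near[OF z, of 0] True by (simp add: K_def sqball_def)
    moreover have "0 \<le> (\<Sum>j<J. if z \<in> ?B j then b / 4 ^ j else 0)" using b0 by (intro sum_nonneg) auto
    ultimately show ?thesis using True by simp
  next
    case False
    define d where "d = nat (max \<bar>fst z - fst y\<bar> \<bar>snd z - snd y\<bar>)"
    have d: "1 \<le> d" "d < 2 * q" using False z assms(2) by (auto simp: d_def sqball_def prod_eq_iff)
    have in_iff: "z \<in> sqball k y \<longleftrightarrow> d < k" for k
      by (auto simp: sqball_def d_def)
    obtain j where j: "2 ^ j \<le> d" "d < 2 ^ (j + 1)" using ex_power_ivl1[of 2 d] d(1) by auto
    have "(2::nat) ^ j < 2 ^ J" using j(1) d(2) J(1) by linarith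
    then have "j < J" by simp
    have "sqball (2 ^ j) y \<subseteq> S"
    proof
      fix w assume "w \<in> sqball (2 ^ j) y"
      moreover have "2 ^ j < 2 * q" using j d by linarith
      then have "int (2 ^ j) < 2 * int q" by linarith
      ultimately show "w \<in> S" using assms(2) by (auto simp: sqball_def S_def)
    qed
    then have "f z \<le> b / (max 1 (real (2 ^ j)))\<^sup>2"
      using j \<open>j < J\<close> by (intro near z) (auto simp: K_def in_iff)
    also have "\<dots> = (if z \<in> ?B j then b / 4 ^ j else 0)"
      using j by (simp add: in_iff max_def power2_eq_square power_mult_distrib[symmetric])
    also have "\<dots> \<le> (\<Sum>j<J. if z \<in> ?B j then b / 4 ^ j else 0)"
      using \<open>j < J\<close> b0 by (intro member_le_sum) auto
    finally show ?thesis using False by simp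
  qed
  have "(\<Sum>z\<in>sqball q c. f z) \<le> (\<Sum>z\<in>sqball q c. (if z = y then b else 0) + (\<Sum>j<J. if z \<in> ?B j then b / 4 ^ j else 0))"
    by (intro sum_mono pw)
  also have "\<dots> = b + (\<Sum>j<J. \<Sum>z\<in>sqball q c. if z \<in> ?B j then b / 4 ^ j else 0)"
    using assms(2) by (simp add: sum.distrib sum.swap[of _ "{..<J}"])
  also have "(\<Sum>j<J. \<Sum>z\<in>sqball q c. if z \<in> ?B j then b / 4 ^ j else 0) \<le> (\<Sum>j<J. 16 * b)"
  proof (intro sum_mono)
    fix j
    have "(\<Sum>z\<in>sqball q c. if z \<in> ?B j then b / 4 ^ j else 0) = real (card (sqball q c \<inter> ?B j)) * (b / 4 ^ j)"
      by (subst sum.inter_restrict[symmetric]) auto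
    also have "card (sqball q c \<inter> ?B j) \<le> card (sqball (2 * 2 ^ j) y)" by (intro card_mono) auto
    then have "real (card (sqball q c \<inter> ?B j)) \<le> 4 * (real (2 * 2 ^ j))\<^sup>2"
      using card_sqball_le[of "2 * 2 ^ j" y] by linarith
    then have "real (card (sqball q c \<inter> ?B j)) * (b / 4 ^ j) \<le> 4 * (real (2 * 2 ^ j))\<^sup>2 * (b / 4 ^ j)"
      using b0 by (intro mult_right_mono) auto
    \<comment> \<open>The area of the annulus cancels the decay 4^(-j), so each of the
      \<open>J\<close> scales contributes equally.\<close>
    also have "4 * (real (2 * 2 ^ j))\<^sup>2 = 16 * 4 ^ j"
      by (simp add: power2_eq_square power_mult_distrib[symmetric])
    finally show "(\<Sum>z\<in>sqball q c. if z \<in> ?B j then b / 4 ^ j else 0) \<le> 16 * b" by simp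
  qed
  finally have "(\<Sum>z\<in>sqball q c. f z) \<le> b * (1 + 16 * real J)" by (simp add: algebra_simps)
  then show ?thesis unfolding f_def b_def by (simp only: mult.assoc)
qed

end

lemma gr_intr_le:
  assumes "y \<in> box N"
  shows "gr (intr N) y y \<le> gconst * ln N + 161"
proof -
  have "intr N \<subseteq> sqball N y" using assms intr_subset_box[of N] by (force simp: sqball_def box_def)
  then have "gr (intr N) y y \<le> gr (sqball N y) y y" by (intro gr_mono) auto
  moreover have "1 \<le> N" using assms by (auto simp: box_def)
  ultimately show ?thesis using gr_sqball_center[of N y] by linarith
qed

context gff
begin

text \<open>On the good events a point carries weight at most \<open>top\<close> and is high, so the
  number of high points is at least the truncated sum divided by \<open>top\<close>. The sum is at
  least half its mean off \<open>E\<close>. The second moment excess comes only from pairs in the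
  same box, whence the division by \<open>m\<close>; 3 in \<open>J + 3\<close> counts the scale 0
  and the two further constraints of \<open>good\<close>.\<close>

lemma many_high_points:
  fixes c :: "nat \<Rightarrow> pt"
  assumes q: "1 \<le> q" and m: "1 \<le> m"
    and sub: "\<And>i. i < m \<Longrightarrow> sqball (4 * q) (c i) \<subseteq> intr N"
    and sep: "\<And>i j. i < m \<Longrightarrow> j < m \<Longrightarrow> i \<noteq> j \<Longrightarrow> 9 * int q \<le> \<bar>fst (c i) - fst (c j)\<bar>"
    and t: "0 < t" "t\<^sup>2 \<le> 2 * pi" and e: "0 < e"
    and J: "2 * q \<le> 2 ^ J" "2 ^ J \<le> 4 * q"
    and D: "gconst * ln N + 161 \<le> D" "0 < D"
    and u: "u \<le> t * (gconst * ln q - 161) - 2 * e"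
  shows "\<exists>E\<in>events. prob E \<le> 4 * (exp (648 * pi) * exp (t * e) * (1 + 16 * real J) / m
        + 2 * ((real J + 3) * exp (- e\<^sup>2 / (2 * D)))) \<and>
    (\<forall>\<omega>\<in>space M - E. (real q)\<^sup>2 / 2 * exp (- (t\<^sup>2 * gconst * ln q / 2) - t * e - 488 * pi)
       \<le> card {y \<in> \<Union>i<m. sqball q (c i). u \<le> \<Phi> \<omega> y})"
proof -
  define S where "S = (\<lambda>i. sqball (4 * q) (c i))"
  define Y where "Y = (\<lambda>i. sqball q (c i))"
  define K where "K = insert (0::nat) ((\<lambda>j. 2 ^ j) ` {..<J})"
  define I where "I = Sigma {..<m} Y"
  define A where "A = (\<lambda>(i, y). good (S i) K t e y)"
  define \<xi> where "\<xi> = (\<lambda>(i, y) \<omega>. exp (t * L (rho (S i) y) \<omega>))"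
  define W where "W = (\<lambda>(i, y). exp (t\<^sup>2 * gr (S i) y y / 2))"
  define w where "w = (\<Sum>p\<in>I. W p)"
  define Wmin where "Wmin = exp (t\<^sup>2 / 2 * (gconst * ln q - 161))"
  define Wmax where "Wmax = exp (t\<^sup>2 / 2 * (gconst * ln q + 163))"
  define \<kappa> where "\<kappa> = exp (648 * pi) * exp (t * e) * (1 + 16 * real J) / m"
  define \<eta> where "\<eta> = (real J + 3) * exp (- e\<^sup>2 / (2 * D))"
  have finI: "finite I" by (simp add: I_def Y_def)
  have K: "finite K" "countable K" "real (card K) \<le> real J + 1" "0 \<in> K"
  proof -
    have "card K \<le> Suc (card ((\<lambda>j. 2 ^ j :: nat) ` {..<J}))" unfolding K_def by (rule card_insert_le_m1[THEN order_trans]) auto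
    moreover have "card ((\<lambda>j. 2 ^ j :: nat) ` {..<J}) \<le> J" using card_image_le[of "{..<J}"] by simp
    ultimately show "real (card K) \<le> real J + 1" by linarith
  qed (auto simp: K_def)
  have S_sub: "S i \<subseteq> intr N" if "i < m" for i using sub[OF that] by (simp add: S_def)
  have YS: "Y i \<subseteq> S i" for i by (auto simp: Y_def S_def sqball_def)
  \<comment> \<open>The largest scale is at most 2q, and \<open>y\<close> is within q of the centre,
    so these balls fit into the box of radius 4q.\<close>
  have KS: "sqball k y \<subseteq> S i" if "k \<in> K" "y \<in> Y i" for k y i
  proof -
    have "int k \<le> 3 * int q"
    proof (cases "k = 0")
      case False
      then have "k \<in> (\<lambda>j. 2 ^ j) ` {..<J}" using that(1) by (simp add: K_def)
      then obtain j where j: "j < J" "k = 2 ^ j" by blast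
      then have "2 * k \<le> 2 ^ J" using power_increasing[of "Suc j" J "2::nat"] by simp
      then show ?thesis using J by linarith
    qed simp
    then show ?thesis using that(2) by (auto simp: Y_def S_def sqball_def)
  qed
  have Ydisj: "i = j" if "i < m" "j < m" "y \<in> Y i" "y \<in> Y j" for i j y
    using sep[of i j] that by (force simp: Y_def sqball_def)
  \<comment> \<open>Centres 9q apart leave a gap between boxes of radius 4q, so the boxes are not
    even adjacent.\<close>
  have Sdisj: "v \<notin> S j \<and> nbrs v \<inter> S j = {}" if "i < m" "j < m" "i \<noteq> j" "v \<in> S i" for i j v
  proof -
    have "z \<notin> S j" if "\<bar>fst z - fst v\<bar> \<le> 1" for z
      using sep[OF \<open>i < m\<close> \<open>j < m\<close> \<open>i \<noteq> j\<close>] \<open>v \<in> S i\<close> that q by (auto simp: S_def sqball_def)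
    then show ?thesis by (auto simp: nbrs_def)
  qed
  have W_bounds: "Wmin \<le> W p" "W p \<le> Wmax" if pI: "p \<in> I" for p
  proof -
    obtain i y where p0: "p = (i, y)" by (cases p)
    then have p: "p = (i, y)" "i < m" "y \<in> sqball q (c i)" using that by (auto simp: I_def Y_def)
    have "t\<^sup>2 / 2 * (gconst * ln q - 161) \<le> t\<^sup>2 / 2 * gr (S i) y y" "t\<^sup>2 / 2 * gr (S i) y y \<le> t\<^sup>2 / 2 * (gconst * ln q + 163)"
      using gr_inner_bounds[OF p(3)] by (auto simp: S_def intro!: mult_left_mono)
    then show "Wmin \<le> W p" "W p \<le> Wmax" by (auto simp: W_def p Wmin_def Wmax_def)
  qed
  have W_nn: "0 \<le> W p" for p by (cases p) (simp add: W_def)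
  have cardI: "real m * (real q)\<^sup>2 \<le> real (card I)"
  proof -
    have "q\<^sup>2 \<le> (2 * q - 1)\<^sup>2" using q by (intro power_mono) auto
    then have "m * q\<^sup>2 \<le> (\<Sum>i<m. card (Y i))" using q by (simp add: Y_def card_sqball)
    also have "\<dots> = card I" unfolding I_def by (subst card_SigmaI) (auto simp: Y_def)
    finally show ?thesis by (metis of_nat_le_iff of_nat_mult of_nat_power)
  qed
  have w_ge: "real m * (real q)\<^sup>2 * Wmin \<le> w"
  proof -
    have "real m * (real q)\<^sup>2 * Wmin \<le> real (card I) * Wmin" using cardI by (intro mult_right_mono) (auto simp: Wmin_def)
    also have "\<dots> \<le> w" unfolding w_def using W_bounds(1) by (intro sum_bounded_below) auto
    finally show ?thesis .
  qed
  have w_pos: "0 < w"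
  proof -
    have "0 < real m * (real q)\<^sup>2 * Wmin" using m q by (simp add: Wmin_def)
    then show ?thesis using w_ge by linarith
  qed
  have E\<xi>: "integrable M (\<xi> p)" "expectation (\<xi> p) = W p" if pI: "p \<in> I" for p
  proof -
    obtain i y where p: "p = (i, y)" "i < m" using pI unfolding I_def by blast
    have eq: "\<xi> p = (\<lambda>\<omega>. exp (L (\<lambda>x. t * rho (S i) y x) \<omega>))" by (simp add: \<xi>_def p lin_cmult)
    show "integrable M (\<xi> p)" unfolding eq by (rule exp_integrable)
    show "expectation (\<xi> p) = W p"
      unfolding eq gff_exp(3)[OF is_gff] using qf_rho_nested[OF subset_refl S_sub[OF p(2)]]
      by (simp add: qf_bilinear W_def p power2_eq_square mult.assoc)
  qed
  have pairs: "(\<Sum>p\<in>I. \<Sum>p'\<in>I. \<integral>\<omega>. \<xi> p \<omega> * \<xi> p' \<omega> * (indicator (A p) \<omega> * indicator (A p') \<omega>) \<partial>M) \<le> (1 + \<kappa>) * w\<^sup>2"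
  proof -
    define f where "f = (\<lambda>p p'. \<integral>\<omega>. \<xi> p \<omega> * \<xi> p' \<omega> * (indicator (A p) \<omega> * indicator (A p') \<omega>) \<partial>M)"
    define b where "b = Wmax * exp (324 * pi) * exp (t * e) * (real q)\<^sup>2 * (1 + 16 * real J)"
    have "(\<Sum>p'\<in>I. f p p') \<le> W p * b + W p * w" if p: "p \<in> I" for p
    proof -
      obtain i y where iy: "p = (i, y)" "i < m" "y \<in> Y i" using p unfolding I_def by blast
      \<comment> \<open>Pairs in the same box need the truncated estimate; pairs in different boxes
        factorise and together give at most w^2.\<close>
      have I_split: "I = Pair i ` Y i \<union> (I - Pair i ` Y i)" "Pair i ` Y i \<subseteq> I" using iy by (auto simp: I_def)
      have "(\<Sum>p'\<in>I. f p p') = (\<Sum>p'\<in>Pair i ` Y i. f p p') + (\<Sum>p'\<in>I - Pair i ` Y i. f p p')"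
        using I_split(2) finI by (simp add: sum.subset_diff add.commute)
      also have "(\<Sum>p'\<in>Pair i ` Y i. f p p') = (\<Sum>z\<in>Y i. f p (i, z))"
        by (subst sum.reindex) (auto simp: inj_on_def)
      also have "\<dots> \<le> W p * b"
        using good_pairs_in_box[OF sub[OF iy(2)] iy(3)[unfolded Y_def] t J, of e]
        unfolding f_def b_def iy \<xi>_def A_def W_def Wmax_def S_def Y_def K_def by simp
      also have "(\<Sum>p'\<in>I - Pair i ` Y i. f p p') \<le> (\<Sum>p'\<in>I - Pair i ` Y i. W p * W p')"
      proof (intro sum_mono)
        fix p' assume "p' \<in> I - Pair i ` Y i"
        then obtain j z where jz: "p' = (j, z)" "j < m" "z \<in> Y j" "i \<noteq> j" unfolding I_def by blast
        show "f p p' \<le> W p * W p'"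
          unfolding f_def iy jz \<xi>_def A_def W_def prod.case
          by (rule good_pair_far[OF S_sub[OF iy(2)] S_sub[OF jz(2)] K(2) Sdisj[OF iy(2) jz(2,4)]])
      qed
      also have "\<dots> \<le> (\<Sum>p'\<in>I. W p * W p')" using finI by (intro sum_mono2 mult_nonneg_nonneg W_nn) auto
      also have "\<dots> = W p * w" by (simp add: w_def sum_distrib_left)
      finally show ?thesis by simp
    qed
    then have "(\<Sum>p\<in>I. \<Sum>p'\<in>I. f p p') \<le> (\<Sum>p\<in>I. W p * b + W p * w)" by (intro sum_mono)
    also have "\<dots> = w * b + w * w" by (simp add: w_def sum.distrib sum_distrib_right)
    \<comment> \<open>One factor exp(324 pi) stems from the pair estimate, the other from the ratio
      of \<open>Wmax\<close> to \<open>Wmin\<close>; hence 648. \<open>w\<close> sums over m boxes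
      while \<open>b\<close> concerns one.\<close>
    also have "b \<le> \<kappa> * w"
    proof -
      have "Wmax \<le> Wmin * exp (324 * pi)"
      proof -
        have "t\<^sup>2 / 2 * 324 \<le> 324 * pi" using t(2) by simp
        then have "t\<^sup>2 / 2 * (gconst * ln q + 163) \<le> t\<^sup>2 / 2 * (gconst * ln q - 161) + 324 * pi" by (simp add: algebra_simps)
        then show ?thesis unfolding Wmax_def Wmin_def by (simp flip: exp_add)
      qed
      then have "b \<le> (Wmin * exp (324 * pi)) * exp (324 * pi) * exp (t * e) * (real q)\<^sup>2 * (1 + 16 * real J)"
        unfolding b_def by (intro mult_right_mono) auto
      also have "\<dots> = \<kappa> * (real m * (real q)\<^sup>2 * Wmin)"
      proof -
        have "exp (324 * pi) * exp (324 * pi) = exp (648 * pi)" by (simp flip: exp_add)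
        then show ?thesis unfolding \<kappa>_def using m by (simp add: mult_ac)
      qed
      also have "\<dots> \<le> \<kappa> * w" using w_ge by (intro mult_left_mono) (auto simp: \<kappa>_def)
      finally show ?thesis .
    qed
    then have "w * b + w * w \<le> (1 + \<kappa>) * w\<^sup>2"
      using w_pos mult_left_mono[of b "\<kappa> * w" w] by (simp add: power2_eq_square algebra_simps)
    finally show ?thesis unfolding f_def .
  qed
  define E where "E = {\<omega> \<in> space M. (\<Sum>p\<in>I. \<xi> p \<omega> * indicator (A p) \<omega>) < w / 2}"
  have A_ev: "A p \<in> events" for p using K(2) by (cases p) (simp add: A_def)
  have \<xi>_meas: "\<xi> p \<in> borel_measurable M" for p by (cases p) (simp add: \<xi>_def)
  have E_ev: "E \<in> events"
    unfolding E_def using A_ev \<xi>_meas by (intro borel_measurable_less borel_measurable_sum borel_measurable_times borel_measurable_indicator) auto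
  have "prob E \<le> 4 * (\<kappa> + 2 * \<eta>)"
    unfolding E_def
  proof (rule truncated_second_moment[OF finI])
    show "w = (\<Sum>p\<in>I. expectation (\<xi> p))" unfolding w_def using E\<xi>(2) by (intro sum.cong) auto
    show "0 \<le> \<xi> p \<omega>" for p \<omega> by (cases p) (simp add: \<xi>_def)
    show "integrable M (\<lambda>\<omega>. \<xi> p \<omega> * \<xi> p' \<omega>)" for p p'
    proof -
      obtain i y j z where p: "p = (i, y)" "p' = (j, z)" by (cases p; cases p')
      have "(\<lambda>\<omega>. \<xi> p \<omega> * \<xi> p' \<omega>) = (\<lambda>\<omega>. exp (L (\<lambda>x. t * rho (S i) y x + t * rho (S j) z x) \<omega>))"
        unfolding p \<xi>_def by (simp add: lin_add lin_cmult exp_add)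
      then show ?thesis using exp_integrable by simp
    qed
    show "expectation (\<lambda>\<omega>. \<xi> p \<omega> * indicator (space M - A p) \<omega>) \<le> \<eta> * expectation (\<xi> p)" if pI: "p \<in> I" for p
    proof -
      obtain i y where p: "p = (i, y)" "i < m" "y \<in> Y i" using pI unfolding I_def by blast
      have "y \<in> box N" using YS S_sub[OF p(2)] intr_subset_box p(3) by blast
      then have "expectation (\<lambda>\<omega>. \<xi> p \<omega> * indicator (space M - A p) \<omega>)
        \<le> (real (card K) + 2) * exp (- e\<^sup>2 / (2 * D)) * exp (t\<^sup>2 * gr (S i) y y / 2)"
        unfolding p \<xi>_def A_def prod.case
        using gr_intr_le[of y N] D K(1) KS[OF _ p(3)] e by (intro good_tail S_sub[OF p(2)]) auto
      also have "\<dots> \<le> \<eta> * exp (t\<^sup>2 * gr (S i) y y / 2)"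
        unfolding \<eta>_def using K(3) by (intro mult_right_mono) auto
      also have "\<dots> = \<eta> * expectation (\<xi> p)" using E\<xi>(2)[OF that] by (simp add: W_def p)
      finally show ?thesis .
    qed
  qed (use A_ev \<xi>_meas E\<xi>(1) w_pos pairs in auto)
  moreover have "(real q)\<^sup>2 / 2 * exp (- (t\<^sup>2 * gconst * ln q / 2) - t * e - 488 * pi)
       \<le> card {y \<in> \<Union>i<m. Y i. u \<le> \<Phi> \<omega> y}" if \<omega>: "\<omega> \<in> space M - E" for \<omega>
  proof -
    define G where "G = {p \<in> I. \<omega> \<in> A p}"
    define top where "top = exp (t\<^sup>2 * (gconst * ln q + 163) + t * e)"
    have finG: "finite G" using finI by (simp add: G_def)
    have "w / 2 \<le> (\<Sum>p\<in>I. \<xi> p \<omega> * indicator (A p) \<omega>)" using \<omega> unfolding E_def by (auto simp only: not_less mem_Collect_eq Diff_iff)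
    also have "\<dots> = (\<Sum>p\<in>G. \<xi> p \<omega>)"
      unfolding G_def sum.inter_filter[OF finI] by (intro sum.cong refl) (simp add: indicator_def)
    also have "\<dots> \<le> (\<Sum>p\<in>G. top)"
    proof (intro sum_mono)
      fix p assume "p \<in> G"
      then obtain i y where p: "p = (i, y)" "i < m" "y \<in> Y i" "\<omega> \<in> good (S i) K t e y"
        unfolding G_def I_def A_def by auto
      \<comment> \<open>At scale 0 nothing is subtracted, so the truncation bounds the field at
        \<open>y\<close> itself, and with it the weight.\<close>
      have "sqball 0 y = {}" by (simp add: sqball_def)
      then have "L (rho (S i) y) \<omega> - L (\<lambda>z. 0) \<omega> \<le> t * (gr (S i) y y - 0) + e"
        using p(4) K(4) rho_empty[of y] gr_outside[of y "{}" y] unfolding good_def by force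
      then have "t * L (rho (S i) y) \<omega> \<le> t * (t * gr (S i) y y + e)"
        using t(1) by (intro mult_left_mono) (auto simp: lin_def)
      also have "\<dots> = t\<^sup>2 * gr (S i) y y + t * e" by (simp add: power2_eq_square distrib_left)
      also have "\<dots> \<le> t\<^sup>2 * (gconst * ln q + 163) + t * e"
        using gr_inner_bounds(2)[of y q "c i"] p(3) by (auto simp: S_def Y_def intro!: mult_left_mono)
      finally show "\<xi> p \<omega> \<le> top" by (simp add: \<xi>_def top_def p)
    qed
    finally have wG: "w / 2 \<le> real (card G) * top" by simp
    have "card G \<le> card {y \<in> \<Union>i<m. Y i. u \<le> \<Phi> \<omega> y}"
    proof (rule card_inj_on_le[of snd])
      show "inj_on snd G" using Ydisj by (fastforce simp: inj_on_def G_def I_def)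
      show "finite {y \<in> \<Union>i<m. Y i. u \<le> \<Phi> \<omega> y}" by (simp add: Y_def)
      show "snd ` G \<subseteq> {y \<in> \<Union>i<m. Y i. u \<le> \<Phi> \<omega> y}"
      proof
        fix y assume "y \<in> snd ` G"
        then obtain i where p: "i < m" "y \<in> Y i" "\<omega> \<in> good (S i) K t e y"
          unfolding G_def I_def A_def by auto
        have "y \<in> box N" using YS S_sub[OF p(1)] intr_subset_box p(2) by blast
        then have "t * gr (S i) y y - 2 * e \<le> \<Phi> \<omega> y" using p(3) by (auto simp: good_def lin_unit_at)
        moreover have "t * (gconst * ln q - 161) \<le> t * gr (S i) y y"
          using gr_inner_bounds(1)[of y q "c i"] p(2) t(1) by (intro mult_left_mono) (auto simp: S_def Y_def)
        ultimately show "y \<in> {y \<in> \<Union>i<m. Y i. u \<le> \<Phi> \<omega> y}" using u p by auto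
      qed
    qed
    moreover have "(real q)\<^sup>2 / 2 * exp (- (t\<^sup>2 * gconst * ln q / 2) - t * e - 488 * pi) \<le> real (card G)"
    proof -
      \<comment> \<open>161/2 + 163 = 487/2 is the constant multiplying t^2 in the logarithm of
        \<open>Wmin / top\<close>.\<close>
      have "t\<^sup>2 * 487 \<le> pi * 976" using t(2) pi_gt_zero by linarith
      then have "- (t\<^sup>2 * gconst * ln q / 2) - t * e - 488 * pi
          \<le> t\<^sup>2 / 2 * (gconst * ln q - 161) - (t\<^sup>2 * (gconst * ln q + 163) + t * e)"
        by (simp add: algebra_simps)
      then have "exp (- (t\<^sup>2 * gconst * ln q / 2) - t * e - 488 * pi) \<le> Wmin / top"
        unfolding Wmin_def top_def by (simp flip: exp_diff)
      then have "(real q)\<^sup>2 / 2 * exp (- (t\<^sup>2 * gconst * ln q / 2) - t * e - 488 * pi) \<le> (real q)\<^sup>2 / 2 * (Wmin / top)"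
        by (intro mult_left_mono) auto
      also have "\<dots> = (1 * (real q)\<^sup>2 * Wmin) / 2 / top" by simp
      also have "\<dots> \<le> (real m * (real q)\<^sup>2 * Wmin) / 2 / top"
        using m by (intro divide_right_mono mult_right_mono) (auto simp: Wmin_def top_def)
      also have "\<dots> \<le> w / 2 / top" using w_ge by (intro divide_right_mono) (auto simp: top_def)
      also have "\<dots> \<le> real (card G)" using wG by (simp add: top_def field_simps)
      finally show ?thesis .
    qed
    ultimately show ?thesis by linarith
  qed
  ultimately show ?thesis using E_ev unfolding \<kappa>_def \<eta>_def Y_def by blast
qed

end

section \<open>Upper bound\<close>

text \<open>As a function of \<open>y\<close> the difference is harmonic in the ball, so the minimum
  principle reduces the claim to its exit points. There the second term vanishes and the first
  dominates the Green function of the ball of radius n.\<close>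

lemma gr_diff_lower_bound:
  assumes "finite T" "sqball n x \<subseteq> T" "k < n" "y \<in> sqball k x"
  shows "gconst * (ln n - ln k) - 162 \<le> gr T x y - gr (sqball k x) x y"
proof -
  let ?B = "sqball k x"
  define b where "b = gconst * (ln n - ln k) - 162"
  have k: "1 \<le> k" using assms(4) by (auto simp: sqball_def)
  have sub: "?B \<subseteq> T" using assms(2,3) by (auto simp: sqball_def)
  have "0 \<le> gr T x y - gr ?B x y - b"
  proof (rule superharmonic_nonneg[where S = ?B and u = "\<lambda>y. gr T x y - gr ?B x y - b"])
    show "avg (\<lambda>y. gr T x y - gr ?B x y - b) z \<le> gr T x z - gr ?B x z - b" if "z \<in> ?B" for z
      using gr_step2[OF assms(1), of z x] gr_step2[OF finite_sqball that, of x] that sub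
      by (simp only: avg_diff avg_const) auto
    show "0 \<le> gr T x z - gr ?B x z - b" if "v \<in> ?B" "z \<in> nbrs v" "z \<notin> ?B" for v z
    proof -
      have zn: "z \<in> sqball n x" using sqball_boundary(1)[OF that] assms(3) by (auto simp: sqball_def)
      have "lnorm (z - x) \<le> ln k + 1" by (rule sqball_boundary(3)[OF that])
      then have "gconst * (ln n - ln k - 1) \<le> gconst * (ln n - lnorm (z - x))"
        using gconst_bounds by (intro mult_left_mono) auto
      also have "\<dots> \<le> gr (sqball n x) z x + 161" using gr_sqball[OF zn] by (simp add: abs_le_iff)
      also have "gr (sqball n x) z x = gr (sqball n x) x z" by (rule gr_sym) simp
      also have "\<dots> \<le> gr T x z" by (rule gr_mono[OF assms(1,2)])
      finally have "gconst * (ln n - ln k) - gconst - 161 \<le> gr T x z" by (simp add: algebra_simps)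
      moreover have "gr ?B x z = 0" using that by (intro gr_outside2) auto
      ultimately show ?thesis using gconst_bounds unfolding b_def by linarith
    qed
  qed (use assms(4) finite_sqball in blast)+
  then show ?thesis by (simp add: b_def)
qed

context gff
begin

text \<open>The single functional \<open>h\<close> is the harmonic average at \<open>x\<close> and
  is subtracted at every \<open>y\<close> of the ball. It carries the fluctuation common to the
  ball, so the variance of the rest grows with ln k rather than ln N. Off \<open>E\<close>,
  \<open>h\<close> is below \<open>e\<close> and every high point contributes at least 1 to
  \<open>X\<close>; Markov's inequality is applied to \<open>X\<close>.\<close>

lemma few_high_points:
  fixes D e s a T :: real
  assumes sub: "sqball n x \<subseteq> intr N" and k: "1 \<le> k" "k < n"
    and D: "gconst * ln N + 161 \<le> D" "0 < D" and e: "0 < e" and s: "0 \<le> s" and T: "0 < T"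
  shows "\<exists>E\<in>events. prob E \<le> exp (- e\<^sup>2 / (2 * D))
      + 4 * (real k)\<^sup>2 * exp (s\<^sup>2 / 2 * (gconst * ln k + 2 * gconst * (ln N - ln n) + 807) - s * (a - e)) / T \<and>
    (\<forall>\<omega>\<in>space M - E. card {y \<in> sqball k x. a \<le> \<Phi> \<omega> y} < T)"
proof -
  let ?B = "sqball k x"
  define v where "v = gr (intr N) x x - gr ?B x x"
  define h where "h = (\<lambda>z. unit_at x z - rho ?B x z)"
  define r where "r = (\<lambda>y z. unit_at y z - h z)"
  define \<sigma> where "\<sigma> = gconst * ln k + 2 * gconst * (ln N - ln n) + 807"
  define X where "X = (\<lambda>\<omega>. \<Sum>y\<in>?B. exp (s * (L (r y) \<omega> - (a - e))))"
  define E where "E = {\<omega> \<in> space M. e \<le> L h \<omega>} \<union> {\<omega> \<in> space M. T \<le> X \<omega>}"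
  have B_sub: "?B \<subseteq> intr N" using sub k by (force simp: sqball_def)
  have B_box: "?B \<subseteq> box N" using B_sub intr_subset_box by blast
  have x_B: "x \<in> ?B" using k by (simp add: sqball_def)
  have G_le: "gr (intr N) y y \<le> gconst * ln N + 161" if "y \<in> ?B" for y using B_box that by (intro gr_intr_le) auto
  have v: "0 \<le> v" "v \<le> D" "v \<le> gconst * (ln N - ln k) + 322"
    using gr_mono[OF finite_intr B_sub, of x x] gr_nonneg[OF finite_sqball, of k x x x] G_le[OF x_B] D
      gr_sqball_center[OF k(1), of x] by (auto simp: v_def abs_le_iff algebra_simps)
  have q0: "qf N (rho ?B x) (rho ?B x) = gr ?B x x" by (rule qf_rho_nested[OF subset_refl B_sub])
  have q1: "qf N (rho ?B x) (unit_at y) = gr ?B x y" for y by (rule qf_rho_unit_at[OF B_sub])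
  have q1': "qf N (unit_at y) (rho ?B x) = gr ?B x y" for y using q1 by (simp add: qf_commute)
  have q2: "qf N (unit_at y) (unit_at z) = gr (intr N) y z" if "y \<in> ?B" "z \<in> ?B" for y z
    using that B_box by (intro qf_unit_at) auto
  have hh: "qf N h h = v" unfolding h_def v_def qf_bilinear using q2[OF x_B x_B] by (simp add: q0 q1 q1')
  have rr: "qf N (r y) (r y) \<le> \<sigma>" if y: "y \<in> ?B" for y
  proof -
    have "qf N (unit_at y) h = gr (intr N) x y - gr ?B x y"
      unfolding h_def qf_bilinear q2[OF y x_B] q1' by (simp add: gr_sym[OF finite_intr, of N y x])
    moreover from this have "qf N h (unit_at y) = gr (intr N) x y - gr ?B x y" by (simp add: qf_commute)
    ultimately have "qf N (r y) (r y) = gr (intr N) y y - 2 * (gr (intr N) x y - gr ?B x y) + v"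
      unfolding r_def by (simp add: qf_bilinear q2[OF y y] hh)
    \<comment> \<open>The variance of \<open>r y\<close> has three parts; 807 = 161 + 2 * 162 +
      322.\<close>
    also have "\<dots> \<le> (gconst * ln N + 161) - 2 * (gconst * (ln n - ln k) - 162) + (gconst * (ln N - ln k) + 322)"
    proof -
      have "G - 2 * d + v \<le> G' - 2 * d' + v'" if "G \<le> G'" "d' \<le> d" "v \<le> v'" for G G' d d' v v' :: real
        using that by linarith
      then show ?thesis
        using G_le[OF y] gr_diff_lower_bound[OF finite_intr sub k(2) y] v(3) by blast
    qed
    also have "\<dots> = \<sigma>" by (simp add: \<sigma>_def algebra_simps)
    finally show ?thesis .
  qed
  have P1: "prob {\<omega> \<in> space M. e \<le> L h \<omega>} \<le> exp (- e\<^sup>2 / (2 * D))"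
  proof -
    define s' where "s' = e / D"
    have s': "0 < s'" using e D by (simp add: s'_def)
    note g = gff_exp[OF is_gff, of "\<lambda>z. s' * h z"]
    have "prob {\<omega> \<in> space M. e \<le> L h \<omega>} \<le> prob {\<omega> \<in> space M. exp (s' * e) \<le> exp (L (\<lambda>z. s' * h z) \<omega>)}"
      using s' by (intro finite_measure_mono) (auto simp: lin_cmult)
    also have "\<dots> \<le> (\<integral>\<omega>. exp (L (\<lambda>z. s' * h z) \<omega>) \<partial>M) / exp (s' * e)"
      by (intro integral_Markov_inequality_measure[OF g(2), where A = "{}"]) auto
    also have "\<dots> = exp (s'\<^sup>2 * v / 2 - s' * e)"
      unfolding g(3) by (simp add: qf_bilinear hh power2_eq_square mult.assoc exp_diff)
    also have "s'\<^sup>2 * v / 2 - s' * e \<le> s'\<^sup>2 * D / 2 - s' * e" using v by (simp add: mult_left_mono)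
    also have "\<dots> = - e\<^sup>2 / (2 * D)" using D by (simp add: s'_def power2_eq_square field_simps)
    finally show ?thesis by simp
  qed
  have X_le: "integrable M (\<lambda>\<omega>. exp (s * (L (r y) \<omega> - (a - e))))"
    "(\<integral>\<omega>. exp (s * (L (r y) \<omega> - (a - e))) \<partial>M) \<le> exp (s\<^sup>2 / 2 * \<sigma> - s * (a - e))" if "y \<in> ?B" for y
  proof -
    have eq: "exp (s * (L (r y) \<omega> - (a - e))) = exp (L (\<lambda>z. s * r y z) \<omega> + - (s * (a - e)))" for \<omega>
      by (simp add: lin_cmult right_diff_distrib)
    show "integrable M (\<lambda>\<omega>. exp (s * (L (r y) \<omega> - (a - e))))"
      unfolding eq by (rule gff_exp_le[OF is_gff, where c = "\<lambda>z. s * r y z" and b = "- (s * (a - e))"]; simp)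
    have "(\<integral>\<omega>. exp (s * (L (r y) \<omega> - (a - e))) \<partial>M) \<le> exp (qf N (\<lambda>z. s * r y z) (\<lambda>z. s * r y z) / 2 + - (s * (a - e)))"
      unfolding eq by (rule gff_exp_le[OF is_gff]; simp)
    also have "qf N (\<lambda>z. s * r y z) (\<lambda>z. s * r y z) / 2 = s\<^sup>2 / 2 * qf N (r y) (r y)"
      by (simp add: qf_bilinear power2_eq_square)
    also have "\<dots> \<le> s\<^sup>2 / 2 * \<sigma>" using rr[OF that] by (intro mult_left_mono) auto
    finally show "(\<integral>\<omega>. exp (s * (L (r y) \<omega> - (a - e))) \<partial>M) \<le> exp (s\<^sup>2 / 2 * \<sigma> - s * (a - e))" by simp
  qed
  have X_int: "integrable M X" unfolding X_def using X_le(1) by (intro Bochner_Integration.integrable_sum)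
  have P2: "prob {\<omega> \<in> space M. T \<le> X \<omega>} \<le> 4 * (real k)\<^sup>2 * exp (s\<^sup>2 / 2 * \<sigma> - s * (a - e)) / T"
  proof -
    have "prob {\<omega> \<in> space M. T \<le> X \<omega>} \<le> (\<integral>\<omega>. X \<omega> \<partial>M) / T"
      using T by (intro integral_Markov_inequality_measure[OF X_int, where A = "{}"]) (auto simp: X_def intro!: sum_nonneg)
    also have "(\<integral>\<omega>. X \<omega> \<partial>M) = (\<Sum>y\<in>?B. \<integral>\<omega>. exp (s * (L (r y) \<omega> - (a - e))) \<partial>M)"
      unfolding X_def using X_le(1) by (intro Bochner_Integration.integral_sum)
    also have "\<dots> \<le> real (card ?B) * exp (s\<^sup>2 / 2 * \<sigma> - s * (a - e))"
      using X_le(2) by (intro sum_bounded_above)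
    also have "\<dots> \<le> 4 * (real k)\<^sup>2 * exp (s\<^sup>2 / 2 * \<sigma> - s * (a - e))"
      by (intro mult_right_mono card_sqball_le) auto
    finally show ?thesis using T by (simp add: divide_right_mono)
  qed
  have X_meas [measurable]: "X \<in> borel_measurable M" using X_int by auto
  have "E \<in> events" unfolding E_def by measurable
  moreover have "prob E \<le> exp (- e\<^sup>2 / (2 * D)) + 4 * (real k)\<^sup>2 * exp (s\<^sup>2 / 2 * \<sigma> - s * (a - e)) / T"
    unfolding E_def using P1 P2
    by (intro order_trans[OF measure_Un_le] add_mono) measurable
  moreover have "card {y \<in> ?B. a \<le> \<Phi> \<omega> y} < T" if \<omega>: "\<omega> \<in> space M - E" for \<omega>
  proof -
    have *: "L h \<omega> < e" "X \<omega> < T" using \<omega> by (auto simp: E_def not_le)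
    have "real (card {y \<in> ?B. a \<le> \<Phi> \<omega> y}) = (\<Sum>y | y \<in> ?B \<and> a \<le> \<Phi> \<omega> y. 1)" by simp
    also have "\<dots> \<le> (\<Sum>y | y \<in> ?B \<and> a \<le> \<Phi> \<omega> y. exp (s * (L (r y) \<omega> - (a - e))))"
    proof (intro sum_mono)
      fix y assume y: "y \<in> {y \<in> ?B. a \<le> \<Phi> \<omega> y}"
      have "L (r y) \<omega> = \<Phi> \<omega> y - L h \<omega>" using y B_box unfolding r_def lin_diff by (auto simp: lin_unit_at)
      then have "0 \<le> s * (L (r y) \<omega> - (a - e))" using y *(1) s by (intro mult_nonneg_nonneg) auto
      then show "1 \<le> exp (s * (L (r y) \<omega> - (a - e)))" by simp
    qed
    also have "\<dots> \<le> X \<omega>" unfolding X_def by (intro sum_mono2) auto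
    finally show ?thesis using *(2) by linarith
  qed
  ultimately show ?thesis unfolding \<sigma>_def by blast
qed

end

section \<open>Geometry of the inner box\<close>

lemma inner_box_iff:
  assumes "0 < l" "1 \<le> N"
  shows "x \<in> inner_box l N \<longleftrightarrow> l * N \<le> real_of_int (fst x) \<and> real_of_int (fst x) \<le> real N + 1 - l * N
    \<and> l * N \<le> real_of_int (snd x) \<and> real_of_int (snd x) \<le> real N + 1 - l * N"
proof -
  obtain a b where x: "x = (a, b)" by (cases x)
  have lN: "0 < l * real N" using assms by simp
  let ?A = "{edist x z | z. z \<notin> box N}"
  have bdd: "bdd_below ?A" by (intro bdd_belowI[of _ 0]) (auto simp: edist_def)
  show ?thesis
  proof
    assume xi: "x \<in> inner_box l N"
    then have ab: "1 \<le> a" "a \<le> int N" "1 \<le> b" "b \<le> int N" and Inf: "l * N \<le> Inf ?A"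
      by (auto simp: inner_box_def box_def x dist_compl_def)
    have le: "l * N \<le> edist x z" if "z \<notin> box N" for z
    proof -
      have "edist x z \<in> ?A" using that by blast
      from cInf_lower[OF this bdd] Inf show ?thesis by linarith
    qed
    \<comment> \<open>The nearest points of the complement lie straight across the four sides, in
      the rows and columns 0 and N + 1.\<close>
    have "edist x (0, b) = a" "edist x (a, 0) = b"
      "edist x (int N + 1, b) = N + 1 - a" "edist x (a, int N + 1) = N + 1 - b"
      using ab by (auto simp: edist_def x)
    moreover have "(0, b) \<notin> box N" "(a, 0) \<notin> box N" "(int N + 1, b) \<notin> box N" "(a, int N + 1) \<notin> box N"
      by (auto simp: box_def)
    ultimately show "l * N \<le> real_of_int (fst x) \<and> real_of_int (fst x) \<le> real N + 1 - l * N
      \<and> l * N \<le> real_of_int (snd x) \<and> real_of_int (snd x) \<le> real N + 1 - l * N"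
      using le[of "(0, b)"] le[of "(a, 0)"] le[of "(int N + 1, b)"] le[of "(a, int N + 1)"] by (auto simp: x)
  next
    assume "l * N \<le> real_of_int (fst x) \<and> real_of_int (fst x) \<le> real N + 1 - l * N
      \<and> l * N \<le> real_of_int (snd x) \<and> real_of_int (snd x) \<le> real N + 1 - l * N"
    then have ab: "l * N \<le> a" "a \<le> real N + 1 - l * N" "l * N \<le> b" "b \<le> real N + 1 - l * N" by (auto simp: x)
    have "1 \<le> a" "a \<le> int N" "1 \<le> b" "b \<le> int N" using ab lN by linarith+
    then have "x \<in> box N" by (auto simp: box_def x)
    moreover have "l * N \<le> Inf ?A"
    proof (rule cInf_greatest)
      have "(0, 0) \<notin> box N" by (simp add: box_def)
      then show "?A \<noteq> {}" by blast
      fix d assume "d \<in> ?A"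
      then obtain z where z: "z \<notin> box N" "d = edist x z" by blast
      have 1: "\<bar>a - fst z\<bar> \<le> d" "\<bar>b - snd z\<bar> \<le> d"
        unfolding z(2) edist_def x using real_sqrt_ge_abs1[of "real_of_int (a - fst z)" "real_of_int (b - snd z)"]
          real_sqrt_ge_abs2[of "real_of_int (b - snd z)" "real_of_int (a - fst z)"] by auto
      have "fst z \<le> 0 \<or> int N + 1 \<le> fst z \<or> snd z \<le> 0 \<or> int N + 1 \<le> snd z"
        using z(1) by (cases z) (auto simp: box_def)
      then have "real_of_int (fst z) \<le> 0 \<or> real N + 1 \<le> real_of_int (fst z) \<or> real_of_int (snd z) \<le> 0 \<or> real N + 1 \<le> real_of_int (snd z)"
        by linarith
      then show "l * N \<le> d" using 1 ab by (auto simp: abs_le_iff)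
    qed
    ultimately show "x \<in> inner_box l N" by (simp add: inner_box_def dist_compl_def)
  qed
qed

lemma inner_box_intr:
  assumes "0 < l" "2 \<le> l * N"
  shows "inner_box l N \<subseteq> intr N"
proof
  fix x assume x: "x \<in> inner_box l N"
  have N: "1 \<le> N" using assms by (cases N) auto
  have "2 \<le> fst x" "fst x \<le> int N - 1" "2 \<le> snd x" "snd x \<le> int N - 1"
    using x assms unfolding inner_box_iff[OF assms(1) N] by linarith+
  then show "x \<in> intr N" by (cases x) (auto simp: intr_def bdry_def box_def nbrs_def)
qed

text \<open>Needed because \<open>Max\<close> of an empty set is unspecified; the witness is the
  middle of the box.\<close>

lemma inner_box_nonempty:
  assumes "0 < l" "l < 1 / 2" "1 \<le> N"
  shows "inner_box l N \<noteq> {}"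
proof -
  define a where "a = int ((N + 1) div 2)"
  have "N \<le> 2 * ((N + 1) div 2)" "2 * ((N + 1) div 2) \<le> N + 1" by auto
  then have "real N \<le> 2 * real_of_int a" "2 * real_of_int a \<le> real N + 1"
    unfolding a_def by linarith+
  moreover have "l * N \<le> 1 / 2 * N" using assms by (intro mult_right_mono) auto
  ultimately have "(a, a) \<in> inner_box l N" unfolding inner_box_iff[OF assms(1,3)] by auto
  then show ?thesis by blast
qed

text \<open>From any point of the inner box one can step towards the centre in both coordinates, so a row
  of \<open>m\<close> well separated boxes fits into the inner box nearby.\<close>
lemma row_of_boxes:
  assumes l: "0 < l" "1 \<le> N" and x: "x \<in> inner_box l N" and qm: "1 \<le> q" "1 \<le> m" "14 * real q * real m \<le> (1 / 2 - l) * N"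
  obtains c where "\<And>i. i < m \<Longrightarrow> sqball (4 * q) (c i) \<subseteq> inner_box l N"
    "\<And>i z. i < m \<Longrightarrow> z \<in> sqball (4 * q) (c i) \<Longrightarrow> edist z x \<le> 28 * real q * real m"
    "\<And>i j. i \<noteq> j \<Longrightarrow> 9 * int q \<le> \<bar>fst (c i) - fst (c j)\<bar>"
proof -
  define dir where "dir = (\<lambda>a :: int. if 2 * a \<le> int N then 1 else -1 :: int)"
  define c where "c = (\<lambda>i :: nat. (fst x + dir (fst x) * (10 * int q * (int i + 1)), snd x + dir (snd x) * (10 * int q)))"
  note x' = x[unfolded inner_box_iff[OF l]]
  \<comment> \<open>The last centre is displaced by 10qm and its box reaches less than 4q further,
    which is within 14qm.\<close>
  define R where "R = 14 * int q * int m"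
  have R: "real_of_int R = 14 * real q * real m" by (simp add: R_def)
  have move: "l * N \<le> real_of_int a' \<and> real_of_int a' \<le> real N + 1 - l * N \<and> \<bar>a' - a\<bar> \<le> R"
    if "l * N \<le> real_of_int a" "real_of_int a \<le> real N + 1 - l * N" "0 \<le> dir a * (a' - a)" "dir a * (a' - a) \<le> R" for a a'
  proof (cases "2 * a \<le> int N")
    case True
    then have "a \<le> a'" "a' \<le> a + R" using that by (auto simp: dir_def)
    moreover have "2 * real_of_int a \<le> real N" using True by linarith
    ultimately show ?thesis using that R qm by (auto simp: algebra_simps)
  next
    case False
    then have "a' \<le> a" "a - R \<le> a'" using that by (auto simp: dir_def)
    moreover have "real N \<le> 2 * real_of_int a" using False by linarith
    ultimately show ?thesis using that R qm by (auto simp: algebra_simps)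
  qed
  have near: "0 \<le> dir a * (z - a) \<and> dir a * (z - a) \<le> R"
    if "\<bar>z - (a + dir a * (10 * int q * (int i + 1)))\<bar> < 4 * int q" "i < m" for a z i
  proof -
    have "dir a * dir a = 1" "\<bar>dir a\<bar> = 1" by (auto simp: dir_def)
    define d where "d = z - (a + dir a * (10 * int q * (int i + 1)))"
    have "dir a * (z - a) = dir a * d + (dir a * dir a) * (10 * int q * (int i + 1))"
      by (simp add: d_def algebra_simps)
    then have eq: "dir a * (z - a) = dir a * d + 10 * int q * (int i + 1)" using \<open>dir a * dir a = 1\<close> by simp
    have "\<bar>dir a * d\<bar> \<le> 4 * int q" using that \<open>\<bar>dir a\<bar> = 1\<close> by (simp add: abs_mult d_def)
    moreover have "int q * 1 \<le> int q * (int i + 1)" "int q * (int i + 1) \<le> int q * int m" "int q * 1 \<le> int q * int m"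
      using that(2) qm by (auto intro!: mult_left_mono)
    ultimately show ?thesis unfolding eq R_def by linarith
  qed
  have loc: "z \<in> inner_box l N \<and> \<bar>fst z - fst x\<bar> \<le> R \<and> \<bar>snd z - snd x\<bar> \<le> R" if "i < m" "z \<in> sqball (4 * q) (c i)" for i z
  proof -
    have "0 < m" using qm by simp
    have "\<bar>fst z - (fst x + dir (fst x) * (10 * int q * (int i + 1)))\<bar> < 4 * int q"
      "\<bar>snd z - (snd x + dir (snd x) * (10 * int q * (int 0 + 1)))\<bar> < 4 * int q"
      using that(2) by (auto simp: sqball_def c_def)
    from near[OF this(1) that(1)] near[OF this(2) \<open>0 < m\<close>]
    show ?thesis using move[of "fst x" "fst z"] move[of "snd x" "snd z"] x' unfolding inner_box_iff[OF l] by auto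
  qed
  show ?thesis
  proof (rule that[of c])
    show "sqball (4 * q) (c i) \<subseteq> inner_box l N" if "i < m" for i using loc[OF that] by blast
    show "edist z x \<le> 28 * real q * real m" if "i < m" "z \<in> sqball (4 * q) (c i)" for i z
    proof -
      have "edist z x \<le> \<bar>real_of_int (fst z - fst x)\<bar> + \<bar>real_of_int (snd z - snd x)\<bar>"
        unfolding edist_def by (rule sqrt_sum_squares_le_sum_abs)
      also have "\<dots> = real_of_int (\<bar>fst z - fst x\<bar> + \<bar>snd z - snd x\<bar>)" by simp
      also have "\<dots> \<le> real_of_int (R + R)" using loc[OF that] by (intro of_int_le_iff[THEN iffD2] add_mono) auto
      finally show ?thesis using R by simp
    qed
    show "9 * int q \<le> \<bar>fst (c i) - fst (c j)\<bar>" if "i \<noteq> j" for i j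
    proof -
      have "fst (c i) - fst (c j) = dir (fst x) * (10 * int q * (int i - int j))"
        by (simp add: c_def algebra_simps)
      moreover have "\<bar>dir (fst x)\<bar> = 1" by (simp add: dir_def)
      ultimately have "\<bar>fst (c i) - fst (c j)\<bar> = 10 * int q * \<bar>int i - int j\<bar>" by (simp add: abs_mult)
      moreover have "int q * 1 \<le> int q * \<bar>int i - int j\<bar>" using that by (intro mult_left_mono) auto
      ultimately show ?thesis by linarith
    qed
  qed
qed

section \<open>Choice of parameters and conclusion\<close>

lemma nat_floor_bounds:
  fixes a :: real
  assumes "1 \<le> a"
  shows "1 \<le> nat \<lfloor>a\<rfloor>" "a / 2 \<le> nat \<lfloor>a\<rfloor>" "nat \<lfloor>a\<rfloor> \<le> a"
proof -
  have "1 \<le> \<lfloor>a\<rfloor>" using assms by simp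
  moreover from this have "real (nat \<lfloor>a\<rfloor>) = real_of_int \<lfloor>a\<rfloor>" by simp
  ultimately show "1 \<le> nat \<lfloor>a\<rfloor>" "a / 2 \<le> nat \<lfloor>a\<rfloor>" "nat \<lfloor>a\<rfloor> \<le> a" by linarith+
qed

lemma ln_2_bounds: "1 / 2 \<le> ln (2::real)" "ln (2::real) \<le> 1"
proof -
  have "(1::real) \<le> ln 4" using exp_le ln_mono[of "exp 1" 4] by simp
  moreover have "ln (4::real) = 2 * ln 2" using ln_realpow[of 2 2] by simp
  ultimately show "1 / 2 \<le> ln (2::real)" by simp
  show "ln (2::real) \<le> 1" using ln_le_minus_one[of 2] by simp
qed

text \<open>The boxes of the lower bound have side \<open>N powr b\<close> with \<open>b\<close> slightly below \<open>\<beta>\<close>, and the tilt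
  \<open>t = 2 * \<tau> / sqrt gconst\<close> is slightly larger than needed to reach the level \<open>\<alpha>\<close>, i.e. \<open>\<tau> * b > \<alpha>\<close>.\<close>
lemma choose_parameters:
  fixes \<alpha> \<beta> \<delta> :: real
  assumes "0 < \<alpha>" "\<alpha> < \<beta>" "0 < \<delta>"
  obtains b t \<epsilon> where "0 < b" "b < \<beta>" "0 < t" "t\<^sup>2 \<le> 2 * pi" "0 < \<epsilon>"
    "2 * sqrt gconst * \<alpha> + 2 * \<epsilon> < t * gconst * b" "t * \<epsilon> < (\<beta> - b) / 2"
    "2 * \<beta> * (1 - (\<alpha> / \<beta>)\<^sup>2) - \<delta> < b * (2 - t\<^sup>2 * gconst / 2) - t * \<epsilon>"
    "(2 * \<alpha> / (sqrt gconst * \<beta>)) * \<epsilon> \<le> \<delta> / 2"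
proof -
  define v where "v = 2 * \<beta> * (1 - (\<alpha> / \<beta>)\<^sup>2)"
  define s where "s = 2 * \<alpha> / (sqrt gconst * \<beta>)"
  have g: "0 < sqrt gconst" "sqrt gconst * sqrt gconst = gconst" using gconst_bounds by auto
  have \<beta>: "0 < \<beta>" using assms by simp
  have s: "0 < s" using assms \<beta> g by (simp add: s_def)
  \<comment> \<open>All requirements are strict in the limit, so h, then b, then \<epsilon> can be
    chosen close enough to their limits to keep them.\<close>
  have lim: "((\<lambda>h. 2 * \<beta> * (1 - (\<alpha> / \<beta> + h)\<^sup>2)) \<longlongrightarrow> 2 * \<beta> * (1 - (\<alpha> / \<beta> + 0)\<^sup>2)) (at_right 0)"
    "((\<lambda>h. \<alpha> / \<beta> + h) \<longlongrightarrow> \<alpha> / \<beta> + 0) (at_right 0)"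
    by (intro tendsto_intros)+
  have "v - \<delta> < 2 * \<beta> * (1 - (\<alpha> / \<beta> + 0)\<^sup>2)" "\<alpha> / \<beta> + 0 < 1" using assms by (simp_all add: v_def)
  from order_tendstoD(1)[OF lim(1) this(1)] order_tendstoD(2)[OF lim(2) this(2)]
  have "\<forall>\<^sub>F h in at_right 0. v - \<delta> < 2 * \<beta> * (1 - (\<alpha> / \<beta> + h)\<^sup>2)" "\<forall>\<^sub>F h in at_right 0. \<alpha> / \<beta> + h < 1" .
  moreover have "\<forall>\<^sub>F h in at_right (0::real). 0 < h" by (rule eventually_at_right_less)
  ultimately have "\<forall>\<^sub>F h in at_right 0. v - \<delta> < 2 * \<beta> * (1 - (\<alpha> / \<beta> + h)\<^sup>2) \<and> \<alpha> / \<beta> + h < 1 \<and> 0 < h"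
    by eventually_elim auto
  then obtain h where h: "v - \<delta> < 2 * \<beta> * (1 - (\<alpha> / \<beta> + h)\<^sup>2)" "\<alpha> / \<beta> + h < 1" "0 < h"
    using eventually_happens'[OF trivial_limit_at_right_real] by blast
  define \<tau> where "\<tau> = \<alpha> / \<beta> + h"
  have \<tau>: "0 < \<tau>" "\<tau> < 1" "\<alpha> < \<tau> * \<beta>" "v - \<delta> < \<beta> * (2 * (1 - \<tau>\<^sup>2))"
  proof -
    have "0 < \<alpha> / \<beta>" using assms \<beta> by simp
    then show "0 < \<tau>" using h unfolding \<tau>_def by linarith
    show "\<tau> < 1" using h(2) by (simp add: \<tau>_def)
    show "\<alpha> < \<tau> * \<beta>" using h(3) \<beta> by (simp add: \<tau>_def distrib_right)
    show "v - \<delta> < \<beta> * (2 * (1 - \<tau>\<^sup>2))" using h(1) by (simp add: \<tau>_def mult_ac)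
  qed
  have lim: "((\<lambda>b. \<tau> * b) \<longlongrightarrow> \<tau> * \<beta>) (at_left \<beta>)" "((\<lambda>b. b * (2 * (1 - \<tau>\<^sup>2))) \<longlongrightarrow> \<beta> * (2 * (1 - \<tau>\<^sup>2))) (at_left \<beta>)"
    "((\<lambda>b. b) \<longlongrightarrow> \<beta>) (at_left \<beta>)"
    by (intro tendsto_intros)+
  note order_tendstoD(1)[OF lim(1) \<tau>(3)] order_tendstoD(1)[OF lim(2) \<tau>(4)] order_tendstoD(1)[OF lim(3) \<beta>]
  moreover have "\<forall>\<^sub>F b in at_left \<beta>. b < \<beta>" by (rule eventually_at_leftI[of "\<beta> - 1"]) auto
  ultimately have "\<forall>\<^sub>F b in at_left \<beta>. \<alpha> < \<tau> * b \<and> v - \<delta> < b * (2 * (1 - \<tau>\<^sup>2)) \<and> 0 < b \<and> b < \<beta>"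
    by eventually_elim auto
  then obtain b where b: "\<alpha> < \<tau> * b" "v - \<delta> < b * (2 * (1 - \<tau>\<^sup>2))" "0 < b" "b < \<beta>"
    using eventually_happens'[OF trivial_limit_at_left_real] by blast
  \<comment> \<open>Then t^2 = 2 pi \<tau>^2, so \<tau> < 1 is exactly the subcritical
    range.\<close>
  define t where "t = 2 * \<tau> / sqrt gconst"
  have t: "0 < t" using \<tau> g by (simp add: t_def)
  have tg: "t * gconst = 2 * sqrt gconst * \<tau>"
    using g by (simp add: t_def field_simps)
  have t2: "t\<^sup>2 * gconst / 2 = 2 * \<tau>\<^sup>2"
    using gconst_bounds by (simp add: t_def power_divide)
  have "t\<^sup>2 = 2 * pi * \<tau>\<^sup>2"
    using gconst_bounds by (simp add: t_def power_divide gconst_def)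
  also have "\<dots> \<le> 2 * pi * 1" using \<tau> by (intro mult_left_mono power_le_one) auto
  finally have t_le: "t\<^sup>2 \<le> 2 * pi" by simp
  have lims: "((\<lambda>\<epsilon>. 2 * sqrt gconst * \<alpha> + 2 * \<epsilon>) \<longlongrightarrow> 2 * sqrt gconst * \<alpha> + 2 * 0) (at_right 0)"
    "((\<lambda>\<epsilon>. t * \<epsilon>) \<longlongrightarrow> t * 0) (at_right 0)" "((\<lambda>\<epsilon>. s * \<epsilon>) \<longlongrightarrow> s * 0) (at_right 0)"
    by (intro tendsto_intros)+
  have "2 * sqrt gconst * \<alpha> < t * gconst * b"
    using mult_strict_left_mono[OF b(1), of "2 * sqrt gconst"] g unfolding tg by simp
  then have "\<forall>\<^sub>F \<epsilon> in at_right 0. 2 * sqrt gconst * \<alpha> + 2 * \<epsilon> < t * gconst * b"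
    using order_tendstoD(2)[OF lims(1)] by simp
  moreover have "\<forall>\<^sub>F \<epsilon> in at_right 0. t * \<epsilon> < min ((\<beta> - b) / 2) (b * (2 * (1 - \<tau>\<^sup>2)) - (v - \<delta>))"
  proof (rule order_tendstoD(2)[OF lims(2)])
    show "t * 0 < min ((\<beta> - b) / 2) (b * (2 * (1 - \<tau>\<^sup>2)) - (v - \<delta>))" using b by simp
  qed
  moreover have "\<forall>\<^sub>F \<epsilon> in at_right 0. s * \<epsilon> < \<delta> / 2"
    by (rule order_tendstoD(2)[OF lims(3)]) (use assms in simp)
  moreover have "\<forall>\<^sub>F \<epsilon> in at_right (0::real). 0 < \<epsilon>" by (rule eventually_at_right_less)
  ultimately have "\<forall>\<^sub>F \<epsilon> in at_right 0. 2 * sqrt gconst * \<alpha> + 2 * \<epsilon> < t * gconst * b \<and>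
    t * \<epsilon> < min ((\<beta> - b) / 2) (b * (2 * (1 - \<tau>\<^sup>2)) - (v - \<delta>)) \<and> s * \<epsilon> < \<delta> / 2 \<and> 0 < \<epsilon>"
    by eventually_elim auto
  then obtain \<epsilon> where \<epsilon>: "2 * sqrt gconst * \<alpha> + 2 * \<epsilon> < t * gconst * b"
    "t * \<epsilon> < min ((\<beta> - b) / 2) (b * (2 * (1 - \<tau>\<^sup>2)) - (v - \<delta>))" "s * \<epsilon> < \<delta> / 2" "0 < \<epsilon>"
    using eventually_happens'[OF trivial_limit_at_right_real] by blast
  show ?thesis
  proof (rule that[of b t \<epsilon>])
    show "2 * \<beta> * (1 - (\<alpha> / \<beta>)\<^sup>2) - \<delta> < b * (2 - t\<^sup>2 * gconst / 2) - t * \<epsilon>"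
      using \<epsilon>(2) unfolding t2 v_def[symmetric] by (simp add: right_diff_distrib)
  qed (use b t t_le \<epsilon> in \<open>auto simp: s_def\<close>)
qed

context gff
begin

text \<open>\<open>N1\<close> to \<open>N7\<close> collect what is needed of a large N; the
  resulting bound depends on N only through \<open>\<Lambda>\<close> and not on \<open>x\<close>, so
  it passes to the maximum. The tilt \<open>s\<close> minimises s^2/2 * gconst * \<beta> \<Lambda> -
  s u, the leading exponent of the first moment.\<close>

lemma atypical_count_bound:
  fixes l \<alpha> \<beta> \<delta> b t \<epsilon> :: real
  assumes l: "0 < l" "l < 1 / 2" and \<alpha>: "0 < \<alpha>" "\<alpha> < \<beta>" "\<beta> < 1" "0 < \<delta>"
    and par: "0 < b" "b < \<beta>" "0 < t" "t\<^sup>2 \<le> 2 * pi" "0 < \<epsilon>" "(2 * \<alpha> / (sqrt gconst * \<beta>)) * \<epsilon> \<le> \<delta> / 2"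
  defines "\<kappa> \<equiv> (\<beta> - b) / 2" and "v \<equiv> 2 * \<beta> * (1 - (\<alpha> / \<beta>)\<^sup>2)" and "\<Lambda> \<equiv> ln (real N)"
    and "s \<equiv> 2 * \<alpha> / (sqrt gconst * \<beta>)"
  assumes N1: "161 \<le> \<Lambda>" and N2: "8 \<le> l * N" and N3: "28 * N powr (b + \<kappa>) \<le> N powr \<beta>"
    and N4: "N powr \<beta> \<le> (1 / 2 - l) * N" and N5: "N powr \<beta> + 1 < l * N / 4"
    and N6: "2 * sqrt gconst * \<alpha> * \<Lambda> \<le> t * (gconst * (b * \<Lambda> - 1) - 161) - 2 * (\<epsilon> * \<Lambda>)"
    and N7: "(v - \<delta>) * \<Lambda> \<le> (2 - t\<^sup>2 * gconst / 2) * (b * \<Lambda> - 1) - t * (\<epsilon> * \<Lambda>) - 488 * pi - 1"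
    and x: "x \<in> inner_box l N"
  shows "measure M {\<omega> \<in> space M. let k = card (high_pts l N \<alpha> (\<Phi> \<omega>) \<inter> disc N x (real N powr \<beta>)) in
      k = 0 \<or> \<bar>ln (real k) / ln (real N) - 2 * \<beta> * (1 - (\<alpha> / \<beta>)\<^sup>2)\<bar> > \<delta>}
    \<le> 4 * (exp (648 * pi) * exp (t * (\<epsilon> * \<Lambda>)) * (1 + 16 * (2 * \<Lambda> + 4)) * (2 * exp (- (\<kappa> * \<Lambda>)))
        + 2 * ((2 * \<Lambda> + 7) * exp (- (\<epsilon>\<^sup>2 * \<Lambda> / 4))))
      + (exp (- (\<epsilon>\<^sup>2 * \<Lambda> / 4)) + 16 * exp (s\<^sup>2 / 2 * (808 + 2 * ln (4 / l))) * exp (- (\<delta> / 2 * \<Lambda>)))"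
    (is "measure M ?bad \<le> ?low + ?up")
proof -
  have N0: "1 \<le> N" "0 < real N" using N2 l by (cases N; simp)+
  have powr_exp: "real N powr a = exp (a * \<Lambda>)" for a using N0 by (simp add: powr_def \<Lambda>_def)
  have ge1: "1 \<le> real N powr a" if "0 < a" for a using that N1 by (simp add: powr_exp)
  have \<beta>: "0 < \<beta>" using \<alpha> by simp
  have g: "0 < sqrt gconst" "sqrt gconst * sqrt gconst = gconst" using gconst_bounds by auto
  have s: "0 < s" using \<alpha> \<beta> g by (simp add: s_def)
  define u where "u = 2 * sqrt gconst * \<alpha> * \<Lambda>"
  define H where "H = (\<lambda>\<omega>. high_pts l N \<alpha> (\<Phi> \<omega>) \<inter> disc N x (real N powr \<beta>))"
  \<comment> \<open>\<open>N1\<close> lets \<open>\<Lambda>\<close> absorb the additive 161 in the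
    variance bound.\<close>
  define D where "D = 2 * \<Lambda>"
  have D: "gconst * ln N + 161 \<le> D" "0 < D"
  proof -
    have "gconst * \<Lambda> \<le> 1 * \<Lambda>" using gconst_bounds N1 by (intro mult_right_mono) auto
    then show "gconst * ln N + 161 \<le> D" "0 < D" using N1 unfolding D_def \<Lambda>_def by linarith+
  qed
  have e: "0 < \<epsilon> * \<Lambda>" using par N1 by simp
  have tail: "- (\<epsilon> * \<Lambda>)\<^sup>2 / (2 * D) = - (\<epsilon>\<^sup>2 * \<Lambda> / 4)"
    using N1 by (simp add: D_def power2_eq_square)
  have "\<exists>E\<in>events. prob E \<le> ?low \<and> (\<forall>\<omega>\<in>space M - E. real N powr (v - \<delta>) \<le> card (H \<omega>))"
  proof -
    define q where "q = nat \<lfloor>N powr b\<rfloor>"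
    define m where "m = nat \<lfloor>N powr \<kappa>\<rfloor>"
    have \<kappa>: "0 < \<kappa>" using par by (simp add: \<kappa>_def)
    note q = nat_floor_bounds[OF ge1[OF par(1)], folded q_def]
    note m = nat_floor_bounds[OF ge1[OF \<kappa>], folded m_def]
    have ln_q: "b * \<Lambda> - 1 \<le> ln q" "ln q \<le> \<Lambda>"
    proof -
      have "ln (N powr b / 2) \<le> ln q" using q N0 by (subst ln_le_cancel_iff) auto
      moreover have "ln (N powr b / 2) = b * \<Lambda> - ln 2" using N0 by (simp add: ln_div powr_exp)
      ultimately show "b * \<Lambda> - 1 \<le> ln q" using ln_2_bounds by linarith
      have "ln q \<le> ln (N powr b)" using q N0 by (subst ln_le_cancel_iff) auto
      also have "\<dots> = b * \<Lambda>" by (simp add: powr_exp)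
      also have "\<dots> \<le> 1 * \<Lambda>" using par \<alpha> N1 by (intro mult_right_mono) auto
      finally show "ln q \<le> \<Lambda>" by simp
    qed
    \<comment> \<open>The power of two just above 2q, so that the dyadic scales cover all distances
      within a box of radius q.\<close>
    obtain j where j: "2 ^ j \<le> 2 * q" "2 * q < 2 ^ (j + 1)" using ex_power_ivl1[of 2 "2 * q"] q(1) by auto
    define J where "J = j + 1"
    have J: "2 * q \<le> 2 ^ J" "2 ^ J \<le> 4 * q" using j by (auto simp: J_def)
    have J_le: "real J \<le> 2 * \<Lambda> + 4"
    proof -
      have "real (2 ^ J) \<le> real (4 * q)" using J(2) by (simp only: of_nat_le_iff)
      then have "ln (2 ^ J) \<le> ln (4 * real q)" using q(1) by (subst ln_le_cancel_iff) auto
      moreover have "ln (4 * real q) = 2 * ln 2 + ln q" using q(1) ln_realpow[of 2 2] by (simp add: ln_mult)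
      ultimately have "real J * ln 2 \<le> 2 * ln 2 + ln q" by (simp add: ln_realpow)
      moreover have "real J * (1 / 2) \<le> real J * ln 2" using ln_2_bounds by (intro mult_left_mono) auto
      ultimately show ?thesis using ln_2_bounds ln_q(2) by linarith
    qed
    have qm: "28 * real q * real m \<le> N powr \<beta>"
    proof -
      have "real q * real m \<le> N powr b * N powr \<kappa>" using q m by (intro mult_mono) auto
      then show ?thesis using N3 by (simp add: powr_add)
    qed
    then have "14 * real q * real m \<le> (1 / 2 - l) * N"
    proof -
      have "0 \<le> real q * real m" by simp
      then show ?thesis using N4 qm unfolding mult.assoc by linarith
    qed
    then obtain c where c: "\<And>i. i < m \<Longrightarrow> sqball (4 * q) (c i) \<subseteq> inner_box l N"
      "\<And>i z. i < m \<Longrightarrow> z \<in> sqball (4 * q) (c i) \<Longrightarrow> edist z x \<le> 28 * real q * real m"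
      "\<And>i j. i \<noteq> j \<Longrightarrow> 9 * int q \<le> \<bar>fst (c i) - fst (c j)\<bar>"
      using row_of_boxes[OF l(1) N0(1) x q(1) m(1)] by blast
    have "inner_box l N \<subseteq> intr N" using N2 l by (intro inner_box_intr) auto
    then have sub: "sqball (4 * q) (c i) \<subseteq> intr N" if "i < m" for i using c(1)[OF that] by blast
    have sep: "9 * int q \<le> \<bar>fst (c i) - fst (c j)\<bar>" if "i < m" "j < m" "i \<noteq> j" for i j
      using c(3) that(3) by blast
    have "u \<le> t * (gconst * ln q - 161) - 2 * (\<epsilon> * \<Lambda>)"
    proof -
      have "t * (gconst * (b * \<Lambda> - 1) - 161) \<le> t * (gconst * ln q - 161)"
        using ln_q par gconst_bounds by (intro mult_left_mono diff_right_mono) auto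
      then show ?thesis using N6 unfolding u_def by linarith
    qed
    have "\<exists>E\<in>events. prob E \<le> 4 * (exp (648 * pi) * exp (t * (\<epsilon> * \<Lambda>)) * (1 + 16 * real J) / m
        + 2 * ((real J + 3) * exp (- (\<epsilon> * \<Lambda>)\<^sup>2 / (2 * D)))) \<and>
      (\<forall>\<omega>\<in>space M - E. (real q)\<^sup>2 / 2 * exp (- (t\<^sup>2 * gconst * ln q / 2) - t * (\<epsilon> * \<Lambda>) - 488 * pi)
       \<le> card {y \<in> \<Union>i<m. sqball q (c i). u \<le> \<Phi> \<omega> y})"
      by (rule many_high_points[OF q(1) m(1) _ _ par(3,4) e J D \<open>u \<le> _\<close>]) (use sub sep in blast)+
    then obtain E where E: "E \<in> events"
      "prob E \<le> 4 * (exp (648 * pi) * exp (t * (\<epsilon> * \<Lambda>)) * (1 + 16 * real J) / m + 2 * ((real J + 3) * exp (- (\<epsilon> * \<Lambda>)\<^sup>2 / (2 * D))))"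
      "\<forall>\<omega>\<in>space M - E. (real q)\<^sup>2 / 2 * exp (- (t\<^sup>2 * gconst * ln q / 2) - t * (\<epsilon> * \<Lambda>) - 488 * pi)
       \<le> card {y \<in> \<Union>i<m. sqball q (c i). u \<le> \<Phi> \<omega> y}"
      by (elim bexE conjE) (rule that)
    have "prob E \<le> ?low"
    proof -
      have "1 / real m \<le> 2 * exp (- (\<kappa> * \<Lambda>))"
      proof -
        have "1 / real m \<le> 1 / (N powr \<kappa> / 2)" using m N0 by (intro divide_left_mono) auto
        also have "\<dots> = 2 * exp (- (\<kappa> * \<Lambda>))" by (simp add: powr_exp exp_minus inverse_eq_divide)
        finally show ?thesis .
      qed
      then have a: "exp (648 * pi) * exp (t * (\<epsilon> * \<Lambda>)) * (1 + 16 * real J) * (1 / m)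
         \<le> exp (648 * pi) * exp (t * (\<epsilon> * \<Lambda>)) * (1 + 16 * (2 * \<Lambda> + 4)) * (2 * exp (- (\<kappa> * \<Lambda>)))"
        using J_le N1 by (intro mult_mono) auto
      have b: "(real J + 3) * exp (- (\<epsilon>\<^sup>2 * \<Lambda> / 4)) \<le> (2 * \<Lambda> + 7) * exp (- (\<epsilon>\<^sup>2 * \<Lambda> / 4))"
        using J_le by (intro mult_right_mono) auto
      have "prob E \<le> 4 * (exp (648 * pi) * exp (t * (\<epsilon> * \<Lambda>)) * (1 + 16 * real J) * (1 / m)
          + 2 * ((real J + 3) * exp (- (\<epsilon>\<^sup>2 * \<Lambda> / 4))))"
        using E(2) unfolding tail by simp
      also have "\<dots> \<le> ?low" by (intro mult_left_mono add_mono a b) auto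
      finally show ?thesis .
    qed
    moreover have "real N powr (v - \<delta>) \<le> card (H \<omega>)" if \<omega>: "\<omega> \<in> space M - E" for \<omega>
    proof -
      have "real N powr (v - \<delta>) \<le> (real q)\<^sup>2 / 2 * exp (- (t\<^sup>2 * gconst * ln q / 2) - t * (\<epsilon> * \<Lambda>) - 488 * pi)"
      proof -
        have "t\<^sup>2 * gconst \<le> (2 * pi) * gconst" using par gconst_bounds by (intro mult_right_mono) auto
        then have "0 \<le> 2 - t\<^sup>2 * gconst / 2" using gconst_bounds(3) by simp
        then have "(2 - t\<^sup>2 * gconst / 2) * (b * \<Lambda> - 1) \<le> (2 - t\<^sup>2 * gconst / 2) * ln q"
          using ln_q by (intro mult_left_mono) auto
        then have "(v - \<delta>) * \<Lambda> \<le> (2 - t\<^sup>2 * gconst / 2) * ln q - t * (\<epsilon> * \<Lambda>) - 488 * pi - ln 2"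
          using N7 ln_2_bounds(2) by linarith
        also have "\<dots> = ln ((real q)\<^sup>2 / 2) + (- (t\<^sup>2 * gconst * ln q / 2) - t * (\<epsilon> * \<Lambda>) - 488 * pi)"
          using q(1) by (simp add: ln_div ln_realpow algebra_simps)
        finally have "exp ((v - \<delta>) * \<Lambda>) \<le> exp (ln ((real q)\<^sup>2 / 2) + (- (t\<^sup>2 * gconst * ln q / 2) - t * (\<epsilon> * \<Lambda>) - 488 * pi))"
          by simp
        then show ?thesis unfolding powr_exp exp_add using q(1) by simp
      qed
      also have "\<dots> \<le> card {y \<in> \<Union>i<m. sqball q (c i). u \<le> \<Phi> \<omega> y}" using E(3) \<omega> by blast
      also have "\<dots> \<le> card (H \<omega>)"
      proof (intro of_nat_mono card_mono subsetI)
        show "finite (H \<omega>)" unfolding H_def disc_def by (intro finite_Int) auto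
        fix y assume y: "y \<in> {y \<in> \<Union>i<m. sqball q (c i). u \<le> \<Phi> \<omega> y}"
        then obtain i where "i < m" "y \<in> sqball (4 * q) (c i)" by (force simp: sqball_def)
        then have "y \<in> inner_box l N" "edist y x \<le> N powr \<beta>" using c(1,2) qm by fastforce+
        then show "y \<in> H \<omega>" using y by (auto simp: H_def high_pts_def disc_def u_def \<Lambda>_def inner_box_def)
      qed
      finally show ?thesis .
    qed
    ultimately show ?thesis using E(1) by blast
  qed
  then obtain E1 where E1: "E1 \<in> events" "prob E1 \<le> ?low" "\<And>\<omega>. \<omega> \<in> space M - E1 \<Longrightarrow> real N powr (v - \<delta>) \<le> card (H \<omega>)"
    by blast
  have "\<exists>E\<in>events. prob E \<le> ?up \<and> (\<forall>\<omega>\<in>space M - E. card (H \<omega>) < real N powr (v + \<delta>))"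
  proof -
    \<comment> \<open>The extra 1 puts the closed Euclidean disc inside an open sup-norm
      ball.\<close>
    define k where "k = nat \<lfloor>N powr \<beta>\<rfloor> + 1"
    define n where "n = nat \<lfloor>l * N / 2\<rfloor>"
    note fl = nat_floor_bounds[OF ge1[OF \<beta>]]
    have k: "1 \<le> k" "N powr \<beta> < k" "k \<le> N powr \<beta> + 1" "k \<le> 2 * N powr \<beta>"
      using fl ge1[OF \<beta>] unfolding k_def by (simp_all; linarith)+
    have "1 \<le> l * N / 2" using N2 by simp
    note n = nat_floor_bounds[OF this, folded n_def]
    have "real k < real n" using k(3) N5 n(2) by linarith
    then have kn: "k < n" by simp
    have ln_k: "ln k \<le> \<beta> * \<Lambda> + 1"
    proof -
      have "ln k \<le> ln (2 * N powr \<beta>)" using k N0 by (subst ln_le_cancel_iff) auto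
      also have "\<dots> = ln 2 + \<beta> * \<Lambda>" by (simp add: powr_exp ln_mult)
      finally show ?thesis using ln_2_bounds by linarith
    qed
    have ln_n: "ln N - ln n \<le> ln (4 / l)"
    proof -
      have "ln N \<le> ln (4 / l * n)" using n(2) l N0 n(1) by (subst ln_le_cancel_iff) (auto simp: field_simps)
      also have "\<dots> = ln (4 / l) + ln n" using l n(1) by (subst ln_mult_pos) auto
      finally show ?thesis by simp
    qed
    have "sqball n x \<subseteq> intr N"
    proof
      fix z assume "z \<in> sqball n x"
      then have "\<bar>fst z - fst x\<bar> < int n" "\<bar>snd z - snd x\<bar> < int n" by (auto simp: sqball_def)
      then have z: "\<bar>real_of_int (fst z) - fst x\<bar> < l * N / 2" "\<bar>real_of_int (snd z) - snd x\<bar> < l * N / 2"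
        using n(3) by linarith+
      have "l / 2 * N = l * N / 2" by simp
      then have "z \<in> inner_box (l / 2) N"
        using x z unfolding inner_box_iff[OF l(1) N0(1)] inner_box_iff[OF half_gt_zero[OF l(1)] N0(1)]
        by (intro conjI; linarith)
      then show "z \<in> intr N" using inner_box_intr[of "l / 2" N] l N2 by auto
    qed
    have "0 < real N powr (v + \<delta>)" using N0 by simp
    from few_high_points[OF \<open>sqball n x \<subseteq> intr N\<close> k(1) kn D e less_imp_le[OF s] this, of u]
    obtain E where E: "E \<in> events" "prob E \<le> exp (- (\<epsilon> * \<Lambda>)\<^sup>2 / (2 * D))
      + 4 * (real k)\<^sup>2 * exp (s\<^sup>2 / 2 * (gconst * ln k + 2 * gconst * (ln N - ln n) + 807) - s * (u - \<epsilon> * \<Lambda>)) / real N powr (v + \<delta>)"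
      "\<forall>\<omega>\<in>space M - E. card {y \<in> sqball k x. u \<le> \<Phi> \<omega> y} < real N powr (v + \<delta>)"
      by (elim bexE conjE) (rule that)
    have "prob E \<le> ?up"
    proof -
      have "gconst * ln k \<le> gconst * (\<beta> * \<Lambda> + 1)" using ln_k gconst_bounds by (intro mult_left_mono) auto
      moreover have "gconst * (ln N - ln n) \<le> gconst * ln (4 / l)" using ln_n gconst_bounds by (intro mult_left_mono) auto
      moreover have "gconst * ln (4 / l) \<le> 1 * ln (4 / l)" using gconst_bounds l by (intro mult_right_mono) auto
      \<comment> \<open>808 is 807 plus the error in ln k; the distance of \<open>x\<close> from the
        boundary enters only through ln(4/l).\<close>
      ultimately have "gconst * ln k + 2 * gconst * (ln N - ln n) + 807 \<le> gconst * (\<beta> * \<Lambda>) + (808 + 2 * ln (4 / l))"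
        using gconst_bounds(2) unfolding distrib_left mult.assoc mult_1_left mult_1_right by linarith
      then have "s\<^sup>2 / 2 * (gconst * ln k + 2 * gconst * (ln N - ln n) + 807) \<le> s\<^sup>2 / 2 * (gconst * (\<beta> * \<Lambda>) + (808 + 2 * ln (4 / l)))"
        by (intro mult_left_mono) auto
      \<comment> \<open>Volume, variance and level give 2\<beta> + 2\<alpha>^2/\<beta> -
        4\<alpha>^2/\<beta>, which is exactly \<open>v\<close>.\<close>
      moreover have "2 * \<beta> * \<Lambda> + s\<^sup>2 / 2 * (gconst * (\<beta> * \<Lambda>)) - s * (u - \<epsilon> * \<Lambda>) - (v + \<delta>) * \<Lambda> = (s * \<epsilon> - \<delta>) * \<Lambda>"
      proof -
        have 1: "s\<^sup>2 / 2 * (gconst * (\<beta> * \<Lambda>)) = 2 * \<alpha>\<^sup>2 / \<beta> * \<Lambda>"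
        proof -
          have s2: "s\<^sup>2 = 4 * \<alpha>\<^sup>2 / (gconst * \<beta>\<^sup>2)"
            using gconst_bounds by (simp add: s_def power_divide power_mult_distrib)
          show ?thesis unfolding s2 using \<beta> gconst_bounds(1) by (simp add: power2_eq_square)
        qed
        have sg: "s * sqrt gconst = 2 * \<alpha> / \<beta>" using \<beta> g by (simp add: s_def)
        have "s * u = 2 * (s * sqrt gconst) * \<alpha> * \<Lambda>" by (simp add: u_def)
        then have 2: "s * u = 4 * \<alpha>\<^sup>2 / \<beta> * \<Lambda>" unfolding sg by (simp add: power2_eq_square)
        have 3: "v = 2 * \<beta> - 2 * \<alpha>\<^sup>2 / \<beta>" using \<beta> by (simp add: v_def power_divide power2_eq_square right_diff_distrib)
        show ?thesis unfolding 1 right_diff_distrib 2 3 by (simp add: algebra_simps)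
      qed
      moreover have "(s * \<epsilon> - \<delta>) * \<Lambda> \<le> - (\<delta> / 2) * \<Lambda>" using par(6) N1 unfolding s_def by (intro mult_right_mono) auto
      ultimately have ex: "2 * \<beta> * \<Lambda> + (s\<^sup>2 / 2 * (gconst * ln k + 2 * gconst * (ln N - ln n) + 807) - s * (u - \<epsilon> * \<Lambda>)) - (v + \<delta>) * \<Lambda>
          \<le> s\<^sup>2 / 2 * (808 + 2 * ln (4 / l)) - \<delta> / 2 * \<Lambda>"
        unfolding distrib_left[of "s\<^sup>2 / 2" "gconst * (\<beta> * \<Lambda>)"] by linarith
      have "4 * (real k)\<^sup>2 \<le> 4 * (2 * N powr \<beta>)\<^sup>2" using k(4) by (intro mult_left_mono power_mono) auto
      also have "\<dots> = 16 * exp (2 * \<beta> * \<Lambda>)" by (simp add: powr_exp power_mult_distrib exp_double mult.assoc)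
      finally have "4 * (real k)\<^sup>2 * exp (s\<^sup>2 / 2 * (gconst * ln k + 2 * gconst * (ln N - ln n) + 807) - s * (u - \<epsilon> * \<Lambda>)) / real N powr (v + \<delta>)
        \<le> 16 * exp (2 * \<beta> * \<Lambda>) * exp (s\<^sup>2 / 2 * (gconst * ln k + 2 * gconst * (ln N - ln n) + 807) - s * (u - \<epsilon> * \<Lambda>)) / real N powr (v + \<delta>)"
        by (intro divide_right_mono mult_right_mono) auto
      also have "\<dots> = 16 * exp (2 * \<beta> * \<Lambda> + (s\<^sup>2 / 2 * (gconst * ln k + 2 * gconst * (ln N - ln n) + 807) - s * (u - \<epsilon> * \<Lambda>)) - (v + \<delta>) * \<Lambda>)"
        unfolding powr_exp exp_diff exp_add by simp
      also have "\<dots> \<le> 16 * exp (s\<^sup>2 / 2 * (808 + 2 * ln (4 / l)) - \<delta> / 2 * \<Lambda>)"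
        using ex by (intro mult_left_mono) auto
      also have "\<dots> = 16 * exp (s\<^sup>2 / 2 * (808 + 2 * ln (4 / l))) * exp (- (\<delta> / 2 * \<Lambda>))"
        unfolding diff_conv_add_uminus exp_add by simp
      finally show ?thesis using E(2) unfolding tail by linarith
    qed
    moreover have "card (H \<omega>) < real N powr (v + \<delta>)" if \<omega>: "\<omega> \<in> space M - E" for \<omega>
    proof -
      have "card (H \<omega>) \<le> card {y \<in> sqball k x. u \<le> \<Phi> \<omega> y}"
      proof (intro card_mono subsetI)
        fix y assume y: "y \<in> H \<omega>"
        then have d: "edist y x \<le> N powr \<beta>" "u \<le> \<Phi> \<omega> y" by (auto simp: H_def high_pts_def disc_def u_def \<Lambda>_def)
        have "\<bar>real_of_int (fst y - fst x)\<bar> \<le> edist y x" "\<bar>real_of_int (snd y - snd x)\<bar> \<le> edist y x"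
          unfolding edist_def by (rule real_sqrt_ge_abs1, rule real_sqrt_ge_abs2)
        then have "\<bar>real_of_int (fst y - fst x)\<bar> < k" "\<bar>real_of_int (snd y - snd x)\<bar> < k" using d k(2) by linarith+
        then have "y \<in> sqball k x" unfolding sqball_def by (simp del: of_int_diff) linarith
        then show "y \<in> {y \<in> sqball k x. u \<le> \<Phi> \<omega> y}" using d by simp
      qed simp
      moreover have "card {y \<in> sqball k x. u \<le> \<Phi> \<omega> y} < real N powr (v + \<delta>)" using E(3) \<omega> by blast
      ultimately show ?thesis by linarith
    qed
    ultimately show ?thesis using E(1) by blast
  qed
  then obtain E2 where E2: "E2 \<in> events" "prob E2 \<le> ?up" "\<And>\<omega>. \<omega> \<in> space M - E2 \<Longrightarrow> card (H \<omega>) < real N powr (v + \<delta>)"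
    by blast
  have "?bad \<subseteq> E1 \<union> E2"
  proof
    fix \<omega> assume \<omega>: "\<omega> \<in> ?bad"
    show "\<omega> \<in> E1 \<union> E2"
    proof (rule ccontr)
      assume "\<omega> \<notin> E1 \<union> E2"
      then have c: "real N powr (v - \<delta>) \<le> card (H \<omega>)" "card (H \<omega>) < real N powr (v + \<delta>)"
        using \<omega> E1(3) E2(3) by auto
      \<comment> \<open>The lower bound on the count also excludes the alternative k = 0.\<close>
      have "0 < real N powr (v - \<delta>)" using N0 by simp
      then have pos: "0 < real (card (H \<omega>))" using c(1) by linarith
      have "ln (real N powr (v - \<delta>)) \<le> ln (card (H \<omega>))" using c(1) pos N0 by (subst ln_le_cancel_iff) auto
      moreover have "ln (card (H \<omega>)) \<le> ln (real N powr (v + \<delta>))" using c(2) pos N0 by (subst ln_le_cancel_iff) auto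
      ultimately have "(v - \<delta>) * \<Lambda> \<le> ln (card (H \<omega>))" "ln (card (H \<omega>)) \<le> (v + \<delta>) * \<Lambda>" by (simp_all add: powr_exp)
      then have "v - \<delta> \<le> ln (card (H \<omega>)) / \<Lambda>" "ln (card (H \<omega>)) / \<Lambda> \<le> v + \<delta>" using N1 by (simp_all add: field_simps)
      moreover have H_eq: "high_pts l N \<alpha> (\<Phi> \<omega>) \<inter> disc N x (real N powr \<beta>) = H \<omega>" by (simp add: H_def)
      ultimately show False using \<omega> pos unfolding Let_def \<Lambda>_def[symmetric] v_def[symmetric] by (auto simp: H_eq)
    qed
  qed
  then have "measure M ?bad \<le> prob (E1 \<union> E2)" using E1(1) E2(1) by (intro finite_measure_mono) auto
  also have "\<dots> \<le> prob E1 + prob E2" using E1(1) E2(1) by (rule measure_Un_le)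
  finally show ?thesis using E1(2) E2(2) by linarith
qed

end

theorem theorem1p4:
  fixes l \<alpha> \<beta> \<delta> :: real
    and M :: "nat \<Rightarrow> 'a measure" and \<Phi> :: "nat \<Rightarrow> 'a \<Rightarrow> pt \<Rightarrow> real"
  assumes "0 < l" "l < 1/2" "0 < \<alpha>" "\<alpha> < \<beta>" "\<beta> < 1" "0 < \<delta>"
    and gff: "\<And>N. N \<ge> 1 \<Longrightarrow> is_gff (M N) N (\<Phi> N)"
  shows "(\<lambda>N. Max ((\<lambda>x. measure (M N)
            {\<omega> \<in> space (M N).
              let k = card (high_pts l N \<alpha> (\<Phi> N \<omega>) \<inter> disc N x (real N powr \<beta>)) in
              k = 0 \<or>
              \<bar>ln (real k) / ln (real N) - 2 * \<beta> * (1 - (\<alpha> / \<beta>)\<^sup>2)\<bar> > \<delta>}) ` inner_box l N))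
         \<longlonglongrightarrow> 0"
proof -
  define bad where "bad = (\<lambda>N x. measure (M N)
            {\<omega> \<in> space (M N).
              let k = card (high_pts l N \<alpha> (\<Phi> N \<omega>) \<inter> disc N x (real N powr \<beta>)) in
              k = 0 \<or>
              \<bar>ln (real k) / ln (real N) - 2 * \<beta> * (1 - (\<alpha> / \<beta>)\<^sup>2)\<bar> > \<delta>})"
  obtain b t \<epsilon> where par: "0 < b" "b < \<beta>" "0 < t" "t\<^sup>2 \<le> 2 * pi" "0 < \<epsilon>"
    "2 * sqrt gconst * \<alpha> + 2 * \<epsilon> < t * gconst * b" "t * \<epsilon> < (\<beta> - b) / 2"
    "2 * \<beta> * (1 - (\<alpha> / \<beta>)\<^sup>2) - \<delta> < b * (2 - t\<^sup>2 * gconst / 2) - t * \<epsilon>"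
    "(2 * \<alpha> / (sqrt gconst * \<beta>)) * \<epsilon> \<le> \<delta> / 2"
    using choose_parameters[OF assms(3,4,6)] by blast
  \<comment> \<open>Half of the gap: a row of N^\<kappa> boxes of radius N^b spans about N^(b +
    \<kappa>), still of smaller order than N^\<beta>.\<close>
  define \<kappa> where "\<kappa> = (\<beta> - b) / 2"
  define C where "C = 16 * exp ((2 * \<alpha> / (sqrt gconst * \<beta>))\<^sup>2 / 2 * (808 + 2 * ln (4 / l)))"
  define bound where "bound = (\<lambda>\<Lambda>. 4 * (exp (648 * pi) * exp (t * (\<epsilon> * \<Lambda>)) * (1 + 16 * (2 * \<Lambda> + 4)) * (2 * exp (- (\<kappa> * \<Lambda>)))
        + 2 * ((2 * \<Lambda> + 7) * exp (- (\<epsilon>\<^sup>2 * \<Lambda> / 4))))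
      + (exp (- (\<epsilon>\<^sup>2 * \<Lambda> / 4)) + C * exp (- (\<delta> / 2 * \<Lambda>))))"
  have ln_top: "filterlim (\<lambda>N. ln (real N)) at_top sequentially" by real_asymp
  have "(bound \<longlongrightarrow> 0) at_top"
  proof -
    have exps: "((\<lambda>\<Lambda>. (c1 * \<Lambda> + c2) * exp (- (c * \<Lambda>))) \<longlongrightarrow> 0) at_top" if "0 < c" for c c1 c2 :: real
    proof -
      have "((\<lambda>\<Lambda>. \<Lambda> * exp (- (c * \<Lambda>))) \<longlongrightarrow> 0) at_top" "((\<lambda>\<Lambda>. exp (- (c * \<Lambda>))) \<longlongrightarrow> 0) at_top"
        using that by real_asymp+
      then have "((\<lambda>\<Lambda>. c1 * (\<Lambda> * exp (- (c * \<Lambda>))) + c2 * exp (- (c * \<Lambda>))) \<longlongrightarrow> c1 * 0 + c2 * 0) at_top"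
        by (intro tendsto_intros)
      then show ?thesis by (simp add: algebra_simps)
    qed
    \<comment> \<open>The gain N^(-\<kappa>) from many boxes beats the loss N^(t\<epsilon>) from the
      slack in the truncation.\<close>
    have "0 < \<kappa> - t * \<epsilon>" "0 < \<epsilon>\<^sup>2 / 4" "0 < \<delta> / 2" using par assms(6) by (auto simp: \<kappa>_def)
    note lims = exps[OF this(1), of 32 65] exps[OF this(2), of 2 7] exps[OF this(2), of 0 1] exps[OF this(3), of 0 1]
    have lim_sum: "((\<lambda>\<Lambda>. 4 * (2 * exp (648 * pi) * ((32 * \<Lambda> + 65) * exp (- ((\<kappa> - t * \<epsilon>) * \<Lambda>))) + 2 * ((2 * \<Lambda> + 7) * exp (- (\<epsilon>\<^sup>2 / 4 * \<Lambda>))))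
      + ((0 * \<Lambda> + 1) * exp (- (\<epsilon>\<^sup>2 / 4 * \<Lambda>)) + C * ((0 * \<Lambda> + 1) * exp (- (\<delta> / 2 * \<Lambda>)))))
      \<longlongrightarrow> 4 * (2 * exp (648 * pi) * 0 + 2 * 0) + (0 + C * 0)) at_top"
      using lims by (intro tendsto_intros)
    have "bound \<Lambda> = 4 * (2 * exp (648 * pi) * ((32 * \<Lambda> + 65) * exp (- ((\<kappa> - t * \<epsilon>) * \<Lambda>))) + 2 * ((2 * \<Lambda> + 7) * exp (- (\<epsilon>\<^sup>2 / 4 * \<Lambda>))))
      + ((0 * \<Lambda> + 1) * exp (- (\<epsilon>\<^sup>2 / 4 * \<Lambda>)) + C * ((0 * \<Lambda> + 1) * exp (- (\<delta> / 2 * \<Lambda>))))" for \<Lambda>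
    proof -
      have "exp (- ((\<kappa> - t * \<epsilon>) * \<Lambda>)) = exp (t * (\<epsilon> * \<Lambda>)) * exp (- (\<kappa> * \<Lambda>))"
        by (simp add: algebra_simps flip: exp_add)
      then show ?thesis by (simp add: bound_def algebra_simps)
    qed
    then have bound_eq: "bound = (\<lambda>\<Lambda>. 4 * (2 * exp (648 * pi) * ((32 * \<Lambda> + 65) * exp (- ((\<kappa> - t * \<epsilon>) * \<Lambda>))) + 2 * ((2 * \<Lambda> + 7) * exp (- (\<epsilon>\<^sup>2 / 4 * \<Lambda>))))
      + ((0 * \<Lambda> + 1) * exp (- (\<epsilon>\<^sup>2 / 4 * \<Lambda>)) + C * ((0 * \<Lambda> + 1) * exp (- (\<delta> / 2 * \<Lambda>)))))"
      by blast
    show ?thesis unfolding bound_eq using lim_sum by simp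
  qed
  then have lim: "(\<lambda>N. bound (ln (real N))) \<longlonglongrightarrow> 0"
    using ln_top by (rule filterlim_compose)
  have "\<forall>\<^sub>F N in sequentially. 161 \<le> ln (real N)"
    using ln_top by (simp add: filterlim_at_top)
  moreover have "\<forall>\<^sub>F N in sequentially. 8 \<le> l * real N" using assms(1) by real_asymp
  moreover have "\<forall>\<^sub>F N in sequentially. 28 * real N powr (b + \<kappa>) \<le> real N powr \<beta>"
  proof -
    have "0 < \<kappa>" "\<beta> = (b + \<kappa>) + \<kappa>" using par by (auto simp: \<kappa>_def field_simps)
    have "\<forall>\<^sub>F N in sequentially. 28 \<le> real N powr \<kappa>" using \<open>0 < \<kappa>\<close> by real_asymp
    then show ?thesis
    proof eventually_elim
      case (elim N)
      then have "28 * real N powr (b + \<kappa>) \<le> real N powr \<kappa> * real N powr (b + \<kappa>)" by (intro mult_right_mono) auto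
      also have "\<dots> = real N powr \<beta>" using \<open>\<beta> = (b + \<kappa>) + \<kappa>\<close> by (metis powr_add add.commute)
      finally show ?case .
    qed
  qed
  moreover have "\<forall>\<^sub>F N in sequentially. real N powr \<beta> \<le> (1 / 2 - l) * real N"
  proof -
    define a where "a = 1 / 2 - l"
    have "0 < a" "\<beta> < 1" using assms by (auto simp: a_def)
    then have "\<forall>\<^sub>F N in sequentially. real N powr \<beta> \<le> a * real N" using assms(3,4) by real_asymp
    then show ?thesis by (simp add: a_def)
  qed
  moreover have "\<forall>\<^sub>F N in sequentially. real N powr \<beta> + 1 < l * real N / 4"
    using assms(1,3,4,5) by real_asymp
  moreover have "\<forall>\<^sub>F N in sequentially. 2 * sqrt gconst * \<alpha> * ln (real N) \<le> t * (gconst * (b * ln (real N) - 1) - 161) - 2 * (\<epsilon> * ln (real N))"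
  proof -
    define d where "d = t * gconst * b - (2 * sqrt gconst * \<alpha> + 2 * \<epsilon>)"
    have "0 < d" using par by (simp add: d_def)
    then have "\<forall>\<^sub>F N in sequentially. t * gconst + 161 * t \<le> d * ln (real N)" by real_asymp
    then show ?thesis by eventually_elim (simp add: d_def algebra_simps)
  qed
  moreover have "\<forall>\<^sub>F N in sequentially. (2 * \<beta> * (1 - (\<alpha> / \<beta>)\<^sup>2) - \<delta>) * ln (real N)
      \<le> (2 - t\<^sup>2 * gconst / 2) * (b * ln (real N) - 1) - t * (\<epsilon> * ln (real N)) - 488 * pi - 1"
  proof -
    define v where "v = 2 * \<beta> * (1 - (\<alpha> / \<beta>)\<^sup>2) - \<delta>"
    define a where "a = 2 - t\<^sup>2 * gconst / 2"
    define d where "d = b * a - t * \<epsilon> - v"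
    have "0 < d" using par(8) by (simp add: d_def a_def v_def)
    then have "\<forall>\<^sub>F N in sequentially. a + 488 * pi + 1 \<le> d * ln (real N)" by real_asymp
    then have "\<forall>\<^sub>F N in sequentially. v * ln (real N) \<le> a * (b * ln (real N) - 1) - t * (\<epsilon> * ln (real N)) - 488 * pi - 1"
      by eventually_elim (simp add: d_def algebra_simps)
    then show ?thesis by (simp add: v_def a_def)
  qed
  ultimately have ev: "\<forall>\<^sub>F N in sequentially. 0 \<le> Max (bad N ` inner_box l N) \<and> Max (bad N ` inner_box l N) \<le> bound (ln (real N))"
    using eventually_ge_at_top[of 1]
  proof eventually_elim
    case (elim N)
    interpret gff "M N" N "\<Phi> N" by standard (rule gff[OF elim(8)])
    have fin: "finite (bad N ` inner_box l N)" by (simp add: inner_box_def)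
    have ne: "bad N ` inner_box l N \<noteq> {}" using inner_box_nonempty[OF assms(1,2) elim(8)] by simp
    have "bad N x \<le> bound (ln (real N))" if "x \<in> inner_box l N" for x
      using atypical_count_bound[OF assms(1-6) par(1-5,9) elim(1,2) elim(3)[unfolded \<kappa>_def] elim(4-7) that]
      by (simp only: bad_def bound_def C_def \<kappa>_def)
    moreover have "0 \<le> bad N x" for x by (simp add: bad_def)
    ultimately show ?case using fin ne by (auto simp: Max_ge_iff)
  qed
  have "(\<lambda>N. Max (bad N ` inner_box l N)) \<longlonglongrightarrow> 0"
    by (rule tendsto_sandwich[OF _ _ tendsto_const lim]) (use ev in \<open>auto elim: eventually_mono\<close>)
  then show ?thesis unfolding bad_def .
qed

end
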